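(* Assume the entries $w_{ij}$ are i.i.d. positive with mean $\mu>0$, variance $\sigma^2>0$ and $\mathbb{E}|w_{11}-\mu|^4<\infty$, and that $c_N=p/N\to c\in(0,\infty)$ as $p,N\to\infty$. Then, with probability one, the empirical spectral distribution of $\boldsymbol{B}_{p,N}$ converges weakly to a deterministic probability distribution which has density function $$f(x)=\begin{cases}\dfrac{\mu^2}{2\pi c\,\sigma^2 x}\sqrt{(b-x)(x-a)}, & x\in[a,b],\\ 0,&\text{otherwise,}\end{cases}$$ and a point mass $1-1/c$ at $x=0$ if $c>1$, where $a=\frac{\sigma^2}{\mu^2}(1-\sqrt c)^2$ and $b=\frac{\sigma^2}{\mu^2}(1+\sqrt c)^2$.
   Context: Let $\{w_{ij}: i,j\ge 1\}$ be a double array of random variables; for each $n\ge 2$ put $N=n-1$, $p=p(n)$, and use the entries with $1\le i\le n$, $1\le j\le p$. The compositional data matrix is the $n\times p$ matrix $\boldsymbol{X}_n=(x_{ij})$ with $x_{ij}=w_{ij}/\sum_{\ell=1}^p w_{i\ell}$. Let $\boldsymbol{C}_n=\boldsymbol{I}_n-\frac1n\boldsymbol{1}_n\boldsymbol{1}_n'$, where $\boldsymbol{1}_n$ is the all-ones vector, and $$\boldsymbol{B}_{p,N}=\frac{p^2}{N}\boldsymbol{X}_n'\boldsymbol{C}_n\boldsymbol{X}_n .$$ The empirical spectral distribution of a $p\times p$ Hermitian matrix with eigenvalues $\lambda_1,\dots,\lambda_p$ is the distribution function $x\mapsto \frac1p\sum_{i=1}^p I_{\{\lambda_i\le x\}}$.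 *)

theory Defs
  imports "HOL-Probability.Probability" "Jordan_Normal_Form.Char_Poly"
begin

text \<open>
  Row \<open>i\<close>, column \<open>j\<close> of a matrix of type \<open>real mat\<close> is counted from \<open>0\<close>, whereas the array
  \<open>w\<close> is indexed from \<open>1\<close>; hence the shift by \<open>Suc\<close>.
\<close>

definition compositional_mat :: "(nat \<Rightarrow> nat \<Rightarrow> real) \<Rightarrow> nat \<Rightarrow> nat \<Rightarrow> real Matrix.mat" where
  "compositional_mat w n p =
     Matrix.mat n p (\<lambda>(i, j). w (Suc i) (Suc j) / (\<Sum>l = 1..p. w (Suc i) l))"

definition ones_col :: "nat \<Rightarrow> real Matrix.mat" where
  "ones_col n = Matrix.mat n 1 (\<lambda>_. 1)"

definition centering_mat :: "nat \<Rightarrow> real Matrix.mat" where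
  "centering_mat n = 1\<^sub>m n - (1 / real n) \<cdot>\<^sub>m (ones_col n * transpose_mat (ones_col n))"

definition B_mat :: "(nat \<Rightarrow> nat \<Rightarrow> real) \<Rightarrow> nat \<Rightarrow> nat \<Rightarrow> real Matrix.mat" where
  "B_mat w n p =
     ((real p)\<^sup>2 / real (n - 1)) \<cdot>\<^sub>m
       (transpose_mat (compositional_mat w n p) * centering_mat n * compositional_mat w n p)"

text \<open>
  Eigenvalues are counted with multiplicity, as the multiset of real roots of the characteristic
  polynomial. For a real symmetric matrix, in particular for \<open>B_mat w n p\<close>, all complex roots
  are real, so this multiset has exactly \<open>dim_row A\<close> elements.
\<close>

definition eigenvalues :: "real Matrix.mat \<Rightarrow> real multiset" where
  "eigenvalues A = proots (char_poly A)"

definition esd :: "real Matrix.mat \<Rightarrow> real \<Rightarrow> real" where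
  "esd A x = real (size {#l \<in># eigenvalues A. l \<le> x#}) / real (dim_row A)"

definition mp_density :: "real \<Rightarrow> real \<Rightarrow> real \<Rightarrow> real \<Rightarrow> real" where
  "mp_density \<mu> \<sigma> c x =
     (let a = \<sigma>\<^sup>2 / \<mu>\<^sup>2 * (1 - sqrt c)\<^sup>2;
          b = \<sigma>\<^sup>2 / \<mu>\<^sup>2 * (1 + sqrt c)\<^sup>2
      in if x \<in> {a..b}
         then \<mu>\<^sup>2 / (2 * pi * c * \<sigma>\<^sup>2 * x) * sqrt ((b - x) * (x - a))
         else 0)"

end

theory Submission
  imports Defs "HOL-Real_Asymp.Real_Asymp"
begin

text \<open>
  The Stieltjes transform is only evaluated on the negative half-line, where everything is real:
  for a positive semidefinite matrix one studies the trace of \<open>(A + t)\<inverse>\<close>, \<open>t > 0\<close>.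
  With \<open>z\<^sub>i\<^sub>j = (w\<^sub>i\<^sub>j - \<mu>) / (m\<^sub>i \<surd>N)\<close>, where \<open>m\<^sub>i\<close> is the mean of row \<open>i\<close>, the matrix \<open>B\<close> and the Gram
  matrix \<open>S = \<Sum> z\<^sub>i z\<^sub>i'\<close> differ by three rank-one terms, so their resolvent traces differ by \<open>O(1/t)\<close>.
  Replacing one row changes the trace by at most \<open>1/t\<close>; the bounded difference inequality and
  Borel-Cantelli reduce the claim to the expected trace. By Sherman-Morrison,
  \<open>p - t tr G = \<Sum>\<^sub>i (1 - 1 / (1 + q\<^sub>i))\<close> with \<open>q\<^sub>i = z\<^sub>i' G\<^sub>i z\<^sub>i\<close> and \<open>G\<^sub>i\<close> independent of row \<open>i\<close>. Since
  \<open>1 / (1 + q\<^sub>i) = m\<^sub>i\<^sup>2 / (m\<^sub>i\<^sup>2 + Q\<^sub>i)\<close> for a quadratic form \<open>Q\<^sub>i\<close> in independent centred entries, row means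
  close to \<open>0\<close> do no harm, and a second moment bound shows that the limit \<open>s\<close> of the normalised trace
  solves \<open>1 - t s = \<gamma> s / (1 + \<gamma> c s)\<close>, \<open>\<gamma> = \<sigma>\<^sup>2 / \<mu>\<^sup>2\<close>, whose nonnegative root is the Stieltjes
  transform of the Marchenko-Pastur law. Expanding in powers of \<open>1 - t\<close> turns convergence of these
  transforms into convergence of the moments of \<open>1 / (1 + x)\<close>, and Weierstrass gives weak convergence.
\<close>

section \<open>Resolvents of positive semidefinite matrices\<close>

unbundle no inner_syntax
unbundle no vec_syntax
hide_const (open) Finite_Cartesian_Product.mat Finite_Cartesian_Product.vec Determinants.det
  Finite_Cartesian_Product.row Finite_Cartesian_Product.transpose Finite_Cartesian_Product.column

text \<open>After normalisation the entries of a row share the denominator m_i, so a row is not a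
  vector of independent entries, and m_i may come arbitrarily close to 0. This dependence is
  confined to one scalar per row: m_i leaves the quadratic form as the factor 1 / (N m_i^2), and
  (m^2, Q) -> m^2 / (m^2 + Q) obeys a Lipschitz bound at the limit point whose constant is 1 /
  \<mu>^2. An L^1 estimate for m_i^2 - \<mu>^2 therefore suffices, without truncation or a lower
  bound on the row means. Two kinds of control are combined. The fourth moment gives only a second
  moment bound for Q_i, which serves expectations but yields no summable tails; summable tails come
  from bounded differences, where the increment 1/t does not depend on the size of the replaced row.
  The limit equation is stable without compactness: one side decreases in s with slope -t and the
  other increases, so a small residual forces a small error. Only countably many t accumulating at 1
  are used, so a single null set covers them all.\<close>

definition psd :: "nat \<Rightarrow> real mat \<Rightarrow> bool" where
  "psd m A \<longleftrightarrow> A \<in> carrier_mat m m \<and> A\<^sup>T = A \<and>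
     (\<forall>v \<in> carrier_vec m. 0 \<le> v \<bullet> (A *\<^sub>v v))"

definition mtrace :: "real mat \<Rightarrow> real" where
  "mtrace A = (\<Sum>i < dim_row A. A $$ (i, i))"

definition outer :: "real vec \<Rightarrow> real vec \<Rightarrow> real mat" where
  "outer v w = mat (dim_vec v) (dim_vec w) (\<lambda>(i, j). v $ i * w $ j)"

definition shift_mat :: "real \<Rightarrow> real mat \<Rightarrow> real mat" where
  "shift_mat t A = A + t \<cdot>\<^sub>m 1\<^sub>m (dim_row A)"

text \<open>Cramer's rule makes the inverse a total function whose entries are rational in the
  entries of \<open>A\<close>. This gives measurability directly and ties the trace to the cofactors
  that occur in the derivative of the characteristic polynomial.\<close>

definition resolvent :: "real \<Rightarrow> real mat \<Rightarrow> real mat" where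
  "resolvent t A = (1 / det (shift_mat t A)) \<cdot>\<^sub>m adj_mat (shift_mat t A)"

lemma outer_carrier [simp]: "v \<in> carrier_vec m \<Longrightarrow> w \<in> carrier_vec m \<Longrightarrow> outer v w \<in> carrier_mat m m"
  by (simp add: outer_def)

lemma outer_mult_vec:
  assumes "v \<in> carrier_vec m" "w \<in> carrier_vec m" "x \<in> carrier_vec m"
  shows "outer v w *\<^sub>v x = (w \<bullet> x) \<cdot>\<^sub>v v"
  by (rule eq_vecI) (use assms in \<open>auto simp: outer_def scalar_prod_def sum_distrib_left sum_distrib_right mult_ac\<close>)

lemma scalar_prod_self_nonneg: "0 \<le> v \<bullet> (v :: real vec)"
  by (auto simp: scalar_prod_def intro: sum_nonneg)

lemma scalar_prod_self_eq_0:
  assumes "v \<in> carrier_vec m" "v \<bullet> (v :: real vec) = 0" shows "v = 0\<^sub>v m"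
proof (rule eq_vecI)
  fix i assume "i < dim_vec (0\<^sub>v m :: real vec)"
  hence i: "i < m" by simp
  have "\<forall>i\<in>{0..<m}. v $ i * v $ i = 0"
    using assms by (subst sum_nonneg_eq_0_iff[symmetric]) (auto simp: scalar_prod_def)
  thus "v $ i = 0\<^sub>v m $ i" using i by auto
qed (use assms in auto)

lemma scalar_prod_Cauchy_Schwarz:
  assumes "v \<in> carrier_vec m" "w \<in> carrier_vec m"
  shows "(v \<bullet> w)\<^sup>2 \<le> (v \<bullet> v) * (w \<bullet> (w :: real vec))"
  using Cauchy_Schwarz_ineq_sum[of "\<lambda>i. v $ i" "\<lambda>i. w $ i" "{0..<m}"] assms
  by (simp add: scalar_prod_def power2_eq_square)

section \<open>Existence and norm bounds of the resolvent\<close>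

lemma shift_carrier [simp]: "A \<in> carrier_mat m m \<Longrightarrow> shift_mat t A \<in> carrier_mat m m"
  by (simp add: shift_mat_def)

lemma shift_mult_vec:
  assumes "A \<in> carrier_mat m m" "v \<in> carrier_vec m"
  shows "shift_mat t A *\<^sub>v v = A *\<^sub>v v + t \<cdot>\<^sub>v v"
proof -
  have "(t \<cdot>\<^sub>m 1\<^sub>m m) *\<^sub>v v = t \<cdot>\<^sub>v v"
    by (rule eq_vecI) (use assms in \<open>auto simp: scalar_prod_def sum.delta' if_distrib if_distribR cong: if_cong\<close>)
  thus ?thesis using assms by (simp add: shift_mat_def add_mult_distrib_mat_vec[of _ m m])
qed

lemma psd_shift_ge:
  assumes "psd m A" "v \<in> carrier_vec m"
  shows "t * (v \<bullet> v) \<le> v \<bullet> (shift_mat t A *\<^sub>v v)"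
proof -
  have "v \<bullet> (shift_mat t A *\<^sub>v v) = v \<bullet> (A *\<^sub>v v) + t * (v \<bullet> v)"
    using assms by (auto simp: psd_def shift_mult_vec[of _ m] intro!: scalar_prod_add_distrib[of _ m, THEN trans])
  thus ?thesis using assms by (auto simp: psd_def)
qed

text \<open>A kernel vector v of A + t would satisfy t |v|^2 <= v' (A + t) v = 0.\<close>

lemma det_shift_nonzero:
  assumes "psd m A" "0 < t"
  shows "det (shift_mat t A) \<noteq> 0"
proof
  assume "det (shift_mat t A) = 0"
  then obtain v where v: "v \<in> carrier_vec m" "v \<noteq> 0\<^sub>v m" "shift_mat t A *\<^sub>v v = 0\<^sub>v m"
    using det_0_iff_vec_prod_zero_field[of "shift_mat t A" m] assms by (auto simp: psd_def)
  have "t * (v \<bullet> v) \<le> 0" using psd_shift_ge[OF assms(1) v(1), of t] v by simp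
  hence "v \<bullet> v = 0" using assms(2) scalar_prod_self_nonneg[of v]
    by (simp add: mult_le_0_iff)
  thus False using scalar_prod_self_eq_0[OF v(1)] v(2) by simp
qed

lemma resolvent_carrier [simp]:
  "A \<in> carrier_mat m m \<Longrightarrow> resolvent t A \<in> carrier_mat m m"
  by (simp add: resolvent_def adj_mat(1)[of _ m])

lemma resolvent_inverse:
  assumes "psd m A" "0 < t"
  shows "shift_mat t A * resolvent t A = 1\<^sub>m m" "resolvent t A * shift_mat t A = 1\<^sub>m m"
proof -
  have A: "shift_mat t A \<in> carrier_mat m m" using assms by (simp add: psd_def)
  note adj = adj_mat[OF A]
  have 1: "(1 / det (shift_mat t A)) \<cdot>\<^sub>m (det (shift_mat t A) \<cdot>\<^sub>m 1\<^sub>m m) = 1\<^sub>m m"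
    by (rule eq_matI) (use det_shift_nonzero[OF assms] in auto)
  show "shift_mat t A * resolvent t A = 1\<^sub>m m"
    unfolding resolvent_def using A adj 1 by (simp add: mult_smult_distrib[of _ m m _ m])
  show "resolvent t A * shift_mat t A = 1\<^sub>m m"
    unfolding resolvent_def using A adj 1 by (simp add: mult_smult_assoc_mat[of _ m m _ m])
qed

lemma shift_resolvent_vec:
  assumes "psd m A" "0 < t" "v \<in> carrier_vec m"
  shows "shift_mat t A *\<^sub>v (resolvent t A *\<^sub>v v) = v" "resolvent t A *\<^sub>v (shift_mat t A *\<^sub>v v) = v"
proof -
  have A: "A \<in> carrier_mat m m" using assms by (simp add: psd_def)
  show "shift_mat t A *\<^sub>v (resolvent t A *\<^sub>v v) = v"
    using A assms(3) resolvent_inverse[OF assms(1,2)]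
    by (metis assoc_mult_mat_vec one_mult_mat_vec resolvent_carrier shift_carrier)
  show "resolvent t A *\<^sub>v (shift_mat t A *\<^sub>v v) = v"
    using A assms(3) resolvent_inverse[OF assms(1,2)]
    by (metis assoc_mult_mat_vec one_mult_mat_vec resolvent_carrier shift_carrier)
qed

text \<open>Insert u = G v into u' (A + t) u >= t |u|^2 and use (A + t) u = v.\<close>

lemma quad_resolvent_ge:
  assumes "psd m A" "0 < t" "v \<in> carrier_vec m"
  shows "t * ((resolvent t A *\<^sub>v v) \<bullet> (resolvent t A *\<^sub>v v)) \<le> v \<bullet> (resolvent t A *\<^sub>v v)"
proof -
  define u where "u = resolvent t A *\<^sub>v v"
  have u: "u \<in> carrier_vec m" using assms by (auto simp: u_def psd_def intro!: mult_mat_vec_carrier)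
  have "t * (u \<bullet> u) \<le> u \<bullet> (shift_mat t A *\<^sub>v u)" by (rule psd_shift_ge[OF assms(1) u])
  also have "\<dots> = v \<bullet> u" using shift_resolvent_vec(1)[OF assms] comm_scalar_prod[OF u assms(3)] by (simp add: u_def)
  finally show ?thesis by (simp add: u_def)
qed

lemma quad_resolvent_nonneg:
  assumes "psd m A" "0 < t" "v \<in> carrier_vec m"
  shows "0 \<le> v \<bullet> (resolvent t A *\<^sub>v v)"
  using quad_resolvent_ge[OF assms] assms(2) scalar_prod_self_nonneg[of "resolvent t A *\<^sub>v v"]
  by (meson mult_nonneg_nonneg less_imp_le order_trans)

text \<open>No diagonalisation is involved: with u = G v and q = v' u, Cauchy-Schwarz gives q^2 <=
  |v|^2 |u|^2, and t |u|^2 <= q turns this into t q <= |v|^2 and then t^2 |u|^2 <= |v|^2.\<close>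

lemma quad_resolvent_le:
  assumes "psd m A" "0 < t" "v \<in> carrier_vec m"
  shows "v \<bullet> (resolvent t A *\<^sub>v v) \<le> (v \<bullet> v) / t"
    and "(resolvent t A *\<^sub>v v) \<bullet> (resolvent t A *\<^sub>v v) \<le> (v \<bullet> v) / t\<^sup>2"
proof -
  define u where "u = resolvent t A *\<^sub>v v"
  have u: "u \<in> carrier_vec m" using assms by (auto simp: u_def psd_def intro!: mult_mat_vec_carrier)
  define q where "q = v \<bullet> u"
  have q: "t * (u \<bullet> u) \<le> q" "0 \<le> q"
    using quad_resolvent_ge[OF assms] quad_resolvent_nonneg[OF assms] by (auto simp: q_def u_def)
  have cs: "q\<^sup>2 \<le> (v \<bullet> v) * (u \<bullet> u)" unfolding q_def by (rule scalar_prod_Cauchy_Schwarz[OF assms(3) u])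
  have le: "q * t \<le> v \<bullet> v"
  proof (cases "q = 0")
    case False
    have "t * q\<^sup>2 \<le> (v \<bullet> v) * (t * (u \<bullet> u))" using cs assms(2) by (simp add: mult_left_mono mult.left_commute)
    also have "\<dots> \<le> (v \<bullet> v) * q" by (rule mult_left_mono[OF q(1) scalar_prod_self_nonneg])
    finally show ?thesis using False q(2) by (simp add: power2_eq_square mult_ac)
  qed (simp add: scalar_prod_self_nonneg)
  thus "v \<bullet> (resolvent t A *\<^sub>v v) \<le> (v \<bullet> v) / t" using assms(2) by (simp add: q_def u_def field_simps)
  have "t * (t * (u \<bullet> u)) \<le> v \<bullet> v" using le q(1) assms(2)
    by (metis mult.commute mult_left_mono less_imp_le order_trans)
  thus "(resolvent t A *\<^sub>v v) \<bullet> (resolvent t A *\<^sub>v v) \<le> (v \<bullet> v) / t\<^sup>2"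
    using assms(2) by (simp add: u_def field_simps power2_eq_square)
qed

text \<open>Column j is G applied to the j-th unit vector, so its squared length is at most 1 / t^2.
  This Frobenius bound, linear in the dimension, later controls the variance of quadratic forms in
  G.\<close>

lemma resolvent_entries_square_sum:
  assumes "psd m A" "0 < t"
  shows "(\<Sum>i<m. \<Sum>j<m. (resolvent t A $$ (i, j))\<^sup>2) \<le> real m / t\<^sup>2"
proof -
  have A: "A \<in> carrier_mat m m" using assms by (simp add: psd_def)
  have R: "dim_row (resolvent t A) = m" "dim_col (resolvent t A) = m"
    using resolvent_carrier[OF A, of t] by auto
  have "(\<Sum>i<m. (resolvent t A $$ (i, j))\<^sup>2) \<le> 1 / t\<^sup>2" if j: "j < m" for j
  proof -
    have "resolvent t A *\<^sub>v unit_vec m j = col (resolvent t A) j"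
      by (rule eq_vecI) (use R j in \<open>auto simp: scalar_prod_def unit_vec_def sum.delta if_distrib cong: if_cong\<close>)
    hence "(resolvent t A *\<^sub>v unit_vec m j) \<bullet> (resolvent t A *\<^sub>v unit_vec m j) = (\<Sum>i<m. (resolvent t A $$ (i, j))\<^sup>2)"
      using R j by (simp add: scalar_prod_def power2_eq_square atLeast0LessThan)
    thus ?thesis using quad_resolvent_le(2)[OF assms, of "unit_vec m j"] j by (simp add: scalar_prod_left_unit)
  qed
  hence "(\<Sum>j<m. \<Sum>i<m. (resolvent t A $$ (i, j))\<^sup>2) \<le> (\<Sum>j<m. 1 / t\<^sup>2)" by (intro sum_mono) auto
  thus ?thesis by (subst sum.swap) simp
qed

section \<open>Rank-one updates\<close>

lemma psd_add_outer:
  assumes "psd m A" "v \<in> carrier_vec m"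
  shows "psd m (A + outer v v)"
proof -
  have A: "A \<in> carrier_mat m m" "A\<^sup>T = A" using assms by (auto simp: psd_def)
  have "(A + outer v v)\<^sup>T = A + outer v v"
    using A assms(2) by (subst transpose_add[of _ m m]) (auto simp: outer_def intro!: eq_matI)
  moreover have "0 \<le> x \<bullet> ((A + outer v v) *\<^sub>v x)" if x: "x \<in> carrier_vec m" for x
  proof -
    have "x \<bullet> ((A + outer v v) *\<^sub>v x) = x \<bullet> (A *\<^sub>v x) + (v \<bullet> x) * (v \<bullet> x)"
      using x assms(2) A comm_scalar_prod[OF x assms(2)]
      by (simp add: add_mult_distrib_mat_vec[of _ m m] outer_mult_vec[of _ m] scalar_prod_add_distrib[of _ m])
    thus ?thesis using assms(1) x by (simp add: psd_def)
  qed
  ultimately show ?thesis using A assms(2) by (simp add: psd_def)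
qed

lemma shift_add_outer:
  assumes "A \<in> carrier_mat m m" "v \<in> carrier_vec m"
  shows "shift_mat t (A + outer v v) = shift_mat t A + outer v v"
  by (rule eq_matI) (use assms in \<open>auto simp: shift_mat_def outer_def\<close>)

text \<open>Sherman-Morrison in the direction v: with u = G v, the updated shifted matrix sends u to
  v + (v' u) v = (1 + q) v.\<close>

lemma resolvent_add_outer_vec:
  assumes "psd m A" "0 < t" "v \<in> carrier_vec m"
  defines "q \<equiv> v \<bullet> (resolvent t A *\<^sub>v v)"
  shows "resolvent t (A + outer v v) *\<^sub>v v = (1 / (1 + q)) \<cdot>\<^sub>v (resolvent t A *\<^sub>v v)"
    and "v \<bullet> (resolvent t (A + outer v v) *\<^sub>v v) = q / (1 + q)"
proof -
  have A: "A \<in> carrier_mat m m" using assms by (simp add: psd_def)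
  define u where "u = resolvent t A *\<^sub>v v"
  have u: "u \<in> carrier_vec m" using A assms(3) by (auto simp: u_def intro!: mult_mat_vec_carrier)
  have q0: "0 \<le> q" unfolding q_def by (rule quad_resolvent_nonneg[OF assms(1-3)])
  have Au: "shift_mat t A *\<^sub>v u = v" unfolding u_def by (rule shift_resolvent_vec(1)[OF assms(1-3)])
  have "shift_mat t (A + outer v v) *\<^sub>v ((1 / (1 + q)) \<cdot>\<^sub>v u) = (1 / (1 + q)) \<cdot>\<^sub>v (v + q \<cdot>\<^sub>v v)"
    using A assms(3) u Au
    by (simp add: shift_add_outer[of _ m] add_mult_distrib_mat_vec[of _ m m] mult_mat_vec[of _ m m]
        outer_mult_vec[of _ m] q_def u_def[symmetric] smult_add_distrib_vec[of _ m] smult_smult_assoc)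
  also have "\<dots> = v"
    by (rule eq_vecI) (use q0 assms(3) in \<open>auto simp: field_simps\<close>)
  finally have "resolvent t (A + outer v v) *\<^sub>v v
      = resolvent t (A + outer v v) *\<^sub>v (shift_mat t (A + outer v v) *\<^sub>v ((1 / (1 + q)) \<cdot>\<^sub>v u))" by simp
  also have "\<dots> = (1 / (1 + q)) \<cdot>\<^sub>v u"
    using shift_resolvent_vec(2)[OF psd_add_outer[OF assms(1,3)] assms(2), of "(1 / (1 + q)) \<cdot>\<^sub>v u"] u by simp
  finally show 1: "resolvent t (A + outer v v) *\<^sub>v v = (1 / (1 + q)) \<cdot>\<^sub>v (resolvent t A *\<^sub>v v)"
    by (simp add: u_def)
  show "v \<bullet> (resolvent t (A + outer v v) *\<^sub>v v) = q / (1 + q)"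
    unfolding 1 using u assms(3) by (simp add: q_def u_def[symmetric])
qed

lemma mtrace_add: "A \<in> carrier_mat m m \<Longrightarrow> B \<in> carrier_mat m m \<Longrightarrow> mtrace (A + B) = mtrace A + mtrace B"
  by (simp add: mtrace_def sum.distrib)

lemma mtrace_smult: "mtrace (k \<cdot>\<^sub>m A) = k * mtrace A" if "A \<in> carrier_mat m m"
  using that by (simp add: mtrace_def sum_distrib_left)

lemma mtrace_outer: "v \<in> carrier_vec m \<Longrightarrow> w \<in> carrier_vec m \<Longrightarrow> mtrace (outer v w) = v \<bullet> w"
  by (auto simp: mtrace_def outer_def scalar_prod_def atLeast0LessThan intro!: sum.cong)

text \<open>The transpose of G is a left inverse of the symmetric matrix A + t and G is a right
  inverse, so the two coincide.\<close>

lemma resolvent_symmetric: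
  assumes "psd m A" "0 < t" shows "(resolvent t A)\<^sup>T = resolvent t A"
proof -
  have A: "A \<in> carrier_mat m m" "A\<^sup>T = A" using assms by (auto simp: psd_def)
  have R: "resolvent t A \<in> carrier_mat m m" "shift_mat t A \<in> carrier_mat m m" using A by auto
  have s: "(shift_mat t A)\<^sup>T = shift_mat t A"
    unfolding shift_mat_def using A by (subst transpose_add[of _ m m]) (auto intro!: eq_matI)
  have "(resolvent t A)\<^sup>T * shift_mat t A = 1\<^sub>m m"
    using transpose_mult[OF R(2,1)] s resolvent_inverse[OF assms] by simp
  hence "(resolvent t A)\<^sup>T = (resolvent t A)\<^sup>T * (shift_mat t A * resolvent t A)"
    using resolvent_inverse[OF assms] R by simp
  also have "\<dots> = resolvent t A"
    using \<open>(resolvent t A)\<^sup>T * shift_mat t A = 1\<^sub>m m\<close> R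
    by (simp add: assoc_mult_mat[symmetric, of _ m m _ m _ m])
  finally show ?thesis .
qed

text \<open>With D the updated resolvent, B - D = D v v' B. Its trace is |u|^2 / (1 + q) for u = B
  v, and t |u|^2 <= q bounds this by 1/t however long v is.\<close>

lemma mtrace_resolvent_add_outer:
  assumes "psd m A" "0 < t" "v \<in> carrier_vec m"
  shows "mtrace (resolvent t (A + outer v v)) \<le> mtrace (resolvent t A)"
    and "mtrace (resolvent t A) \<le> mtrace (resolvent t (A + outer v v)) + 1 / t"
proof -
  have A: "A \<in> carrier_mat m m" using assms by (simp add: psd_def)
  note P = psd_add_outer[OF assms(1,3)]
  define B where "B = resolvent t A"
  define D where "D = resolvent t (A + outer v v)"
  have BD: "B \<in> carrier_mat m m" "D \<in> carrier_mat m m" using A assms(3) by (auto simp: B_def D_def)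
  define u where "u = B *\<^sub>v v"
  define q where "q = v \<bullet> u"
  have u: "u \<in> carrier_vec m" using BD assms(3) by (auto simp: u_def intro!: mult_mat_vec_carrier)
  have q0: "0 \<le> q" "t * (u \<bullet> u) \<le> q"
    using quad_resolvent_nonneg[OF assms] quad_resolvent_ge[OF assms] by (auto simp: q_def u_def B_def)
  have Dv: "D *\<^sub>v v = (1 / (1 + q)) \<cdot>\<^sub>v u"
    using resolvent_add_outer_vec(1)[OF assms] by (simp add: D_def q_def u_def B_def)
  have Du: "D *\<^sub>v v \<in> carrier_vec m" using u Dv by simp
  have S: "shift_mat t A \<in> carrier_mat m m" "outer v v \<in> carrier_mat m m" using A assms(3) by auto
  \<comment> \<open>D inverts the updated matrix, so it may be inserted to the left of B; expanding
    the sum produces the resolvent identity.\<close>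
  have "B = D * (shift_mat t A + outer v v) * B"
    using resolvent_inverse(2)[OF P assms(2)] BD by (simp add: D_def shift_add_outer[OF A assms(3)])
  also have "\<dots> = D * (shift_mat t A * B) + D * (outer v v * B)"
    using BD S by (simp add: mult_add_distrib_mat[of _ m m _ m] add_mult_distrib_mat[of _ m m _ _ m])
  also have "\<dots> = D + D * (outer v v * B)"
    using resolvent_inverse(1)[OF assms(1,2)] BD by (simp add: B_def)
  also have "outer v v * B = outer v u"
  proof (rule eq_matI)
    fix i j assume "i < dim_row (outer v u)" "j < dim_col (outer v u)"
    hence ij: "i < m" "j < m" using u assms(3) by (auto simp: outer_def)
    have sym: "B $$ (k, j) = B $$ (j, k)" if "k < m" for k
      using resolvent_symmetric[OF assms(1,2)] BD that ij by (metis B_def carrier_matD index_transpose_mat(1))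
    show "(outer v v * B) $$ (i, j) = outer v u $$ (i, j)"
      using ij BD u assms(3)
      by (auto simp: outer_def u_def scalar_prod_def sum_distrib_left sym mult_ac intro!: sum.cong)
  qed (use BD u assms(3) in \<open>auto simp: outer_def\<close>)
  also have "D * outer v u = outer (D *\<^sub>v v) u"
    by (rule eq_matI) (use BD u assms(3) in \<open>auto simp: outer_def scalar_prod_def sum_distrib_left sum_distrib_right mult_ac\<close>)
  finally have "mtrace B = mtrace D + (D *\<^sub>v v) \<bullet> u"
    using BD u assms(3) Du by (metis mtrace_add mtrace_outer outer_carrier)
  hence eq: "mtrace B = mtrace D + (u \<bullet> u) / (1 + q)" using u by (simp add: Dv)
  have "0 \<le> (u \<bullet> u) / (1 + q)" using q0 by (simp add: scalar_prod_self_nonneg)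
  thus "mtrace (resolvent t (A + outer v v)) \<le> mtrace (resolvent t A)" using eq by (simp add: B_def D_def)
  have "u \<bullet> u \<le> q / t" using q0 assms(2) by (simp add: field_simps)
  also have "\<dots> \<le> (1 + q) / t" using assms(2) by (simp add: divide_right_mono)
  finally have "(u \<bullet> u) / (1 + q) \<le> 1 / t" using q0 assms(2) by (simp add: field_simps)
  thus "mtrace (resolvent t A) \<le> mtrace (resolvent t (A + outer v v)) + 1 / t" using eq by (simp add: B_def D_def)
qed

lemma mtrace_resolvent_bounds:
  assumes "psd m A" "0 < t"
  shows "0 \<le> mtrace (resolvent t A)" "mtrace (resolvent t A) \<le> real m / t"
proof -
  have A: "A \<in> carrier_mat m m" using assms by (simp add: psd_def)
  have R: "dim_row (resolvent t A) = m" "dim_col (resolvent t A) = m"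
    using resolvent_carrier[OF A, of t] by auto
  have e: "unit_vec m i \<bullet> (resolvent t A *\<^sub>v unit_vec m i) = resolvent t A $$ (i, i)" if "i < m" for i
    using R that by (subst scalar_prod_left_unit) (auto intro!: carrier_vecI)
  show "0 \<le> mtrace (resolvent t A)"
    unfolding mtrace_def R using quad_resolvent_nonneg[OF assms, of "unit_vec m _"] e by (intro sum_nonneg) (metis lessThan_iff unit_vec_carrier)
  have "mtrace (resolvent t A) \<le> (\<Sum>i<m. 1 / t)"
    unfolding mtrace_def R 
  proof (rule sum_mono)
    fix i assume "i \<in> {..<m}"
    thus "resolvent t A $$ (i, i) \<le> 1 / t"
      using quad_resolvent_le(1)[OF assms, of "unit_vec m i"] e[of i] by (simp add: scalar_prod_left_unit)
  qed
  thus "mtrace (resolvent t A) \<le> real m / t" by simp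
qed

section \<open>Eigenvalues and Gram matrices\<close>

text \<open>Write the eigenvector as x + i y. Symmetry gives x' A y = y' A x, which forces Im a
  (|x|^2 + |y|^2) = 0; adding x' A x and y' A y then gives the sign of Re a.\<close>

lemma psd_complex_eigenvalue:
  assumes "psd m A" "eigenvalue (map_mat complex_of_real A) a"
  shows "Im a = 0" "0 \<le> Re a"
proof -
  have A: "A \<in> carrier_mat m m" "A\<^sup>T = A" using assms by (auto simp: psd_def)
  obtain v where v: "v \<in> carrier_vec m" "v \<noteq> 0\<^sub>v m" "map_mat complex_of_real A *\<^sub>v v = a \<cdot>\<^sub>v v"
    using assms(2) A by (auto simp: eigenvalue_def eigenvector_def)
  define x where "x = map_vec Re v"
  define y where "y = map_vec Im v"
  have xy: "x \<in> carrier_vec m" "y \<in> carrier_vec m" using v by (auto simp: x_def y_def)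
  have comp: "(\<Sum>j = 0..<m. complex_of_real (A $$ (i, j)) * v $ j) = a * v $ i" if "i < m" for i
  proof -
    have "(map_mat complex_of_real A *\<^sub>v v) $ i = (a \<cdot>\<^sub>v v) $ i" using v by simp
    thus ?thesis using that A(1) v(1) by (simp add: scalar_prod_def)
  qed
  have Ax: "A *\<^sub>v x = Re a \<cdot>\<^sub>v x + (- Im a) \<cdot>\<^sub>v y"
  proof (rule eq_vecI)
    fix i assume "i < dim_vec (Re a \<cdot>\<^sub>v x + (- Im a) \<cdot>\<^sub>v y)"
    hence i: "i < m" using xy by simp
    show "(A *\<^sub>v x) $ i = (Re a \<cdot>\<^sub>v x + (- Im a) \<cdot>\<^sub>v y) $ i"
      using arg_cong[OF comp[OF i], of Re] i A v by (simp add: scalar_prod_def x_def y_def)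
  qed (use A xy in auto)
  have Ay: "A *\<^sub>v y = Re a \<cdot>\<^sub>v y + Im a \<cdot>\<^sub>v x"
  proof (rule eq_vecI)
    fix i assume "i < dim_vec (Re a \<cdot>\<^sub>v y + Im a \<cdot>\<^sub>v x)"
    hence i: "i < m" using xy by simp
    show "(A *\<^sub>v y) $ i = (Re a \<cdot>\<^sub>v y + Im a \<cdot>\<^sub>v x) $ i"
      using arg_cong[OF comp[OF i], of Im] i A v by (simp add: scalar_prod_def x_def y_def)
  qed (use A xy in auto)
  have sym: "x \<bullet> (A *\<^sub>v y) = y \<bullet> (A *\<^sub>v x)"
  proof -
    have "x \<bullet> (A *\<^sub>v y) = (A *\<^sub>v x) \<bullet> y"
      using transpose_vec_mult_scalar[OF A(1) xy(2,1)] A xy by simp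
    also have "\<dots> = y \<bullet> (A *\<^sub>v x)" using A xy by (intro comm_scalar_prod[of _ m]) (auto intro!: mult_mat_vec_carrier)
    finally show ?thesis .
  qed
  have "x \<bullet> (A *\<^sub>v y) = Re a * (x \<bullet> y) + Im a * (x \<bullet> x)"
    unfolding Ay using xy by (subst scalar_prod_add_distrib[of _ m]) auto
  moreover have "y \<bullet> (A *\<^sub>v x) = Re a * (x \<bullet> y) - Im a * (y \<bullet> y)"
    unfolding Ax using xy comm_scalar_prod[OF xy] by (subst scalar_prod_add_distrib[of _ m]) auto
  ultimately have im: "Im a * (x \<bullet> x + y \<bullet> y) = 0" using sym by (simp add: algebra_simps)
  have pos: "x \<bullet> x + y \<bullet> y > 0"
  proof (rule ccontr)
    assume "\<not> x \<bullet> x + y \<bullet> y > 0"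
    hence "x \<bullet> x = 0" "y \<bullet> y = 0"
      using scalar_prod_self_nonneg[of x] scalar_prod_self_nonneg[of y] by linarith+
    hence 0: "x = 0\<^sub>v m" "y = 0\<^sub>v m" using xy scalar_prod_self_eq_0 by auto
    have "v = 0\<^sub>v m"
    proof (rule eq_vecI)
      fix i assume "i < dim_vec (0\<^sub>v m :: complex vec)"
      hence i: "i < m" by simp
      have "x $ i = 0" "y $ i = 0" using 0 i by auto
      thus "v $ i = 0\<^sub>v m $ i" using i v by (simp add: x_def y_def complex_eq_iff)
    qed (use v in auto)
    thus False using v by simp
  qed
  show im0: "Im a = 0" using im pos by simp
  have "x \<bullet> (A *\<^sub>v x) = Re a * (x \<bullet> x)" "y \<bullet> (A *\<^sub>v y) = Re a * (y \<bullet> y)"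
    unfolding Ax Ay using xy by (subst scalar_prod_add_distrib[of _ m], auto simp: im0)+
  moreover have "0 \<le> x \<bullet> (A *\<^sub>v x)" "0 \<le> y \<bullet> (A *\<^sub>v y)"
    using assms(1) xy by (simp_all add: psd_def)
  ultimately have "0 \<le> Re a * (x \<bullet> x + y \<bullet> y)" by (simp only: distrib_left)
  thus "0 \<le> Re a" using pos by (simp add: zero_le_mult_iff)
qed

text \<open>The factorisation exists over the complex numbers; since all its roots are real,
  injectivity of the embedding of real polynomials brings it down.\<close>

lemma psd_char_poly_splits:
  assumes "psd m A"
  obtains as where "char_poly A = (\<Prod>a\<leftarrow>as. [:- a, 1:])" "length as = m" "\<And>a. a \<in> set as \<Longrightarrow> 0 \<le> a"
proof -
  have A: "A \<in> carrier_mat m m" using assms by (auto simp: psd_def)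
  let ?C = "map_mat complex_of_real A"
  have C: "?C \<in> carrier_mat m m" using A by simp
  obtain as where as: "char_poly ?C = (\<Prod>a\<leftarrow>as. [:- a, 1:])" "length as = m"
    using char_poly_factorized[OF C] by blast
  have ev: "eigenvalue ?C a" if "a \<in> set as" for a
    using that unfolding eigenvalue_root_char_poly[OF C] as(1)
    by (force simp: poly_prod_list prod_list_zero_iff)
  have re: "complex_of_real (Re a) = a" if "a \<in> set as" for a
    using psd_complex_eigenvalue(1)[OF assms ev[OF that]] by (simp add: complex_eq_iff)
  interpret h: map_poly_inj_idom_hom "complex_of_real" ..
  have "map_poly complex_of_real (char_poly A) = char_poly ?C"
    by (rule of_real_hom.char_poly_hom[OF A, symmetric])
  also have "\<dots> = (\<Prod>a\<leftarrow>as. [:- complex_of_real (Re a), 1:])"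
    unfolding as(1) by (intro arg_cong[where f = prod_list] map_cong refl) (simp add: re)
  also have "\<dots> = map_poly complex_of_real (\<Prod>a\<leftarrow>map Re as. [:- a, 1:])"
    by (simp add: h.hom_prod_list o_def)
  finally have "char_poly A = (\<Prod>a\<leftarrow>map Re as. [:- a, 1:])" by simp
  thus thesis
    by (rule that) (use as(2) psd_complex_eigenvalue(2)[OF assms ev] in auto)
qed

text \<open>The logarithmic derivative of a product of linear factors, multiplied out.\<close>

lemma poly_pderiv_linear_factors:
  assumes "\<And>a. a \<in> set as \<Longrightarrow> x \<noteq> (a :: real)"
  shows "poly (pderiv (\<Prod>a\<leftarrow>as. [:- a, 1:])) x
    = poly (\<Prod>a\<leftarrow>as. [:- a, 1:]) x * (\<Sum>a\<leftarrow>as. 1 / (x - a))"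
  using assms
proof (induction as)
  case (Cons b as)
  define P where "P = (\<Prod>a\<leftarrow>as. [:- a, 1:])"
  define S where "S = (\<Sum>a\<leftarrow>as. 1 / (x - a))"
  have IH: "poly (pderiv P) x = poly P x * S" using Cons by (simp add: P_def S_def)
  have xb: "x - b \<noteq> 0" using Cons.prems by simp
  have "poly (pderiv ([:- b, 1:] * P)) x = (x - b) * (poly P x * S) + poly P x"
    unfolding pderiv_mult by (simp add: pderiv_pCons IH algebra_simps)
  also have "\<dots> = poly ([:- b, 1:] * P) x * (1 / (x - b) + S)"
    using xb by (simp add: field_simps)
  finally show ?case by (simp add: P_def S_def)
qed simp

lemma poly_char_poly_neg:
  assumes "A \<in> carrier_mat m m"
  shows "poly (char_poly A) (- t) = (-1) ^ m * det (shift_mat t A)"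
proof -
  have "- char_matrix A (- t) = (-1) \<cdot>\<^sub>m shift_mat t A"
    by (rule eq_matI) (use assms in \<open>auto simp: char_matrix_def shift_mat_def\<close>)
  moreover have "dim_col (shift_mat t A) = m" using shift_carrier[OF assms, of t] by auto
  ultimately show ?thesis using assms by (simp add: char_poly_matrix det_smult)
qed

text \<open>The trace formula avoids a spectral decomposition: the logarithmic derivative of the
  characteristic polynomial at -t is computed once from its roots and once from the derivative of a
  determinant, which is the sum of the principal minors and hence, up to sign, the trace of the
  adjugate.\<close>

lemma eigenvalues_psd:
  assumes "psd m A"
  shows "size (eigenvalues A) = m" "\<And>l. l \<in># eigenvalues A \<Longrightarrow> 0 \<le> l"
    and "0 < t \<Longrightarrow> (\<Sum>l\<in>#eigenvalues A. 1 / (l + t)) = mtrace (resolvent t A)"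
proof -
  have A: "A \<in> carrier_mat m m" using assms by (auto simp: psd_def)
  obtain as where as: "char_poly A = (\<Prod>a\<leftarrow>as. [:- a, 1:])" "length as = m" "\<And>a. a \<in> set as \<Longrightarrow> 0 \<le> a"
    using psd_char_poly_splits[OF assms] by metis
  have "proots (\<Prod>a\<leftarrow>as. [:- a, 1:]) = mset as"
  proof (induction as)
    case (Cons b as)
    have nz: "[:- b, 1:] \<noteq> 0" "(\<Prod>a\<leftarrow>as. [:- a, 1:]) \<noteq> 0" by (auto simp: prod_list_zero_iff)
    show ?case unfolding list.map prod_list.Cons proots_mult[OF nz] Cons.IH by simp
  qed simp
  hence e: "eigenvalues A = mset as" by (simp add: eigenvalues_def as(1))
  show "size (eigenvalues A) = m" "\<And>l. l \<in># eigenvalues A \<Longrightarrow> 0 \<le> l" using as e by auto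
  assume t: "0 < t"
  define d where "d = det (shift_mat t A)"
  have d: "d \<noteq> 0" using det_shift_nonzero[OF assms t] by (simp add: d_def)
  have S: "shift_mat t A \<in> carrier_mat m m" using A by simp
  \<comment> \<open>Deleting row and column i commutes with the shift. The minor has size m - 1,
    whence the minus sign against (-1) ^ m.\<close>
  have del: "poly (char_poly (mat_delete A i i)) (- t) = - ((-1) ^ m * cofactor (shift_mat t A) i i)"
    if "i < m" for i
  proof -
    have "mat_delete A i i \<in> carrier_mat (m - 1) (m - 1)" using A by (auto simp: mat_delete_def)
    moreover have "shift_mat t (mat_delete A i i) = mat_delete (shift_mat t A) i i"
      by (rule eq_matI) (use A that in \<open>auto simp: shift_mat_def mat_delete_def\<close>)
    moreover have "(-1) ^ m = - ((-1 :: real) ^ (m - 1))" using that by (cases m) auto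
    ultimately show ?thesis by (simp add: poly_char_poly_neg cofactor_def power_add[symmetric] mult_2[symmetric])
  qed
  have "poly (pderiv (char_poly A)) (- t) = - ((-1) ^ m * (\<Sum>i<m. cofactor (shift_mat t A) i i))"
    unfolding pderiv_char_poly[OF A] poly_sum using del by (simp add: sum_negf sum_distrib_left)
  moreover have "poly (pderiv (char_poly A)) (- t) = (-1) ^ m * d * (\<Sum>a\<leftarrow>as. 1 / (- t - a))"
    unfolding as(1) by (subst poly_pderiv_linear_factors)
      (use as(3) t in \<open>force simp: as(1)[symmetric] poly_char_poly_neg[OF A] d_def\<close>)+
  moreover have "(\<Sum>a\<leftarrow>as. 1 / (- t - a)) = - (\<Sum>a\<leftarrow>as. 1 / (a + t))"
  proof (induction as)
    case (Cons a as)
    have "1 / (- t - a) = - (1 / (a + t))" by (subst minus_divide_right) simp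
    thus ?case using Cons by simp
  qed simp
  ultimately have "(\<Sum>a\<leftarrow>as. 1 / (a + t)) = (\<Sum>i<m. cofactor (shift_mat t A) i i) / d"
    using d by (simp add: field_simps)
  also have "\<dots> = mtrace (resolvent t A)"
    using S by (simp add: mtrace_def resolvent_def adj_mat_def d_def sum_divide_distrib)
  finally show "(\<Sum>l\<in>#eigenvalues A. 1 / (l + t)) = mtrace (resolvent t A)"
    by (simp add: e sum_mset_sum_list[symmetric] flip: mset_map)
qed

section \<open>Gram matrices and removal of a row\<close>

definition gram :: "nat \<Rightarrow> (nat \<Rightarrow> nat \<Rightarrow> real) \<Rightarrow> nat set \<Rightarrow> real mat" where
  "gram m z I = mat m m (\<lambda>(j, k). \<Sum>i\<in>I. z i j * z i k)"

lemma gram_carrier [simp]: "gram m z I \<in> carrier_mat m m"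
  by (simp add: gram_def)

lemma gram_cong: "(\<And>i j. i \<in> I \<Longrightarrow> j < m \<Longrightarrow> z i j = z' i j) \<Longrightarrow> gram m z I = gram m z' I"
  by (auto simp: gram_def intro!: eq_matI sum.cong)

lemma gram_insert:
  assumes "finite I" "i \<notin> I"
  shows "gram m z (insert i I) = gram m z I + outer (vec m (z i)) (vec m (z i))"
  by (rule eq_matI) (use assms in \<open>auto simp: gram_def outer_def\<close>)

lemma psd_gram:
  assumes "finite I" shows "psd m (gram m z I)"
  using assms
proof (induction I)
  case empty
  have "gram m z {} = 0\<^sub>m m m" by (rule eq_matI) (auto simp: gram_def)
  moreover have "v \<bullet> (0\<^sub>m m m *\<^sub>v v) = 0" if "v \<in> carrier_vec m" for v :: "real vec"
    using that by (simp add: scalar_prod_def)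
  ultimately show ?case by (auto simp: psd_def)
next
  case (insert i I)
  thus ?case by (simp add: gram_insert psd_add_outer)
qed

lemma gram_remove:
  assumes "finite I" "i \<in> I"
  shows "gram m z I = gram m z (I - {i}) + outer (vec m (z i)) (vec m (z i))"
  using gram_insert[of "I - {i}" i m z] assms by (simp add: insert_absorb)

text \<open>Taking traces in S G + t G = 1 shows that the left side is tr (S G), the sum of z_i' G
  z_i. Each summand equals q_i / (1 + q_i), where q_i uses the resolvent without row i. Indexing
  rows by a set makes that resolvent available as \<open>I - {i}\<close>.\<close>

lemma gram_trace_identity:
  fixes m :: nat and z :: "nat \<Rightarrow> nat \<Rightarrow> real"
  assumes "finite I" "0 < t"
  defines "q \<equiv> \<lambda>i. vec m (z i) \<bullet> (resolvent t (gram m z (I - {i})) *\<^sub>v vec m (z i))"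
  shows "real m - t * mtrace (resolvent t (gram m z I)) = (\<Sum>i\<in>I. 1 - 1 / (1 + q i))"
proof -
  define G where "G = resolvent t (gram m z I)"
  have G: "G \<in> carrier_mat m m" by (simp add: G_def)
  have "(\<Sum>i\<in>I. vec m (z i) \<bullet> (G *\<^sub>v vec m (z i))) = (\<Sum>i\<in>I. 1 - 1 / (1 + q i))"
  proof (rule sum.cong[OF refl])
    fix i assume i: "i \<in> I"
    have q0: "0 \<le> q i" unfolding q_def using assms by (intro quad_resolvent_nonneg[of m] psd_gram) auto
    have "vec m (z i) \<bullet> (G *\<^sub>v vec m (z i)) = q i / (1 + q i)"
      unfolding G_def gram_remove[OF assms(1) i] q_def
      using assms by (intro resolvent_add_outer_vec(2)[of m] psd_gram) auto
    also have "\<dots> = 1 - 1 / (1 + q i)" using q0 by (simp add: field_simps)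
    finally show "vec m (z i) \<bullet> (G *\<^sub>v vec m (z i)) = 1 - 1 / (1 + q i)" .
  qed
  moreover have "(\<Sum>i\<in>I. vec m (z i) \<bullet> (G *\<^sub>v vec m (z i))) = mtrace (gram m z I * G)"
  proof -
    have "(\<Sum>i\<in>I. vec m (z i) \<bullet> (G *\<^sub>v vec m (z i))) = (\<Sum>i\<in>I. \<Sum>j<m. \<Sum>k<m. z i j * z i k * G $$ (j, k))"
      using G by (simp add: scalar_prod_def atLeast0LessThan sum_distrib_left mult_ac)
    also have "\<dots> = (\<Sum>j<m. \<Sum>k<m. \<Sum>i\<in>I. z i j * z i k * G $$ (j, k))"
      by (subst sum.swap, rule sum.cong[OF refl], subst sum.swap) simp
    also have "\<dots> = (\<Sum>j<m. \<Sum>k<m. gram m z I $$ (j, k) * G $$ (k, j))"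
    proof (intro sum.cong refl)
      fix j k assume "j \<in> {..<m}" "k \<in> {..<m}"
      hence jk: "j < m" "k < m" by auto
      have "G\<^sup>T = G" unfolding G_def using assms by (intro resolvent_symmetric[of m] psd_gram)
      hence "G $$ (j, k) = G $$ (k, j)" using G jk by (metis carrier_matD index_transpose_mat(1))
      thus "(\<Sum>i\<in>I. z i j * z i k * G $$ (j, k)) = gram m z I $$ (j, k) * G $$ (k, j)"
        using jk by (simp add: gram_def sum_distrib_right)
    qed
    also have "\<dots> = mtrace (gram m z I * G)"
      using G by (simp add: mtrace_def gram_def scalar_prod_def atLeast0LessThan)
    finally show ?thesis .
  qed
  moreover have "mtrace (gram m z I * G) + t * mtrace G = real m"
  proof -
    have "shift_mat t (gram m z I) * G = gram m z I * G + t \<cdot>\<^sub>m G"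
    proof -
      have "(t \<cdot>\<^sub>m 1\<^sub>m m) * G = t \<cdot>\<^sub>m G"
        using G by (subst mult_smult_assoc_mat[of _ m m _ m]) auto
      thus ?thesis using G by (simp add: shift_mat_def add_mult_distrib_mat[of _ m m _ _ m] gram_def)
    qed
    moreover have "shift_mat t (gram m z I) * G = 1\<^sub>m m"
      unfolding G_def using assms by (intro resolvent_inverse[of m] psd_gram)
    moreover have "mtrace (1\<^sub>m m) = real m" by (simp add: mtrace_def)
    ultimately show ?thesis using G
      by (metis mtrace_add mtrace_smult gram_carrier mult_carrier_mat smult_carrier_mat)
  qed
  ultimately show ?thesis by (simp add: G_def)
qed

section \<open>The Marchenko-Pastur integrals\<close>

text \<open>The function is R + (a + b)/2 arcsin u - sqrt (a b) arcsin v. R vanishes at both ends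
  while each arcsine rises by \<pi>, which gives the stated increment.\<close>

lemma sqrt_quotient_antiderivative:
  fixes a b :: real
  assumes "0 \<le> a" "a < b"
  obtains F where "continuous_on {a..b} F"
    and "\<And>y. y \<in> {a<..<b} \<Longrightarrow> (F has_real_derivative sqrt ((b - y) * (y - a)) / y) (at y)"
    and "F b - F a = pi * ((a + b) / 2 - sqrt (a * b))"
proof -
  define R where "R = (\<lambda>y. sqrt ((b - y) * (y - a)))"
  \<comment> \<open>Here \<open>u\<close> is affine in y and, for a > 0, \<open>v\<close> is affine
    in 1 / y; both send a to -1 and b to 1.\<close>
  define u where "u = (\<lambda>y. (2 * y - a - b) / (b - a))"
  define v where "v = (\<lambda>y. ((a + b) * y - 2 * a * b) / (y * (b - a)))"
  (* For a = 0 the argument v is constant and undefined at 0, but its coefficient vanishes. *)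
  define T where "T = (\<lambda>y. if a = 0 then 0 else sqrt (a * b) * arcsin (v y))"
  define F where "F = (\<lambda>y. R y + (a + b) / 2 * arcsin (u y) - T y)"
  have Rpos: "R y > 0" "R y ^ 2 = (b - y) * (y - a)" if "y \<in> {a<..<b}" for y
    using that by (auto simp: R_def)
  have vbnd: "-1 \<le> v y \<and> v y \<le> 1" if "y \<in> {a..b}" "a > 0" for y
  proof -
    have "0 \<le> 2 * b * (y - a)" "0 \<le> 2 * a * (b - y)" using that by auto
    hence "- (y * (b - a)) \<le> (a + b) * y - 2 * a * b" "(a + b) * y - 2 * a * b \<le> y * (b - a)"
      by (auto simp: algebra_simps)
    thus ?thesis using that assms(2) unfolding v_def
      by (auto simp: le_divide_eq divide_le_eq)
  qed
  have dR: "(R has_real_derivative (a + b - 2 * y) / (2 * R y)) (at y)" if "y \<in> {a<..<b}" for y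
  proof -
    have "((\<lambda>y. (b - y) * (y - a)) has_real_derivative a + b - 2 * y) (at y)"
      by (auto intro!: derivative_eq_intros simp: algebra_simps)
    moreover have "0 < (b - y) * (y - a)" using that by simp
    ultimately show ?thesis unfolding R_def
      using DERIV_chain2[OF DERIV_real_sqrt, of "\<lambda>y. (b - y) * (y - a)" y] by (simp add: field_simps)
  qed
  have du: "((\<lambda>y. arcsin (u y)) has_real_derivative 1 / R y) (at y)" if "y \<in> {a<..<b}" for y
  proof -
    have u1: "-1 < u y" "u y < 1" using that assms by (auto simp: u_def field_simps)
    have "1 - (u y)\<^sup>2 = (2 * R y / (b - a))\<^sup>2"
    proof -
      have "(b - a)\<^sup>2 - (2 * y - a - b)\<^sup>2 = 4 * ((b - y) * (y - a))"
        by (simp add: algebra_simps power2_eq_square)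
      moreover have "(b - a)\<^sup>2 \<noteq> 0" using assms by simp
      ultimately show ?thesis
        unfolding power_divide power_mult_distrib Rpos(2)[OF that] u_def by (simp add: diff_divide_eq_iff)
    qed
    hence s: "sqrt (1 - (u y)\<^sup>2) = 2 * R y / (b - a)" using Rpos(1)[OF that] assms by simp
    have "(u has_real_derivative 2 / (b - a)) (at y)"
      unfolding u_def by (rule DERIV_cdivide) (auto intro!: derivative_eq_intros)
    from DERIV_chain2[OF DERIV_arcsin[OF u1] this]
    have "((\<lambda>y. arcsin (u y)) has_real_derivative inverse (2 * R y / (b - a)) * (2 / (b - a))) (at y)"
      by (simp only: s)
    also have "inverse (2 * R y / (b - a)) * (2 / (b - a)) = 1 / R y"
      using Rpos(1)[OF that] assms by (simp add: divide_simps)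
    finally show ?thesis .
  qed
  have dT: "(T has_real_derivative a * b / (y * R y)) (at y)" if y: "y \<in> {a<..<b}" for y
  proof (cases "a = 0")
    case False
    hence a0: "a > 0" using assms by simp
    hence y0: "y > 0" and ab: "a * b > 0" using y assms by auto
    have "1 - (v y)\<^sup>2 = (2 * sqrt (a * b) * R y / (y * (b - a)))\<^sup>2"
    proof -
      have "(y * (b - a))\<^sup>2 - ((a + b) * y - 2 * a * b)\<^sup>2 = 4 * (a * b) * ((b - y) * (y - a))"
        by (simp add: algebra_simps power2_eq_square)
      moreover have "y * (b - a) \<noteq> 0" using y0 assms by simp
      ultimately show ?thesis
        unfolding power_divide power_mult_distrib Rpos(2)[OF y] v_def using ab y0 assms
        by (simp add: field_simps)
    qed
    hence s: "sqrt (1 - (v y)\<^sup>2) = 2 * sqrt (a * b) * R y / (y * (b - a))"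
      using Rpos(1)[OF y] assms y0 ab by simp
    have "0 < 1 - (v y)\<^sup>2" 
    proof -
      have "0 < sqrt (1 - (v y)\<^sup>2)" unfolding s using Rpos(1)[OF y] assms y0 ab by simp
      thus ?thesis by simp
    qed
    hence v1: "-1 < v y" "v y < 1"
      by (simp_all add: abs_square_less_1 abs_less_iff)
    have "(v has_real_derivative 2 * a * b / (y\<^sup>2 * (b - a))) (at y)"
    proof -
      have "(v has_real_derivative ((a + b) * (y * (b - a)) - ((a + b) * y - 2 * a * b) * (b - a))
          / ((y * (b - a)) * (y * (b - a)))) (at y)"
        unfolding v_def using assms y0 by (auto intro!: derivative_eq_intros)
      also have "(a + b) * (y * (b - a)) - ((a + b) * y - 2 * a * b) * (b - a)
          = 2 * a * b * (b - a)"
        by (simp add: algebra_simps)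
      also have "2 * a * b * (b - a) / ((y * (b - a)) * (y * (b - a)))
          = 2 * a * b / (y\<^sup>2 * (b - a))"
        using assms by (simp add: power2_eq_square)
      finally show ?thesis .
    qed
    note * = DERIV_cmult[OF DERIV_chain2[OF DERIV_arcsin[OF v1] this], of "sqrt (a * b)"]
    have "((\<lambda>y. sqrt (a * b) * arcsin (v y)) has_real_derivative a * b / (y * R y)) (at y)"
    proof -
      have "sqrt (a * b) * (inverse (sqrt (1 - (v y)\<^sup>2)) * (2 * a * b / (y\<^sup>2 * (b - a)))) = a * b / (y * R y)"
        unfolding s using Rpos(1)[OF y] assms y0 ab a0 by (simp add: divide_simps power2_eq_square)
      with * show ?thesis by (simp only:)
    qed
    thus ?thesis using False by (simp add: T_def)
  qed (simp add: T_def)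
  show thesis
  proof (rule that[of F])
    have "continuous_on {a..b} T"
    proof (cases "a = 0")
      case False
      hence "a > 0" using assms by simp
      hence "continuous_on {a..b} v" unfolding v_def using assms by (intro continuous_intros) auto
      hence "continuous_on {a..b} (\<lambda>y. arcsin (v y))"
        using vbnd \<open>a > 0\<close> by (intro continuous_on_arcsin) auto
      thus ?thesis using False by (auto simp: T_def intro!: continuous_intros)
    qed (simp add: T_def)
    moreover have "continuous_on {a..b} (\<lambda>y. arcsin (u y))"
      unfolding u_def using assms by (intro continuous_on_arcsin continuous_intros) (auto simp: field_simps)
    moreover have "continuous_on {a..b} R" unfolding R_def by (intro continuous_intros)
    ultimately show "continuous_on {a..b} F"
      unfolding F_def by (intro continuous_on_diff continuous_on_add continuous_on_mult_left)
  next
    fix y assume y: "y \<in> {a<..<b}"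
    hence y0: "y > 0" using assms by auto
    have "(F has_real_derivative (a + b - 2 * y) / (2 * R y) + (a + b) / 2 * (1 / R y) - a * b / (y * R y)) (at y)"
      unfolding F_def by (intro DERIV_diff DERIV_add DERIV_cmult dR du dT y)
    also have "(a + b - 2 * y) / (2 * R y) + (a + b) / 2 * (1 / R y) - a * b / (y * R y)
      = ((b - y) * (y - a)) / (y * R y)"
      using y0 Rpos(1)[OF y] by (simp add: field_simps)
    also have "\<dots> = R y / y"
      using y0 Rpos(1)[OF y] unfolding Rpos(2)[OF y, symmetric] by (simp add: power2_eq_square)
    finally show "(F has_real_derivative sqrt ((b - y) * (y - a)) / y) (at y)" by (simp add: R_def)
  next
    have "u b = 1" "u a = -1" using assms by (auto simp: u_def divide_eq_eq)
    moreover have "v b = 1" "v a = -1" if "a \<noteq> 0" using assms that by (auto simp: v_def divide_eq_eq algebra_simps)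
    ultimately show "F b - F a = pi * ((a + b) / 2 - sqrt (a * b))"
      by (auto simp: F_def R_def T_def algebra_simps add_divide_distrib)
  qed
qed

lemma has_integral_sqrt_quotient:
  fixes a b s :: real
  assumes "0 \<le> a" "a < b" "0 \<le> s"
  shows "((\<lambda>x. sqrt ((b - x) * (x - a)) / (x + s)) has_integral
           pi * ((a + b) / 2 + s - sqrt ((a + s) * (b + s)))) {a..b}"
proof -
  obtain F where F: "continuous_on {a + s..b + s} F"
    "\<And>y. y \<in> {a + s<..<b + s} \<Longrightarrow> (F has_real_derivative sqrt ((b + s - y) * (y - (a + s))) / y) (at y)"
    "F (b + s) - F (a + s) = pi * ((a + s + (b + s)) / 2 - sqrt ((a + s) * (b + s)))"
    using sqrt_quotient_antiderivative[of "a + s" "b + s"] assms by auto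
  have "((\<lambda>x. sqrt ((b - x) * (x - a)) / (x + s)) has_integral (F (b + s) - F (a + s))) {a..b}"
  \<comment> \<open>The version with interior derivatives is essential: the square root and the
    arcsines in F are not differentiable at the end points.\<close>
  proof (rule fundamental_theorem_of_calculus_interior)
    show "continuous_on {a..b} (\<lambda>x. F (x + s))"
      by (rule continuous_on_compose2[OF F(1)]) (auto intro!: continuous_intros)
    fix x assume "x \<in> {a<..<b}"
    hence "(F has_real_derivative sqrt ((b - x) * (x - a)) / (x + s)) (at (x + s))"
      using F(2)[of "x + s"] by (simp add: algebra_simps)
    thus "((\<lambda>x. F (x + s)) has_vector_derivative sqrt ((b - x) * (x - a)) / (x + s)) (at x)"
      by (simp add: DERIV_shift has_real_derivative_iff_has_vector_derivative[symmetric])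
  qed (use assms in auto)
  thus ?thesis unfolding F(3) by (simp add: field_simps)
qed

section \<open>Mass and Stieltjes transform of the Marchenko-Pastur density\<close>

context
  fixes c \<gamma> a b :: real
  assumes c: "0 < c" and \<gamma>: "0 < \<gamma>"
  defines "a \<equiv> \<gamma> * (1 - sqrt c)\<^sup>2" and "b \<equiv> \<gamma> * (1 + sqrt c)\<^sup>2"
begin

lemma mp_edges:
  "0 \<le> a" "a < b" "a + b = 2 * \<gamma> * (1 + c)" "a * b = (\<gamma> * (1 - c))\<^sup>2"
proof -
  show "0 \<le> a" using \<gamma> by (simp add: a_def)
  have "b - a = 4 * \<gamma> * sqrt c" by (simp add: a_def b_def power2_eq_square algebra_simps)
  moreover have "0 < 4 * \<gamma> * sqrt c" using c \<gamma> by simp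
  ultimately show "a < b" by linarith
  show "a + b = 2 * \<gamma> * (1 + c)" using c by (simp add: a_def b_def power2_eq_square algebra_simps)
  have "a * b = (\<gamma> * ((1 - sqrt c) * (1 + sqrt c)))\<^sup>2" by (simp add: a_def b_def power_mult_distrib power2_eq_square)
  also have "(1 - sqrt c) * (1 + sqrt c) = 1 - c" using c by (simp add: algebra_simps)
  finally show "a * b = (\<gamma> * (1 - c))\<^sup>2" .
qed

text \<open>Since sqrt (a b) = \<gamma> |1 - c|, the value is the minimum of 1 and 1/c; for c > 1
  the missing 1 - 1/c is the weight of the atom.\<close>

lemma has_integral_mp_mass:
  "((\<lambda>x. sqrt ((b - x) * (x - a)) / (2 * pi * c * \<gamma> * x)) has_integral
      (1 + c - \<bar>1 - c\<bar>) / (2 * c)) {a..b}"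
proof -
  have "sqrt (a * b) = \<gamma> * \<bar>1 - c\<bar>" using \<gamma> by (simp add: mp_edges(4) abs_mult)
  moreover have "pi * (2 * \<gamma> * (1 + c) / 2 - \<gamma> * \<bar>1 - c\<bar>) = pi * (\<gamma> * (1 + c - \<bar>1 - c\<bar>))"
    by (simp add: right_diff_distrib)
  ultimately have "((\<lambda>x. sqrt ((b - x) * (x - a)) / x) has_integral pi * (\<gamma> * (1 + c - \<bar>1 - c\<bar>))) {a..b}"
    using has_integral_sqrt_quotient[OF mp_edges(1,2), of 0] by (simp add: mp_edges(3))
  from has_integral_divide[OF this, of "2 * pi * c * \<gamma>"] show ?thesis
    using c \<gamma> by (simp add: mult_ac)
qed

text \<open>Partial fractions, 1 / (x (x + t)) = (1/x - 1/(x + t)) / t, reduce this to the previous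
  integral at s = 0 and s = t.\<close>

lemma has_integral_mp_stieltjes:
  assumes t: "0 < t"
  shows "((\<lambda>x. sqrt ((b - x) * (x - a)) / (2 * pi * c * \<gamma> * x) * (1 / (x + t))) has_integral
      (sqrt ((a + t) * (b + t)) - t - \<gamma> * \<bar>1 - c\<bar>) / (2 * c * \<gamma> * t)) {a..b}"
proof -
  have s: "sqrt (a * b) = \<gamma> * \<bar>1 - c\<bar>" using \<gamma> by (simp add: mp_edges(4) abs_mult)
  have "((\<lambda>x. (sqrt ((b - x) * (x - a)) / (x + 0) - sqrt ((b - x) * (x - a)) / (x + t)) / (2 * pi * c * \<gamma> * t)) has_integral
      (pi * ((a + b) / 2 + 0 - sqrt ((a + 0) * (b + 0))) - pi * ((a + b) / 2 + t - sqrt ((a + t) * (b + t)))) / (2 * pi * c * \<gamma> * t)) {a..b}"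
    by (intro has_integral_divide has_integral_diff has_integral_sqrt_quotient mp_edges(1,2)) (use t in auto)
  also have "(pi * ((a + b) / 2 + 0 - sqrt ((a + 0) * (b + 0))) - pi * ((a + b) / 2 + t - sqrt ((a + t) * (b + t)))) / (2 * pi * c * \<gamma> * t)
     = (sqrt ((a + t) * (b + t)) - t - \<gamma> * \<bar>1 - c\<bar>) / (2 * c * \<gamma> * t)"
    using c \<gamma> t by (simp add: s field_simps)
  finally show ?thesis
  proof (rule has_integral_eq[rotated])
    fix x assume "x \<in> {a..b}"
    hence x: "0 \<le> x" using mp_edges(1) by simp
    define S where "S = sqrt ((b - x) * (x - a))"
    show "(sqrt ((b - x) * (x - a)) / (x + 0) - sqrt ((b - x) * (x - a)) / (x + t)) / (2 * pi * c * \<gamma> * t)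
       = sqrt ((b - x) * (x - a)) / (2 * pi * c * \<gamma> * x) * (1 / (x + t))"
    \<comment> \<open>The point 0 lies in the interval only when a = 0; there the square root
      vanishes, so both sides are 0 regardless of the quotient.\<close>
    proof (cases "x = 0")
      case True
      hence "a = 0" using \<open>x \<in> {a..b}\<close> mp_edges(1) by simp
      thus ?thesis using True by simp
    next
      case False
      hence "1 / x - 1 / (x + t) = t / (x * (x + t))" using x t by (simp add: field_simps)
      hence "S / (x + 0) - S / (x + t) = S * (t / (x * (x + t)))"
        by (simp add: divide_inverse right_diff_distrib[symmetric])
      thus ?thesis using t unfolding S_def[symmetric] by simp
    qed
  qed
qed

end

section \<open>The equation of the limiting transform\<close>

lemma mp_equation_root:
  fixes c \<gamma> t :: real
  assumes "0 < c" "0 < \<gamma>" "0 < t"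
  defines "a \<equiv> \<gamma> * (1 - sqrt c)\<^sup>2" and "b \<equiv> \<gamma> * (1 + sqrt c)\<^sup>2"
  defines "m \<equiv> (sqrt ((a + t) * (b + t)) - t + \<gamma> * (c - 1)) / (2 * c * \<gamma> * t)"
  shows "0 \<le> m" "1 - t * m = (1 / c) * (1 - 1 / (1 + \<gamma> * c * m))"
proof -
  note e = mp_edges[OF assms(1,2), folded a_def b_def]
  define D where "D = sqrt ((a + t) * (b + t))"
  \<comment> \<open>This is the discriminant of t \<gamma> c m^2 + (t + \<gamma> - \<gamma> c) m -
    1, of which the given m is the nonnegative root.\<close>
  have "(a + t) * (b + t) = (t + \<gamma> - \<gamma> * c)\<^sup>2 + 4 * t * \<gamma> * c"
  proof -
    have "(a + t) * (b + t) = a * b + (a + b) * t + t\<^sup>2" by (simp add: algebra_simps power2_eq_square)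
    thus ?thesis unfolding e(3,4) by (simp add: algebra_simps power2_eq_square)
  qed
  moreover have "0 \<le> (a + t) * (b + t)" using e assms by simp
  ultimately have D2: "D\<^sup>2 = (t + \<gamma> - \<gamma> * c)\<^sup>2 + 4 * t * \<gamma> * c" by (simp add: D_def)
  have D0: "0 \<le> D" using e assms by (simp add: D_def)
  have "\<bar>t + \<gamma> - \<gamma> * c\<bar> \<le> \<bar>D\<bar>"
    unfolding abs_le_square_iff D2 using assms(1-3) by simp
  hence "\<bar>t + \<gamma> - \<gamma> * c\<bar> \<le> D" using D0 by simp
  hence 0: "0 \<le> D - t + \<gamma> * (c - 1)" by (simp add: algebra_simps abs_le_iff)
  thus m0: "0 \<le> m" using assms by (simp add: m_def D_def)
  have D: "D = 2 * c * \<gamma> * t * m + (t + \<gamma> - \<gamma> * c)"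
    unfolding m_def D_def[symmetric] using assms(1-3) by (simp add: field_simps)
  have "4 * t * \<gamma> * c * (t * \<gamma> * c * m\<^sup>2 + (t + \<gamma> - \<gamma> * c) * m - 1) = 0"
    using D2 unfolding D by (simp add: algebra_simps power2_eq_square)
  hence q: "t * \<gamma> * c * m\<^sup>2 + (t + \<gamma> - \<gamma> * c) * m - 1 = 0" using assms by simp
  have p: "1 + \<gamma> * c * m > 0" using m0 assms(1-3) by (simp add: add_pos_nonneg)
  have "(1 - t * m) * (1 + \<gamma> * c * m) = \<gamma> * m"
    using q by (simp add: algebra_simps power2_eq_square)
  hence "1 - t * m = \<gamma> * m / (1 + \<gamma> * c * m)"
    using p by (metis less_irrefl nonzero_mult_div_cancel_right)
  also have "\<dots> = (1 / c) * (1 - 1 / (1 + \<gamma> * c * m))" using p assms(1-3) by (simp add: field_simps)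
  finally show "1 - t * m = (1 / c) * (1 - 1 / (1 + \<gamma> * c * m))" .
qed

text \<open>The function x -> 1 - t x - g x vanishes at m, and since g increases, it decreases at
  rate at least t. Uniqueness of the root and stability under a small residual come from the same
  inequality.\<close>

lemma mp_equation_contraction:
  fixes c \<gamma> t s m :: real
  assumes "0 < c" "0 < \<gamma>" "0 < t" "0 \<le> s" "0 \<le> m"
    and "1 - t * m = (1 / c) * (1 - 1 / (1 + \<gamma> * c * m))"
  shows "t * \<bar>s - m\<bar> \<le> \<bar>1 - t * s - (1 / c) * (1 - 1 / (1 + \<gamma> * c * s))\<bar>"
proof -
  define g where "g = (\<lambda>x. (1 / c) * (1 - 1 / (1 + \<gamma> * c * x)))"
  have mono: "g x \<le> g y" if "0 \<le> x" "x \<le> y" for x y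
  proof -
    have "0 < 1 + \<gamma> * c * x" using that assms by (simp add: add_pos_nonneg)
    moreover have "\<gamma> * c * x \<le> \<gamma> * c * y" using that assms by (intro mult_left_mono) auto
    ultimately have "1 / (1 + \<gamma> * c * y) \<le> 1 / (1 + \<gamma> * c * x)" by (intro divide_left_mono) auto
    thus ?thesis unfolding g_def using assms by (intro mult_left_mono) auto
  qed
  have m: "1 - t * m = g m" using assms by (simp add: g_def)
  have "t * \<bar>s - m\<bar> \<le> \<bar>1 - t * s - g s\<bar>"
  proof (cases "s \<le> m")
    case True
    have "t * \<bar>s - m\<bar> = t * m - t * s" using True by (simp add: algebra_simps)
    also have "\<dots> \<le> 1 - t * s - g s" using mono[of s m] True assms m by simp
    finally show ?thesis by simp
  next
    case False
    have "t * \<bar>s - m\<bar> = t * s - t * m" using False by (simp add: algebra_simps)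
    also have "\<dots> \<le> - (1 - t * s - g s)" using mono[of m s] False assms m by simp
    finally show ?thesis by linarith
  qed
  thus ?thesis by (simp add: g_def)
qed

section \<open>Weak convergence from Stieltjes transforms\<close>

lemma (in prob_space) abs_expectation_diff_le:
  fixes f g :: "'a \<Rightarrow> real"
  assumes "integrable M f" "integrable M g" "AE x in M. \<bar>f x - g x\<bar> \<le> d"
  shows "\<bar>expectation f - expectation g\<bar> \<le> d"
proof -
  have "\<bar>expectation f - expectation g\<bar> = \<bar>expectation (\<lambda>x. f x - g x)\<bar>" using assms by simp
  also have "\<dots> \<le> expectation (\<lambda>x. \<bar>f x - g x\<bar>)" by (rule integral_abs_bound)
  also have "\<dots> \<le> d" by (rule integral_le_const) (use assms in auto)
  finally show ?thesis .
qed

section \<open>Measures with a density and an atom at 0\<close>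

lemma nn_integral_density_plus_atom:
  fixes f :: "real \<Rightarrow> ennreal" and r :: ennreal
  assumes sets: "sets \<nu> = sets borel" and f [measurable]: "f \<in> borel_measurable borel"
    and em: "\<And>A. A \<in> sets borel \<Longrightarrow> emeasure \<nu> A = (\<integral>\<^sup>+x \<in> A. f x \<partial>lborel) + r * indicator A 0"
    and g: "g \<in> borel_measurable borel"
  shows "(\<integral>\<^sup>+x. g x \<partial>\<nu>) = (\<integral>\<^sup>+x. f x * g x \<partial>lborel) + r * g 0"
  using g
proof (induction rule: borel_measurable_induct)
  case (cong g h)
  thus ?case using sets by (simp cong: nn_integral_cong)
next
  case (set A)
  thus ?case using em sets by simp
next
  case (mult u k)
  thus ?case using sets by (simp add: nn_integral_cmult mult.left_commute[of _ k] distrib_left cong: measurable_cong_sets)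
next
  case (add u v)
  thus ?case using sets by (simp add: nn_integral_add distrib_left algebra_simps cong: measurable_cong_sets)
next
  case (seq U)
  note [measurable] = seq(1)
  have m: "\<And>i. U i \<in> borel_measurable \<nu>" using seq(1) sets by (simp cong: measurable_cong_sets)
  have eq: "(\<Squnion> range U) = (\<lambda>x. SUP i. U i x)" by (simp add: fun_eq_iff image_image)
  have "(\<integral>\<^sup>+x. (SUP i. U i x) \<partial>\<nu>) = (SUP i. \<integral>\<^sup>+x. U i x \<partial>\<nu>)"
    by (rule nn_integral_monotone_convergence_SUP[OF seq(3) m])
  also have "\<dots> = (SUP i. (\<integral>\<^sup>+x. f x * U i x \<partial>lborel) + r * U i 0)"
    using seq by simp
  also have "\<dots> = (SUP i. \<integral>\<^sup>+x. f x * U i x \<partial>lborel) + (SUP i. r * U i 0)"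
    by (rule ennreal_SUP_add) (use seq(3) in \<open>auto simp: incseq_def le_fun_def intro!: nn_integral_mono mult_left_mono\<close>)
  also have "(SUP i. r * U i 0) = r * (SUP i. U i 0)"
    by (simp add: SUP_mult_left_ennreal)
  also have "(SUP i. \<integral>\<^sup>+x. f x * U i x \<partial>lborel) = (\<integral>\<^sup>+x. (SUP i. f x * U i x) \<partial>lborel)"
    by (rule nn_integral_monotone_convergence_SUP[symmetric])
      (use seq(3) in \<open>auto simp: incseq_def le_fun_def intro!: mult_left_mono\<close>)
  also have "\<dots> = (\<integral>\<^sup>+x. f x * (SUP i. U i x) \<partial>lborel)"
    by (simp add: SUP_mult_left_ennreal)
  finally show ?case unfolding eq .
qed

text \<open>Countable additivity is inherited from the two summands, a density with respect to
  Lebesgue measure and a multiple of the unit mass at 0.\<close>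

lemma density_plus_atom_exists:
  fixes f :: "real \<Rightarrow> ennreal" and r :: ennreal
  assumes f [measurable]: "f \<in> borel_measurable borel"
  obtains \<nu> where "sets \<nu> = sets borel" "space \<nu> = UNIV"
    "\<And>A. A \<in> sets borel \<Longrightarrow> emeasure \<nu> A = (\<integral>\<^sup>+x \<in> A. f x \<partial>lborel) + r * indicator A 0"
proof -
  define m where "m = (\<lambda>A. (\<integral>\<^sup>+x \<in> A. f x \<partial>lborel) + r * indicator A (0 :: real))"
  define \<nu> where "\<nu> = measure_of UNIV (sets borel) m"
  have sig: "sigma_algebra (UNIV :: real set) (sets borel)"
    using sets.sigma_algebra_axioms[of borel] by simp
  have s: "sets \<nu> = sets borel" "space \<nu> = UNIV"
    unfolding \<nu>_def by (auto simp: sigma_algebra.sets_measure_of_eq[OF sig])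
  have "emeasure \<nu> A = m A" if "A \<in> sets borel" for A
  proof (rule emeasure_measure_of[OF \<nu>_def])
    show "positive (sets \<nu>) m" by (simp add: positive_def m_def)
    show "countably_additive (sets \<nu>) m"
    proof (rule countably_additiveI)
      fix A :: "nat \<Rightarrow> real set" assume A: "range A \<subseteq> sets \<nu>" "disjoint_family A" "(\<Union>i. A i) \<in> sets \<nu>"
      have A': "range A \<subseteq> sets (density lborel f)" "range A \<subseteq> sets (return borel (0 :: real))" using A s by auto
      have Ai: "A i \<in> sets borel" for i using A s by auto
      have "(\<Sum>i. m (A i)) = (\<Sum>i. emeasure (density lborel f) (A i) + r * emeasure (return borel 0) (A i))"
        using Ai by (simp add: m_def emeasure_density)
      also have "\<dots> = (\<Sum>i. emeasure (density lborel f) (A i)) + (\<Sum>i. r * emeasure (return borel 0) (A i))"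
        by (rule suminf_add[symmetric]) auto
      also have "\<dots> = emeasure (density lborel f) (\<Union>i. A i) + r * emeasure (return borel 0) (\<Union>i. A i)"
        using suminf_emeasure[OF A'(1) A(2)] suminf_emeasure[OF A'(2) A(2)] by simp
      also have "\<dots> = m (\<Union>i. A i)"
        using Ai by (simp add: m_def emeasure_density)
      finally show "(\<Sum>i. m (A i)) = m (\<Union>i. A i)" .
    qed
  qed (use that s in auto)
  thus thesis using that s by (auto simp: m_def)
qed

text \<open>A sequential identity theorem for power series: once the coefficients below K are known
  to vanish in the limit, they are subtracted and the rest is divided by h_j ^ K. The bound on the
  coefficients makes the remaining tail small uniformly in n, so j can be fixed before n tends to
  infinity.\<close>

lemma bounded_coefficients_tendsto_0:
  fixes d :: "nat \<Rightarrow> nat \<Rightarrow> real" and h :: "nat \<Rightarrow> real"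
  assumes bnd: "\<And>n k. \<bar>d n k\<bar> \<le> 1"
    and h: "\<And>j. 0 < h j" "\<And>j. h j \<le> 1 / 2" "h \<longlonglongrightarrow> 0"
    and lim: "\<And>j. (\<lambda>n. \<Sum>k. d n k * h j ^ k) \<longlonglongrightarrow> 0"
  shows "(\<lambda>n. d n K) \<longlonglongrightarrow> 0"
proof (induction K rule: less_induct)
  case (less K)
  have abs_sum: "summable (\<lambda>k. \<bar>d n (k + m) * h j ^ k\<bar>)" for n j m
  proof (rule summable_comparison_test')
    show "summable (\<lambda>k. h j ^ k)" using h(1,2)[of j] by (intro summable_geometric) auto
    fix k show "norm \<bar>d n (k + m) * h j ^ k\<bar> \<le> h j ^ k"
      using bnd[of n "k + m"] h(1)[of j] by (simp add: abs_mult mult_left_le_one_le)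
  qed
  have sum: "summable (\<lambda>k. d n (k + m) * h j ^ k)" for n j m
    using abs_sum by (rule summable_rabs_cancel)
  define r where "r = (\<lambda>j n. \<Sum>k. d n (k + K) * h j ^ k)"
  have r0: "r j \<longlonglongrightarrow> 0" for j
  proof -
    have "(\<lambda>n. ((\<Sum>k. d n k * h j ^ k) - (\<Sum>k<K. d n k * h j ^ k)) / h j ^ K) \<longlonglongrightarrow> (0 - (\<Sum>k<K. 0 * h j ^ k)) / h j ^ K"
      using h(1)[of j] less lim by (intro tendsto_intros) auto
    moreover have "((\<Sum>k. d n k * h j ^ k) - (\<Sum>k<K. d n k * h j ^ k)) / h j ^ K = r j n" for n
    proof -
      have "(\<Sum>k. d n k * h j ^ k) - (\<Sum>k<K. d n k * h j ^ k) = (\<Sum>k. d n (k + K) * h j ^ (k + K))"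
        using suminf_split_initial_segment[OF sum[of n 0 j, simplified], of K] by simp
      also have "\<dots> = (\<Sum>k. h j ^ K * (d n (k + K) * h j ^ k))" by (simp add: power_add mult_ac)
      also have "\<dots> = h j ^ K * r j n" unfolding r_def by (rule suminf_mult[OF sum])
      finally show ?thesis using h(1)[of j] by simp
    qed
    ultimately show ?thesis by simp
  qed
  \<comment> \<open>The terms after coefficient K are dominated by the series h + h^2 + ..., which
    is at most 2 h because h <= 1/2.\<close>
  have close: "\<bar>d n K\<bar> \<le> \<bar>r j n\<bar> + 2 * h j" for n j
  proof -
    have "r j n = d n K + (\<Sum>k. d n (Suc k + K) * h j ^ Suc k)"
      unfolding r_def by (subst suminf_split_head[OF sum]) simp
    moreover have "\<bar>\<Sum>k. d n (Suc k + K) * h j ^ Suc k\<bar> \<le> 2 * h j"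
    proof -
      have s: "summable (\<lambda>k. \<bar>d n (Suc k + K) * h j ^ Suc k\<bar>)"
        using abs_sum[of n K j] by (subst summable_Suc_iff) simp
      have g: "summable (\<lambda>k. h j * h j ^ k)" using h(1,2)[of j] by (intro summable_mult summable_geometric) auto
      have "\<bar>\<Sum>k. d n (Suc k + K) * h j ^ Suc k\<bar> \<le> (\<Sum>k. \<bar>d n (Suc k + K) * h j ^ Suc k\<bar>)"
        by (rule summable_rabs[OF s])
      also have "\<dots> \<le> (\<Sum>k. h j * h j ^ k)"
      proof (rule suminf_le[OF _ s g])
        fix k show "\<bar>d n (Suc k + K) * h j ^ Suc k\<bar> \<le> h j * h j ^ k"
          using bnd[of n "Suc k + K"] h(1)[of j] by (simp add: abs_mult mult_left_le_one_le)
      qed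
      also have "\<dots> = h j * (1 / (1 - h j))"
        using h(1,2)[of j] by (subst suminf_mult) (auto simp: suminf_geometric)
      also have "\<dots> \<le> h j * 2" using h(1,2)[of j] by (intro mult_left_mono) (auto simp: field_simps)
      finally show ?thesis by simp
    qed
    ultimately show ?thesis by linarith
  qed
  show ?case
  proof (rule LIMSEQ_I)
    fix e :: real assume e: "0 < e"
    have "eventually (\<lambda>j. h j < e / 4) sequentially"
      using h(3) e by (intro order_tendstoD) auto
    then obtain j where j: "h j < e / 4" by (auto simp: eventually_sequentially)
    obtain N where N: "\<And>n. n \<ge> N \<Longrightarrow> \<bar>r j n\<bar> < e / 2"
      using LIMSEQ_D[OF r0[of j], of "e / 2"] e by auto
    have "\<bar>d n K\<bar> < e" if "n \<ge> N" for n
      using close[of n j] N[OF that] j by linarith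
    thus "\<exists>N. \<forall>n\<ge>N. norm (d n K - 0) < e" by auto
  qed
qed

section \<open>Moments of 1 / (1 + x)\<close>

context real_distribution
begin

lemma integrable_inverse_power:
  assumes "AE x in M. 0 \<le> x"
  shows "integrable M (\<lambda>x. (1 / (1 + x)) ^ k)"
proof (rule integrable_const_bound[where B = 1])
  show "AE x in M. norm ((1 / (1 + x)) ^ k) \<le> 1"
    using assms by eventually_elim (auto simp: power_abs intro!: power_le_one)
qed simp

lemma integral_inverse_power_bounds:
  assumes "AE x in M. 0 \<le> x"
  shows "0 \<le> (\<integral>x. (1 / (1 + x)) ^ k \<partial>M)" "(\<integral>x. (1 / (1 + x)) ^ k \<partial>M) \<le> 1"
proof -
  show "0 \<le> (\<integral>x. (1 / (1 + x)) ^ k \<partial>M)"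
    by (rule integral_nonneg_AE) (use assms in \<open>eventually_elim, auto\<close>)
  show "(\<integral>x. (1 / (1 + x)) ^ k \<partial>M) \<le> 1"
    by (rule integral_le_const[OF integrable_inverse_power[OF assms]])
      (use assms in \<open>eventually_elim, auto intro!: power_le_one\<close>)
qed

text \<open>With u = 1 / (1 + x), the integrand is u / (1 - h u), a geometric series. Since u lies
  in [0, 1], it is dominated by the series of h ^ k, which justifies termwise integration.\<close>

lemma stieltjes_sums:
  assumes AE: "AE x in M. 0 \<le> x" and h: "0 < h" "h < 1"
  shows "(\<lambda>k. (\<integral>x. (1 / (1 + x)) ^ Suc k \<partial>M) * h ^ k) sums (\<integral>x. 1 / (x + (1 - h)) \<partial>M)"
proof -
  define f where "f = (\<lambda>k x. (1 / (1 + x)) ^ Suc k * h ^ k)"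
  have int: "integrable M (f k)" for k
    unfolding f_def using integrable_inverse_power[OF AE, of "Suc k"] by (rule integrable_mult_left)
  have geo: "summable (\<lambda>k. h ^ k)" using h by (intro summable_geometric) auto
  have bnd: "AE x in M. \<forall>k. norm (f k x) \<le> h ^ k"
    using AE
  proof eventually_elim
    case (elim x)
    show ?case
    proof
      fix k
      have "(1 / (1 + x)) ^ Suc k \<le> 1" using elim by (intro power_le_one) auto
      moreover have "0 \<le> (1 / (1 + x)) ^ Suc k" using elim by simp
      ultimately show "norm (f k x) \<le> h ^ k"
        using h mult_left_le_one_le[of "h ^ k" "(1 / (1 + x)) ^ Suc k"]
        unfolding f_def real_norm_def by (simp only: abs_of_nonneg zero_le_power less_imp_le mult_nonneg_nonneg)
    qed
  qed
  have "(\<lambda>k. integral\<^sup>L M (f k)) sums (\<integral>x. (\<Sum>k. f k x) \<partial>M)"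
  proof (rule sums_integral[OF int])
    show "AE x in M. summable (\<lambda>k. norm (f k x))"
      using bnd by eventually_elim (rule summable_comparison_test'[OF geo], auto)
    show "summable (\<lambda>k. \<integral>x. norm (f k x) \<partial>M)"
    proof (rule summable_comparison_test'[OF geo])
      fix k
      have "(\<integral>x. norm (f k x) \<partial>M) \<le> h ^ k"
        by (rule integral_le_const) (use int bnd in auto)
      thus "norm (\<integral>x. norm (f k x) \<partial>M) \<le> h ^ k" by simp
    qed
  qed
  moreover have "(\<integral>x. (\<Sum>k. f k x) \<partial>M) = (\<integral>x. 1 / (x + (1 - h)) \<partial>M)"
  proof (rule integral_cong_AE)
    show "(\<lambda>x. \<Sum>k. f k x) \<in> borel_measurable M" unfolding f_def by measurable
    show "AE x in M. (\<Sum>k. f k x) = 1 / (x + (1 - h))"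
      using AE
    proof eventually_elim
      case (elim x)
      have "norm (h / (1 + x)) < 1" using elim h by (auto simp: field_simps)
      hence "(\<lambda>k. 1 / (1 + x) * (h / (1 + x)) ^ k) sums (1 / (1 + x) * (1 / (1 - h / (1 + x))))"
        by (intro sums_mult geometric_sums)
      moreover have "(\<lambda>k. 1 / (1 + x) * (h / (1 + x)) ^ k) = (\<lambda>k. f k x)"
        by (simp add: f_def fun_eq_iff power_divide field_simps)
      moreover have "1 / (1 + x) * (1 / (1 - h / (1 + x))) = 1 / (x + (1 - h))"
        using elim h by (simp add: field_simps)
      ultimately show ?case by (simp add: sums_iff)
    qed
  qed simp
  moreover have "integral\<^sup>L M (f k) = (\<integral>x. (1 / (1 + x)) ^ Suc k \<partial>M) * h ^ k" for k
    unfolding f_def by (rule integral_mult_left_zero)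
  ultimately show ?thesis by (simp only:)
qed

end

text \<open>In the variable u = 1 / (1 + x) the half-line becomes a bounded interval, so polynomials
  in u approximate the test functions uniformly. The continuous step functions vanish for large x
  and therefore extend continuously to u = 0.\<close>

theorem stieltjes_imp_weak_conv:
  fixes M :: "nat \<Rightarrow> real measure" and h :: "nat \<Rightarrow> real"
  assumes M: "\<And>n. real_distribution (M n)" "\<And>n. AE x in M n. 0 \<le> x"
    and \<nu>: "real_distribution \<nu>" "AE x in \<nu>. 0 \<le> x"
    and h: "\<And>j. 0 < h j" "\<And>j. h j \<le> 1 / 2" "h \<longlonglongrightarrow> 0"
    and lim: "\<And>j. (\<lambda>n. \<integral>x. 1 / (x + (1 - h j)) \<partial>M n) \<longlonglongrightarrow> (\<integral>x. 1 / (x + (1 - h j)) \<partial>\<nu>)"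
  shows "weak_conv_m M \<nu>"
proof -
  interpret \<nu>: real_distribution \<nu> by fact
  define d where "d = (\<lambda>n k. (\<integral>x. (1 / (1 + x)) ^ Suc k \<partial>M n) - (\<integral>x. (1 / (1 + x)) ^ Suc k \<partial>\<nu>))"
  have h1: "h j < 1" for j using h(2)[of j] by simp
  have d0: "(\<lambda>n. d n k) \<longlonglongrightarrow> 0" for k
  proof (rule bounded_coefficients_tendsto_0[OF _ h])
    fix n k
    show "\<bar>d n k\<bar> \<le> 1"
      using real_distribution.integral_inverse_power_bounds[OF M, of n "Suc k"]
        \<nu>.integral_inverse_power_bounds[OF \<nu>(2), of "Suc k"] unfolding d_def by linarith
  next
    fix j
    have "(\<lambda>k. d n k * h j ^ k) sums ((\<integral>x. 1 / (x + (1 - h j)) \<partial>M n) - (\<integral>x. 1 / (x + (1 - h j)) \<partial>\<nu>))" for n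
      unfolding d_def left_diff_distrib
      by (intro sums_diff real_distribution.stieltjes_sums[OF M] \<nu>.stieltjes_sums \<nu>(2) h h1)
    hence "(\<Sum>k. d n k * h j ^ k) = (\<integral>x. 1 / (x + (1 - h j)) \<partial>M n) - (\<integral>x. 1 / (x + (1 - h j)) \<partial>\<nu>)" for n
      by (simp add: sums_iff)
    thus "(\<lambda>n. \<Sum>k. d n k * h j ^ k) \<longlonglongrightarrow> 0" using LIM_zero[OF lim[of j]] by simp
  qed
  have pow: "(\<lambda>n. \<integral>x. (1 / (1 + x)) ^ k \<partial>M n) \<longlonglongrightarrow> (\<integral>x. (1 / (1 + x)) ^ k \<partial>\<nu>)" for k
  proof (cases k)
    case 0
    have "measure (M n) (space (M n)) = 1" for n
      using M(1)[of n] by (simp add: real_distribution_def prob_space.prob_space)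
    thus ?thesis using 0 \<nu>.prob_space by simp
  next
    case (Suc i)
    show ?thesis using LIM_zero_cancel[OF d0[of i, unfolded d_def]] Suc by simp
  qed
  show ?thesis
  proof (rule integral_cts_step_conv_imp_weak_conv[OF M(1) \<nu>(1)])
    fix a b :: real assume ab: "a < b"
    \<comment> \<open>Values u < \<delta> come from x > 1 + |b| >= b, where the step function is
      already 0.\<close>
    define \<delta> where "\<delta> = 1 / (2 + \<bar>b\<bar>)"
    have \<delta>: "0 < \<delta>" by (simp add: \<delta>_def add_pos_nonneg)
    (* The step function in the variable u = 1 / (1 + x); capping u from below at \<delta> keeps \<phi>
       continuous at 0 and only matters where the step function vanishes. *)
    define \<phi> where "\<phi> = (\<lambda>u. cts_step a b (1 / max u \<delta> - 1))"
    have cs: "continuous_on UNIV (cts_step a b)"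
      using cts_step_uniformly_continuous[OF ab] by (rule uniformly_continuous_imp_continuous)
    have "continuous_on {0..1} \<phi>"
      unfolding \<phi>_def using \<delta>
      by (intro continuous_on_compose2[OF cs] continuous_intros) (auto simp: max_def)
    have \<phi>_eq: "\<phi> (1 / (1 + x)) = cts_step a b x" if "0 \<le> x" for x
    proof (cases "\<delta> \<le> 1 / (1 + x)")
      case True
      thus ?thesis using that by (simp add: \<phi>_def max_def)
    next
      case False
      hence "2 + \<bar>b\<bar> < 1 + x" using that unfolding \<delta>_def by (simp add: field_simps)
      hence "b \<le> x" by linarith
      moreover have "\<phi> (1 / (1 + x)) = cts_step a b (1 + \<bar>b\<bar>)" using False by (simp add: \<phi>_def max_def \<delta>_def)
      ultimately show ?thesis using ab by (simp add: cts_step_def)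
    qed
    show "(\<lambda>n. integral\<^sup>L (M n) (cts_step a b)) \<longlonglongrightarrow> integral\<^sup>L \<nu> (cts_step a b)"
    proof (rule LIMSEQ_I)
      fix e :: real assume e: "0 < e"
      \<comment> \<open>The error e is split three ways: polynomial approximation under
        \<open>M n\<close>, the same under \<nu>, and the difference of the polynomial
        integrals.\<close>
      obtain g where g: "polynomial_function g" "\<forall>u\<in>{0..1}. norm (\<phi> u - g u) < e / 3"
        using Stone_Weierstrass_polynomial_function[of "{0..1}" \<phi> "e / 3"] \<open>continuous_on {0..1} \<phi>\<close> e by auto
      then obtain q m where q: "g = (\<lambda>u. \<Sum>i\<le>m. q i * u ^ i)"
        by (auto simp: polynomial_function_iff_Basis_inner real_polynomial_function_iff_sum)
      define G where "G = (\<lambda>x :: real. g (1 / (1 + x)))"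
      have near: "\<bar>(\<integral>x. cts_step a b x \<partial>L) - (\<integral>x. G x \<partial>L)\<bar> \<le> e / 3" and
        Gint: "(\<integral>x. G x \<partial>L) = (\<Sum>i\<le>m. q i * (\<integral>x. (1 / (1 + x)) ^ i \<partial>L))"
        if L: "real_distribution L" "AE x in L. 0 \<le> x" for L
      proof -
        interpret L: real_distribution L by fact
        have i: "integrable L (\<lambda>x. q i * (1 / (1 + x)) ^ i)" for i
          by (intro integrable_mult_right L.integrable_inverse_power L)
        have iG: "integrable L G" unfolding G_def q by (intro Bochner_Integration.integrable_sum i)
        show "(\<integral>x. G x \<partial>L) = (\<Sum>i\<le>m. q i * (\<integral>x. (1 / (1 + x)) ^ i \<partial>L))"
          unfolding G_def q using i by (subst Bochner_Integration.integral_sum) auto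
        have ic: "integrable L (cts_step a b)" by (rule L.integrable_cts_step[OF ab])
        show "\<bar>(\<integral>x. cts_step a b x \<partial>L) - (\<integral>x. G x \<partial>L)\<bar> \<le> e / 3"
        proof (rule L.abs_expectation_diff_le[OF ic iG])
          show "AE x in L. \<bar>cts_step a b x - G x\<bar> \<le> e / 3"
            using L(2)
          proof eventually_elim
            case (elim x)
            have "1 / (1 + x) \<in> {0..1}" using elim by auto
            hence "norm (\<phi> (1 / (1 + x)) - g (1 / (1 + x))) < e / 3" using g by blast
            thus ?case using \<phi>_eq[OF elim] by (simp add: G_def)
          qed
        qed
      qed
      have "(\<lambda>n. \<integral>x. G x \<partial>M n) \<longlonglongrightarrow> (\<integral>x. G x \<partial>\<nu>)"
        unfolding Gint[OF M] Gint[OF \<nu>] by (intro tendsto_intros pow)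
      from LIMSEQ_D[OF this, of "e / 3"] e obtain N where
        N: "\<And>n. n \<ge> N \<Longrightarrow> \<bar>(\<integral>x. G x \<partial>M n) - (\<integral>x. G x \<partial>\<nu>)\<bar> < e / 3" by auto
      have "\<bar>integral\<^sup>L (M n) (cts_step a b) - integral\<^sup>L \<nu> (cts_step a b)\<bar> < e" if "n \<ge> N" for n
        using N[OF that] near[OF M, of n] near[OF \<nu>] by linarith
      thus "\<exists>N. \<forall>n\<ge>N. norm (integral\<^sup>L (M n) (cts_step a b) - integral\<^sup>L \<nu> (cts_step a b)) < e"
        by auto
    qed
  qed
qed

section \<open>Concentration under bounded differences\<close>

text \<open>McDiarmid's method on a product space. The new coordinate is integrated out; its
  fluctuation around the partial mean is handled by Hoeffding's lemma, and the partial mean by the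
  induction hypothesis.\<close>

lemma PiM_bounded_differences_mgf:
  fixes D :: "'i \<Rightarrow> 'b measure" and f :: "('i \<Rightarrow> 'b) \<Rightarrow> real" and d :: real
  assumes D: "\<And>i. prob_space (D i)" and I: "finite I" and l: "0 < l"
    and f: "f \<in> borel_measurable (PiM I D)" "\<And>x. x \<in> space (PiM I D) \<Longrightarrow> \<bar>f x\<bar> \<le> K"
    and diff: "\<And>i x y. i \<in> I \<Longrightarrow> x \<in> space (PiM I D) \<Longrightarrow> y \<in> space (D i) \<Longrightarrow> \<bar>f (x(i := y)) - f x\<bar> \<le> d"
  shows "(\<integral>\<^sup>+x. exp (l * (f x - (\<integral>x. f x \<partial>PiM I D))) \<partial>PiM I D) \<le> exp (card I * (l\<^sup>2 * d\<^sup>2 / 2))"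
  using I f diff
proof (induction I arbitrary: f rule: finite_induct)
  case empty
  interpret product_prob_space D by (intro product_prob_spaceI D)
  interpret PI: prob_space "PiM {} D" by (rule prob_space_PiM) (rule D)
  have "(\<integral>x. f x \<partial>PiM {} D) = (\<integral>x. f (\<lambda>_. undefined) \<partial>PiM {} D)"
    by (intro Bochner_Integration.integral_cong) (auto simp: space_PiM)
  also have "\<dots> = f (\<lambda>_. undefined)" using PI.prob_space by simp
  finally have E: "(\<integral>x. f x \<partial>PiM {} D) = f (\<lambda>_. undefined)" .
  have "(\<integral>\<^sup>+x. exp (l * (f x - (\<integral>x. f x \<partial>PiM {} D))) \<partial>PiM {} D) = (\<integral>\<^sup>+x. 1 \<partial>PiM {} D)"
    unfolding E by (intro nn_integral_cong) (auto simp: space_PiM)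
  thus ?case using PI.emeasure_space_1 by simp
next
  case (insert i I)
  interpret Di: prob_space "D i" by (rule D)
  interpret product_prob_space D by (intro product_prob_spaceI D)
  interpret PI: prob_space "PiM I D" by (rule prob_space_PiM) (rule D)
  interpret Q: prob_space "PiM (insert i I) D" by (rule prob_space_PiM) (rule D)
  note [measurable] = insert.prems(1)
  have upd: "x(i := y) \<in> space (PiM (insert i I) D)" if "x \<in> space (PiM I D)" "y \<in> space (D i)" for x y
    using that insert.hyps by (auto simp: space_PiM PiE_def extensional_def)
  have fm [measurable]: "(\<lambda>(x, y). f (x(i := y))) \<in> borel_measurable (PiM I D \<Otimes>\<^sub>M D i)"
    using measurable_compose[OF measurable_add_dim insert.prems(1)] by (simp add: case_prod_beta)
  have fm1: "(\<lambda>y. f (x(i := y))) \<in> borel_measurable (D i)" if "x \<in> space (PiM I D)" for x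
    using measurable_compose[OF measurable_Pair1'[OF that] fm] by simp
  have int1: "integrable (D i) (\<lambda>y. f (x(i := y)))" if "x \<in> space (PiM I D)" for x
    by (rule Di.integrable_const_bound[where B = K])
      (use fm1[OF that] upd[OF that] insert.prems(2) in auto)
  \<comment> \<open>Averaging over coordinate i keeps both the bound K and the increment d, so g
    qualifies for the induction hypothesis.\<close>
  define g where "g = (\<lambda>x. \<integral>y. f (x(i := y)) \<partial>D i)"
  have gm: "g \<in> borel_measurable (PiM I D)"
    unfolding g_def by (rule Di.borel_measurable_lebesgue_integral) (rule fm)
  have gK: "\<bar>g x\<bar> \<le> K" if x: "x \<in> space (PiM I D)" for x
  proof -
    have "\<bar>g x\<bar> \<le> (\<integral>y. \<bar>f (x(i := y))\<bar> \<partial>D i)" unfolding g_def by (rule integral_abs_bound)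
    also have "\<dots> \<le> K"
      by (rule Di.integral_le_const) (use int1[OF x] upd[OF x] insert.prems(2) in auto)
    finally show ?thesis .
  qed
  have gd: "\<bar>g (x(j := z)) - g x\<bar> \<le> d" if j: "j \<in> I" and x: "x \<in> space (PiM I D)" and z: "z \<in> space (D j)" for j x z
  proof -
    have x': "x(j := z) \<in> space (PiM I D)"
      using x z j by (auto simp: space_PiM PiE_def extensional_def)
    show ?thesis unfolding g_def
    proof (rule Di.abs_expectation_diff_le[OF int1[OF x'] int1[OF x]], rule AE_I2)
      fix y assume y: "y \<in> space (D i)"
      have "(x(j := z))(i := y) = (x(i := y))(j := z)" using j insert.hyps by (auto simp: fun_eq_iff)
      thus "\<bar>f ((x(j := z))(i := y)) - f (x(i := y))\<bar> \<le> d"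
        using insert.prems(3)[OF insertI2[OF j] upd[OF x y] z] by (simp only:)
    qed
  qed
  have Ef: "(\<integral>x. f x \<partial>PiM (insert i I) D) = (\<integral>x. g x \<partial>PiM I D)"
    unfolding g_def
    by (rule product_integral_insert[OF insert.hyps(1,2)], rule Q.integrable_const_bound[where B = K])
      (use insert.prems(2) in auto)
  define m where "m = (\<integral>x. g x \<partial>PiM I D)"
  \<comment> \<open>For fixed x the value stays within d of its mean g x, an interval of width 2 d;
    Hoeffding's l^2 (2 d)^2 / 8 is the exponent l^2 d^2 / 2.\<close>
  have inner: "(\<integral>\<^sup>+y. exp (l * (f (x(i := y)) - g x)) \<partial>D i) \<le> exp (l\<^sup>2 * d\<^sup>2 / 2)" if x: "x \<in> space (PiM I D)" for x
  proof -
    have "\<bar>f (x(i := y)) - g x\<bar> \<le> d" if y: "y \<in> space (D i)" for y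
    proof -
      have "\<bar>(\<integral>z. f (x(i := y)) \<partial>D i) - g x\<bar> \<le> d" unfolding g_def
      proof (rule Di.abs_expectation_diff_le[OF _ int1[OF x]], simp, rule AE_I2)
        fix z assume z: "z \<in> space (D i)"
        have "(x(i := z))(i := y) = x(i := y)" by simp
        thus "\<bar>f (x(i := y)) - f (x(i := z))\<bar> \<le> d"
          using insert.prems(3)[OF insertI1 upd[OF x z] y] by (simp only:)
      qed
      thus ?thesis using Di.prob_space by simp
    qed
    hence AE: "AE y in D i. f (x(i := y)) \<in> {g x - d..g x + d}" by (intro AE_I2) (force simp: abs_le_iff)
    interpret h: interval_bounded_random_variable "D i" "\<lambda>y. f (x(i := y))" "g x - d" "g x + d"
      by unfold_locales (use fm1[OF x] AE in auto)
    have "(\<integral>\<^sup>+y. exp (l * (f (x(i := y)) - g x)) \<partial>D i) \<le> exp (l\<^sup>2 * ((g x + d) - (g x - d))\<^sup>2 / 8)"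
      using h.Hoeffdings_lemma_nn_integral[OF l] by (simp add: g_def)
    also have "l\<^sup>2 * ((g x + d) - (g x - d))\<^sup>2 / 8 = l\<^sup>2 * d\<^sup>2 / 2" by (simp add: power2_eq_square)
    finally show ?thesis .
  qed
  have "(\<integral>\<^sup>+x. exp (l * (f x - m)) \<partial>PiM (insert i I) D)
      = (\<integral>\<^sup>+x. \<integral>\<^sup>+y. exp (l * (f (x(i := y)) - m)) \<partial>D i \<partial>PiM I D)"
    by (rule product_nn_integral_insert[OF insert.hyps(1,2)]) measurable
  also have "\<dots> \<le> (\<integral>\<^sup>+x. exp (l * (g x - m)) * exp (l\<^sup>2 * d\<^sup>2 / 2) \<partial>PiM I D)"
  proof (rule nn_integral_mono)
    fix x assume x: "x \<in> space (PiM I D)"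
    have "(\<integral>\<^sup>+y. exp (l * (f (x(i := y)) - m)) \<partial>D i)
        = (\<integral>\<^sup>+y. ennreal (exp (l * (g x - m))) * exp (l * (f (x(i := y)) - g x)) \<partial>D i)"
      by (intro nn_integral_cong) (simp add: ennreal_mult[symmetric] exp_add[symmetric] algebra_simps)
    also have "\<dots> = ennreal (exp (l * (g x - m))) * (\<integral>\<^sup>+y. exp (l * (f (x(i := y)) - g x)) \<partial>D i)"
      using fm1[OF x] by (intro nn_integral_cmult) auto
    also have "\<dots> \<le> ennreal (exp (l * (g x - m))) * ennreal (exp (l\<^sup>2 * d\<^sup>2 / 2))"
      by (intro mult_left_mono inner x) auto
    finally show "(\<integral>\<^sup>+y. exp (l * (f (x(i := y)) - m)) \<partial>D i) \<le> ennreal (exp (l * (g x - m)) * exp (l\<^sup>2 * d\<^sup>2 / 2))"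
      by (simp add: ennreal_mult)
  qed
  also have "\<dots> = (\<integral>\<^sup>+x. exp (l * (g x - m)) \<partial>PiM I D) * exp (l\<^sup>2 * d\<^sup>2 / 2)"
    using gm by (subst nn_integral_multc[symmetric]) (auto simp: ennreal_mult)
  also have "\<dots> \<le> ennreal (exp (card I * (l\<^sup>2 * d\<^sup>2 / 2))) * exp (l\<^sup>2 * d\<^sup>2 / 2)"
    unfolding m_def by (intro mult_right_mono insert.IH gm gK gd) auto
  also have "\<dots> = ennreal (exp (card (insert i I) * (l\<^sup>2 * d\<^sup>2 / 2)))"
    using insert.hyps by (simp add: ennreal_mult[symmetric] exp_add[symmetric] distrib_right)
  finally show ?case by (simp add: Ef m_def)
qed

context prob_space
begin

text \<open>Independence identifies the joint law with the product of the marginals. The absolute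
  value costs the factor 2 through exp |x| <= exp x + exp (- x), and the two signs are the product
  estimate for f and for -f.\<close>

lemma bounded_differences_mgf:
  fixes f :: "('i \<Rightarrow> 'b) \<Rightarrow> real" and d :: real
  assumes X: "\<And>i. random_variable (N i) (X i)" "indep_vars N X I"
    and I: "finite I" "I \<noteq> {}" and l: "0 < l"
    and f: "f \<in> borel_measurable (PiM I N)" "\<And>x. x \<in> space (PiM I N) \<Longrightarrow> \<bar>f x\<bar> \<le> K"
    and diff: "\<And>i x y. i \<in> I \<Longrightarrow> x \<in> space (PiM I N) \<Longrightarrow> y \<in> space (N i) \<Longrightarrow> \<bar>f (x(i := y)) - f x\<bar> \<le> d"
  defines "T \<equiv> \<lambda>\<omega>. f (\<lambda>i\<in>I. X i \<omega>)"
  shows "(\<integral>\<^sup>+\<omega>. exp (l * \<bar>T \<omega> - expectation T\<bar>) \<partial>M) \<le> ennreal (2 * exp (card I * (l\<^sup>2 * d\<^sup>2 / 2)))"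
proof -
  define D where "D = (\<lambda>i. distr M (N i) (X i))"
  have D: "prob_space (D i)" for i unfolding D_def by (rule prob_space_distr[OF X(1)])
  have Xm: "(\<lambda>\<omega>. \<lambda>i\<in>I. X i \<omega>) \<in> measurable M (PiM I N)" using X(1) by (intro measurable_restrict)
  have eq: "distr M (PiM I N) (\<lambda>\<omega>. \<lambda>i\<in>I. X i \<omega>) = PiM I D"
    using indep_vars_iff_distr_eq_PiM[OF I(2) X(1)] X(2) by (simp add: D_def)
  have s: "sets (PiM I D) = sets (PiM I N)" by (intro sets_PiM_cong) (auto simp: D_def)
  have sp: "space (PiM I D) = space (PiM I N)" using s by (rule sets_eq_imp_space_eq)
  have spD: "space (D i) = space (N i)" for i by (simp add: D_def)
  have fm: "f \<in> borel_measurable (PiM I D)" using f(1) s by (simp cong: measurable_cong_sets)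
  have ET: "expectation T = (\<integral>x. f x \<partial>PiM I D)"
    unfolding T_def eq[symmetric] by (rule integral_distr[symmetric, OF Xm f(1)])
  have Tm: "T \<in> borel_measurable M" unfolding T_def using Xm f(1) by measurable
  let ?B = "exp (card I * (l\<^sup>2 * d\<^sup>2 / 2))"
  have signed: "(\<integral>\<^sup>+\<omega>. exp (l * (\<epsilon> * T \<omega> - \<epsilon> * expectation T)) \<partial>M) \<le> ?B" if \<epsilon>: "\<bar>\<epsilon>\<bar> = 1" for \<epsilon> :: real
  proof -
    have "(\<integral>\<^sup>+\<omega>. exp (l * (\<epsilon> * T \<omega> - \<epsilon> * expectation T)) \<partial>M)
        = (\<integral>\<^sup>+x. exp (l * (\<epsilon> * f x - (\<integral>x. \<epsilon> * f x \<partial>PiM I D))) \<partial>PiM I D)"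
      unfolding integral_mult_right_zero ET unfolding T_def eq[symmetric]
      using f(1) Xm by (subst nn_integral_distr) auto
    also have "\<dots> \<le> ?B"
      by (rule PiM_bounded_differences_mgf[OF D I(1) l, where K = K])
        (use fm f(2) diff \<epsilon> in \<open>auto simp: sp spD abs_mult right_diff_distrib[symmetric]\<close>)
    finally show ?thesis .
  qed
  have a: "(\<integral>\<^sup>+\<omega>. exp (l * (T \<omega> - expectation T)) \<partial>M) \<le> ?B" using signed[of 1] by simp
  have b: "(\<integral>\<^sup>+\<omega>. exp (l * (expectation T - T \<omega>)) \<partial>M) \<le> ?B" using signed[of "-1"] by simp
  have "(\<integral>\<^sup>+\<omega>. exp (l * \<bar>T \<omega> - expectation T\<bar>) \<partial>M)
      \<le> (\<integral>\<^sup>+\<omega>. ennreal (exp (l * (T \<omega> - expectation T))) + ennreal (exp (l * (expectation T - T \<omega>))) \<partial>M)"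
    by (intro nn_integral_mono) (auto simp: abs_if ennreal_plus[symmetric] simp del: ennreal_plus)
  also have "\<dots> = (\<integral>\<^sup>+\<omega>. exp (l * (T \<omega> - expectation T)) \<partial>M) + (\<integral>\<^sup>+\<omega>. exp (l * (expectation T - T \<omega>)) \<partial>M)"
    using Tm by (intro nn_integral_add) auto
  also have "\<dots> \<le> ennreal ?B + ennreal ?B"
    by (intro add_mono a b)
  also have "\<dots> = ennreal (2 * ?B)"
    by (simp add: ennreal_plus[symmetric] del: ennreal_plus)
  finally show ?thesis .
qed

lemma bounded_differences_concentration:
  fixes f :: "('i \<Rightarrow> 'b) \<Rightarrow> real" and d :: real
  assumes X: "\<And>i. random_variable (N i) (X i)" "indep_vars N X I"
    and I: "finite I" "I \<noteq> {}" and d: "0 < d"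
    and f: "f \<in> borel_measurable (PiM I N)" "\<And>x. x \<in> space (PiM I N) \<Longrightarrow> \<bar>f x\<bar> \<le> K"
    and diff: "\<And>i x y. i \<in> I \<Longrightarrow> x \<in> space (PiM I N) \<Longrightarrow> y \<in> space (N i) \<Longrightarrow> \<bar>f (x(i := y)) - f x\<bar> \<le> d"
  defines "T \<equiv> \<lambda>\<omega>. f (\<lambda>i\<in>I. X i \<omega>)"
  shows "0 < e \<Longrightarrow> prob {\<omega> \<in> space M. e \<le> \<bar>T \<omega> - expectation T\<bar>} \<le> 2 * exp (- e\<^sup>2 / (2 * card I * d\<^sup>2))"
    and "expectation (\<lambda>\<omega>. \<bar>T \<omega> - expectation T\<bar>) \<le> 2 * exp (1 / 2) * (d * sqrt (card I))"
proof -
  have Xm: "(\<lambda>\<omega>. \<lambda>i\<in>I. X i \<omega>) \<in> measurable M (PiM I N)" using X(1) by (intro measurable_restrict)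
  have Tm [measurable]: "T \<in> borel_measurable M" unfolding T_def using Xm f(1) by measurable
  have n: "0 < real (card I)" using I by (simp add: card_gt_0_iff)
  have mgf: "(\<integral>\<^sup>+\<omega>. exp (l * \<bar>T \<omega> - expectation T\<bar>) \<partial>M) \<le> ennreal (2 * exp (card I * (l\<^sup>2 * d\<^sup>2 / 2)))"
    if "0 < l" for l
    unfolding T_def by (rule bounded_differences_mgf[OF X I that f diff])
  show "prob {\<omega> \<in> space M. e \<le> \<bar>T \<omega> - expectation T\<bar>} \<le> 2 * exp (- e\<^sup>2 / (2 * card I * d\<^sup>2))" if e: "0 < e"
  proof -
    \<comment> \<open>The minimiser of the Chernoff exponent card I * l^2 d^2 / 2 - l e.\<close>
    define l where "l = e / (card I * d\<^sup>2)"
    have l: "0 < l" using e n d by (simp add: l_def)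
    have "emeasure M {\<omega> \<in> space M. e \<le> \<bar>T \<omega> - expectation T\<bar>}
        \<le> emeasure M {\<omega> \<in> space M. 1 \<le> ennreal (exp (- (l * e))) * ennreal (exp (l * \<bar>T \<omega> - expectation T\<bar>))}"
      using l by (intro emeasure_mono) (auto simp: ennreal_mult[symmetric] exp_add[symmetric])
    also have "\<dots> \<le> ennreal (exp (- (l * e))) * (\<integral>\<^sup>+\<omega>. ennreal (exp (l * \<bar>T \<omega> - expectation T\<bar>)) * indicator (space M) \<omega> \<partial>M)"
      by (rule nn_integral_Markov_inequality) measurable
    also have "(\<integral>\<^sup>+\<omega>. ennreal (exp (l * \<bar>T \<omega> - expectation T\<bar>)) * indicator (space M) \<omega> \<partial>M) = (\<integral>\<^sup>+\<omega>. exp (l * \<bar>T \<omega> - expectation T\<bar>) \<partial>M)"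
      by (intro nn_integral_cong) simp
    also have "ennreal (exp (- (l * e))) * \<dots> \<le> ennreal (exp (- (l * e))) * ennreal (2 * exp (card I * (l\<^sup>2 * d\<^sup>2 / 2)))"
      by (intro mult_left_mono mgf l) auto
    also have "\<dots> = ennreal (2 * exp (card I * (l\<^sup>2 * d\<^sup>2 / 2) - l * e))"
    proof -
      have "exp (- (l * e)) * exp (card I * (l\<^sup>2 * d\<^sup>2 / 2)) = exp (card I * (l\<^sup>2 * d\<^sup>2 / 2) - l * e)"
        unfolding exp_add[symmetric] by (rule arg_cong[where f = exp]) simp
      thus ?thesis by (simp only: ennreal_mult[symmetric] mult.left_commute[of _ 2] exp_ge_zero mult_nonneg_nonneg zero_le_numeral)
    qed
    also have "card I * (l\<^sup>2 * d\<^sup>2 / 2) - l * e = - e\<^sup>2 / (2 * card I * d\<^sup>2)"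
      using n d by (simp add: l_def power2_eq_square field_simps)
    finally show ?thesis by (simp add: emeasure_eq_measure)
  qed
  \<comment> \<open>This scale makes the exponent equal to 1/2; the mean deviation is then bounded
    through y <= exp y.\<close>
  define l where "l = 1 / (d * sqrt (card I))"
  have l: "0 < l" using n d by (simp add: l_def)
  have "integrable M T"
    by (rule integrable_const_bound[where B = K])
      (use f(2) Tm measurable_space[OF Xm] in \<open>auto simp: T_def\<close>)
  hence int: "integrable M (\<lambda>\<omega>. \<bar>T \<omega> - expectation T\<bar>)" by simp
  have "ennreal l * ennreal (expectation (\<lambda>\<omega>. \<bar>T \<omega> - expectation T\<bar>)) = ennreal l * (\<integral>\<^sup>+\<omega>. \<bar>T \<omega> - expectation T\<bar> \<partial>M)"
    using int by (subst nn_integral_eq_integral) auto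
  also have "\<dots> = (\<integral>\<^sup>+\<omega>. ennreal l * ennreal \<bar>T \<omega> - expectation T\<bar> \<partial>M)"
    by (rule nn_integral_cmult[symmetric]) measurable
  also have "\<dots> \<le> (\<integral>\<^sup>+\<omega>. exp (l * \<bar>T \<omega> - expectation T\<bar>) \<partial>M)"
  proof (intro nn_integral_mono)
    fix \<omega>
    have "l * \<bar>T \<omega> - expectation T\<bar> \<le> exp (l * \<bar>T \<omega> - expectation T\<bar>)"
      using exp_ge_add_one_self[of "l * \<bar>T \<omega> - expectation T\<bar>"] by linarith
    thus "ennreal l * ennreal \<bar>T \<omega> - expectation T\<bar> \<le> ennreal (exp (l * \<bar>T \<omega> - expectation T\<bar>))"
      using l by (simp add: ennreal_mult[symmetric] ennreal_leI)
  qed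
  also have "\<dots> \<le> ennreal (2 * exp (card I * (l\<^sup>2 * d\<^sup>2 / 2)))" by (rule mgf[OF l])
  also have "card I * (l\<^sup>2 * d\<^sup>2 / 2) = 1 / 2"
    using n d by (simp add: l_def power_divide power_mult_distrib)
  finally have "l * expectation (\<lambda>\<omega>. \<bar>T \<omega> - expectation T\<bar>) \<le> 2 * exp (1 / 2)"
    using l by (simp add: ennreal_mult[symmetric])
  thus "expectation (\<lambda>\<omega>. \<bar>T \<omega> - expectation T\<bar>) \<le> 2 * exp (1 / 2) * (d * sqrt (card I))"
    using n d by (simp add: l_def field_simps)
qed

end

section \<open>Variance of a quadratic form\<close>

lemma prod_two_exceptions:
  fixes f :: "nat \<Rightarrow> real"
  assumes "j < m" "k < m"
  shows "(\<Prod>i<m. if i \<noteq> j \<and> i \<noteq> k then 1 else f i) = (if j = k then f j else f j * f k)"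
proof -
  have "(\<Prod>i<m. if i \<noteq> j \<and> i \<noteq> k then 1 else f i) = (\<Prod>i\<in>{j, k}. f i)"
    using assms by (intro prod.mono_neutral_cong_right) auto
  thus ?thesis by simp
qed

lemma (in prob_space) fourth_moment_imp_square_integrable:
  fixes Y :: "'a \<Rightarrow> real"
  assumes [measurable]: "Y \<in> borel_measurable M" and int: "integrable M (\<lambda>\<omega>. Y \<omega> ^ 4)"
  shows "integrable M (\<lambda>\<omega>. (Y \<omega>)\<^sup>2)"
proof (rule Bochner_Integration.integrable_bound)
  show "integrable M (\<lambda>\<omega>. 1 + Y \<omega> ^ 4)" using int by auto
  have "x\<^sup>2 \<le> 1 + x ^ 4" for x :: real
    using zero_le_power2[of "x\<^sup>2 - 1/2"] by (simp add: power2_eq_square power4_eq_xxxx algebra_simps)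
  thus "AE \<omega> in M. norm ((Y \<omega>)\<^sup>2) \<le> norm (1 + Y \<omega> ^ 4)" by (intro AE_I2) simp
qed simp

text \<open>The centred form is a combination of the products \<open>e a\<close>, which are
  orthogonal except that \<open>e a\<close> coincides with \<open>e (prod.swap a)\<close>, and each
  has second moment at most \<kappa>. The cross term G i j * G j i is bounded by the mean of the two
  squares, whence the factor 2 for arbitrary coefficients.\<close>

lemma (in prob_space) quadratic_form_variance:
  fixes X :: "nat \<Rightarrow> 'a \<Rightarrow> real" and G :: "nat \<Rightarrow> nat \<Rightarrow> real"
  assumes ind: "indep_vars (\<lambda>_. borel) X {..<m}"
    and int: "\<And>i. i < m \<Longrightarrow> integrable M (\<lambda>\<omega>. X i \<omega> ^ 4)"
    and mom: "\<And>i. i < m \<Longrightarrow> expectation (X i) = 0" "\<And>i. i < m \<Longrightarrow> expectation (\<lambda>\<omega>. (X i \<omega>)\<^sup>2) = s"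
      "\<And>i. i < m \<Longrightarrow> expectation (\<lambda>\<omega>. X i \<omega> ^ 4) = \<kappa>"
  shows "(\<integral>\<^sup>+\<omega>. ((\<Sum>i<m. \<Sum>j<m. G i j * X i \<omega> * X j \<omega>) - s * (\<Sum>i<m. G i i))\<^sup>2 \<partial>M)
     \<le> ennreal (2 * \<kappa> * (\<Sum>i<m. \<Sum>j<m. (G i j)\<^sup>2))"
proof -
  have Xm [measurable]: "X i \<in> borel_measurable M" if "i < m" for i
    using ind that by (auto simp: indep_vars_def)
  have X2: "integrable M (\<lambda>\<omega>. (X i \<omega>)\<^sup>2)" if "i < m" for i
    using fourth_moment_imp_square_integrable[OF Xm int] that by simp
  have X1: "integrable M (X i)" if "i < m" for i
    using square_integrable_imp_integrable[OF Xm X2] that by simp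
  (* e (j, k) is X j * X k minus its mean, written as a product over all coordinates:
     two of them are orthogonal unless they involve the same set of indices. *)
  define \<psi> where "\<psi> = (\<lambda>(j :: nat, k :: nat) i x. if i \<noteq> j \<and> i \<noteq> k then 1 else if j = k then x\<^sup>2 - s else x :: real)"
  define e where "e = (\<lambda>a \<omega>. \<Prod>i<m. \<psi> a i (X i \<omega>))"
  define F where "F = {..<m} \<times> {..<m}"
  define g where "g = (\<lambda>(i, j). G i j)"
  have fin: "finite F" by (simp add: F_def)
  have swap: "\<psi> (k, j) = \<psi> (j, k)" for j k by (auto simp: \<psi>_def fun_eq_iff)
  have e_eq: "e (j, k) \<omega> = X j \<omega> * X k \<omega> - (if j = k then s else 0)" if "j < m" "k < m" for j k \<omega>
  proof -
    have "e (j, k) \<omega> = (\<Prod>i<m. if i \<noteq> j \<and> i \<noteq> k then 1 else if j = k then (X i \<omega>)\<^sup>2 - s else X i \<omega>)"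
      by (simp add: e_def \<psi>_def)
    also have "\<dots> = X j \<omega> * X k \<omega> - (if j = k then s else 0)"
      by (subst prod_two_exceptions[OF that]) (auto simp: power2_eq_square)
    finally show ?thesis .
  qed
  have quad: "(\<Sum>i<m. \<Sum>j<m. G i j * X i \<omega> * X j \<omega>) - s * (\<Sum>i<m. G i i) = (\<Sum>a\<in>F. g a * e a \<omega>)" for \<omega>
  proof -
    have "(\<Sum>a\<in>F. g a * e a \<omega>) = (\<Sum>i<m. \<Sum>j<m. G i j * e (i, j) \<omega>)"
      by (simp add: F_def g_def sum.cartesian_product case_prod_beta)
    also have "\<dots> = (\<Sum>i<m. \<Sum>j<m. G i j * X i \<omega> * X j \<omega> - (if i = j then s * G i j else 0))"
      by (intro sum.cong refl) (auto simp: e_eq algebra_simps)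
    also have "\<dots> = (\<Sum>i<m. \<Sum>j<m. G i j * X i \<omega> * X j \<omega>) - s * (\<Sum>i<m. G i i)"
      by (simp add: sum_subtractf sum_distrib_left)
    finally show ?thesis by simp
  qed
  have \<psi>m: "\<psi> a i \<in> borel_measurable borel" for a i by (cases a) (simp add: \<psi>_def)
  have \<psi>sq: "integrable M (\<lambda>\<omega>. (\<psi> a i (X i \<omega>))\<^sup>2)" if i: "i < m" for a i
  proof -
    obtain j k where a: "a = (j, k)" by (cases a)
    have "integrable M (\<lambda>\<omega>. X i \<omega> ^ 4 - 2 * s * (X i \<omega>)\<^sup>2 + s\<^sup>2)" using int[OF i] X2[OF i] by auto
    also have "(\<lambda>\<omega>. X i \<omega> ^ 4 - 2 * s * (X i \<omega>)\<^sup>2 + s\<^sup>2) = (\<lambda>\<omega>. ((X i \<omega>)\<^sup>2 - s)\<^sup>2)"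
      by (simp add: fun_eq_iff power2_eq_square power4_eq_xxxx algebra_simps)
    finally show ?thesis using X2[OF i] by (cases "j = k"; cases "i = j"; cases "i = k") (simp_all add: \<psi>_def a)
  qed
  have \<psi>\<psi>: "integrable M (\<lambda>\<omega>. \<psi> a i (X i \<omega>) * \<psi> b i (X i \<omega>))" if i: "i < m" for a b i
  proof (rule Bochner_Integration.integrable_bound)
    show "integrable M (\<lambda>\<omega>. (\<psi> a i (X i \<omega>))\<^sup>2 + (\<psi> b i (X i \<omega>))\<^sup>2)" using \<psi>sq[OF i] by auto
    show "(\<lambda>\<omega>. \<psi> a i (X i \<omega>) * \<psi> b i (X i \<omega>)) \<in> borel_measurable M"
      using \<psi>m Xm[OF i] by (intro borel_measurable_times) (auto intro: measurable_compose)
    have "\<bar>x * y\<bar> \<le> x\<^sup>2 + y\<^sup>2" for x y :: real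
    proof -
      have "2 * (\<bar>x\<bar> * \<bar>y\<bar>) \<le> \<bar>x\<bar>\<^sup>2 + \<bar>y\<bar>\<^sup>2" using sum_squares_bound[of "\<bar>x\<bar>" "\<bar>y\<bar>"] by simp
      moreover have "0 \<le> \<bar>x\<bar> * \<bar>y\<bar>" by simp
      ultimately show ?thesis unfolding abs_mult power2_abs by linarith
    qed
    thus "AE \<omega> in M. norm (\<psi> a i (X i \<omega>) * \<psi> b i (X i \<omega>)) \<le> norm ((\<psi> a i (X i \<omega>))\<^sup>2 + (\<psi> b i (X i \<omega>))\<^sup>2)"
      by (intro AE_I2) simp
  qed
  have ind2: "indep_vars (\<lambda>_. borel) (\<lambda>i \<omega>. \<psi> a i (X i \<omega>) * \<psi> b i (X i \<omega>)) {..<m}" for a b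
    using indep_vars_compose2[OF ind, of "\<lambda>i x. \<psi> a i x * \<psi> b i x" "\<lambda>_. borel"] \<psi>m by auto
  have ee: "e a \<omega> * e b \<omega> = (\<Prod>i<m. \<psi> a i (X i \<omega>) * \<psi> b i (X i \<omega>))" for a b \<omega>
    by (simp add: e_def prod.distrib)
  have ee_int: "integrable M (\<lambda>\<omega>. e a \<omega> * e b \<omega>)" for a b
    unfolding ee by (rule indep_vars_integrable[OF _ ind2 \<psi>\<psi>]) auto
  have ee_E: "expectation (\<lambda>\<omega>. e a \<omega> * e b \<omega>) = (\<Prod>i<m. expectation (\<lambda>\<omega>. \<psi> a i (X i \<omega>) * \<psi> b i (X i \<omega>)))" for a b
    unfolding ee by (rule indep_vars_lebesgue_integral[OF _ ind2 \<psi>\<psi>]) auto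
  have \<psi>0: "expectation (\<lambda>\<omega>. \<psi> (j, k) i (X i \<omega>)) = 0" if "i < m" "i = j \<or> i = k" for i j k
    using that X2[of i] mom(1,2)[of i] prob_space by (cases "j = k") (auto simp: \<psi>_def)
  have orth: "expectation (\<lambda>\<omega>. e a \<omega> * e b \<omega>) = 0" if "a \<in> F" "b \<in> F" "b \<noteq> a" "b \<noteq> prod.swap a" for a b
  proof -
    note ne = that(3,4)
    obtain j k l n where ab: "a = (j, k)" "b = (l, n)" by (cases a, cases b)
    have lt: "j < m" "k < m" "l < m" "n < m" using that ab by (auto simp: F_def)
    have "\<exists>i<m. expectation (\<lambda>\<omega>. \<psi> a i (X i \<omega>) * \<psi> b i (X i \<omega>)) = 0"
    proof -
      \<comment> \<open>Two pairs that differ as sets leave some index in exactly one of them; at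
        that index the other factor is 1 and the remaining factor has mean 0.\<close>
      consider i where "i = j \<or> i = k" "i \<noteq> l" "i \<noteq> n" | i where "i = l \<or> i = n" "i \<noteq> j" "i \<noteq> k"
        using ne unfolding ab by auto
      thus ?thesis
      proof cases
        case 1
        thus ?thesis using \<psi>0[of i j k] lt unfolding ab by (intro exI[of _ i]) (auto simp: \<psi>_def)
      next
        case 2
        thus ?thesis using \<psi>0[of i l n] lt unfolding ab by (intro exI[of _ i]) (auto simp: \<psi>_def)
      qed
    qed
    thus ?thesis unfolding ee_E by (auto intro: prod_zero)
  qed
  \<comment> \<open>Both bounds follow from one computation: the variance of the square of X i is
    \<kappa> - s^2, and it is nonnegative.\<close>
  have s2: "s\<^sup>2 \<le> \<kappa>" "expectation (\<lambda>\<omega>. ((X i \<omega>)\<^sup>2 - s)\<^sup>2) \<le> \<kappa>" if i: "i < m" for i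
  proof -
    have "expectation (\<lambda>\<omega>. ((X i \<omega>)\<^sup>2 - s)\<^sup>2) = expectation (\<lambda>\<omega>. X i \<omega> ^ 4 - 2 * s * (X i \<omega>)\<^sup>2 + s\<^sup>2)"
      by (intro Bochner_Integration.integral_cong) (auto simp: power2_eq_square power4_eq_xxxx algebra_simps)
    also have "\<dots> = \<kappa> - s\<^sup>2"
      using int[OF i] X2[OF i] mom(2,3)[OF i] prob_space by (simp add: power2_eq_square)
    finally have "expectation (\<lambda>\<omega>. ((X i \<omega>)\<^sup>2 - s)\<^sup>2) = \<kappa> - s\<^sup>2" .
    moreover have "0 \<le> expectation (\<lambda>\<omega>. ((X i \<omega>)\<^sup>2 - s)\<^sup>2)" by (rule integral_nonneg_AE) auto
    ultimately show "s\<^sup>2 \<le> \<kappa>" "expectation (\<lambda>\<omega>. ((X i \<omega>)\<^sup>2 - s)\<^sup>2) \<le> \<kappa>" by auto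
  qed
  have diag: "expectation (\<lambda>\<omega>. e a \<omega> * e a \<omega>) \<le> \<kappa>" if "a \<in> F" for a
  proof -
    obtain j k where a: "a = (j, k)" by (cases a)
    have lt: "j < m" "k < m" using that a by (auto simp: F_def)
    have "expectation (\<lambda>\<omega>. e a \<omega> * e a \<omega>) = (\<Prod>i<m. if i \<noteq> j \<and> i \<noteq> k then 1
        else expectation (\<lambda>\<omega>. if j = k then ((X i \<omega>)\<^sup>2 - s)\<^sup>2 else (X i \<omega>)\<^sup>2))"
      unfolding ee_E a using prob_space
      by (intro prod.cong refl) (cases "j = k", auto simp: \<psi>_def power2_eq_square)
    also have "\<dots> = (if j = k then expectation (\<lambda>\<omega>. ((X j \<omega>)\<^sup>2 - s)\<^sup>2) else s\<^sup>2)"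
      using mom(2) lt by (subst prod_two_exceptions[OF lt]) (auto simp: power2_eq_square)
    also have "\<dots> \<le> \<kappa>" using s2 lt by auto
    finally show ?thesis .
  qed
  have diag0: "0 \<le> expectation (\<lambda>\<omega>. e a \<omega> * e a \<omega>)" for a by (rule integral_nonneg_AE) auto
  have swap_e: "e (prod.swap a) = e a" for a by (cases a) (simp add: e_def swap fun_eq_iff)
  have row: "(\<Sum>b\<in>F. g a * g b * expectation (\<lambda>\<omega>. e a \<omega> * e b \<omega>)) \<le> \<kappa> * ((g a)\<^sup>2 + ((g a)\<^sup>2 + (g (prod.swap a))\<^sup>2) / 2)" if a: "a \<in> F" for a
  proof -
    define v where "v = expectation (\<lambda>\<omega>. e a \<omega> * e a \<omega>)"
    have v: "0 \<le> v" "v \<le> \<kappa>" using diag[OF a] diag0 by (auto simp: v_def)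
    have sub: "{a, prod.swap a} \<subseteq> F" using a by (auto simp: F_def)
    have "(\<Sum>b\<in>F. g a * g b * expectation (\<lambda>\<omega>. e a \<omega> * e b \<omega>))
        = (\<Sum>b\<in>{a, prod.swap a}. g a * g b * expectation (\<lambda>\<omega>. e a \<omega> * e b \<omega>))"
      using orth[OF a] sub by (intro sum.mono_neutral_right fin) auto
    also have "\<dots> = (\<Sum>b\<in>{a, prod.swap a}. g a * g b * v)"
      by (intro sum.cong refl) (auto simp: swap_e v_def)
    also have "\<dots> \<le> v * ((g a)\<^sup>2 + ((g a)\<^sup>2 + (g (prod.swap a))\<^sup>2) / 2)"
    proof (cases "prod.swap a = a")
      case True
      thus ?thesis using v by (simp add: power2_eq_square algebra_simps)
    next
      case False
      hence "(\<Sum>b\<in>{a, prod.swap a}. g a * g b * v) = v * ((g a)\<^sup>2 + g a * g (prod.swap a))"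
        by (simp add: power2_eq_square algebra_simps)
      also have "\<dots> \<le> v * ((g a)\<^sup>2 + ((g a)\<^sup>2 + (g (prod.swap a))\<^sup>2) / 2)"
        using sum_squares_bound[of "g a" "g (prod.swap a)"] v by (intro mult_left_mono) auto
      finally show ?thesis .
    qed
    also have "\<dots> \<le> \<kappa> * ((g a)\<^sup>2 + ((g a)\<^sup>2 + (g (prod.swap a))\<^sup>2) / 2)"
      using v by (intro mult_right_mono) auto
    finally show ?thesis .
  qed
  have sq: "(\<Sum>a\<in>F. g a * e a \<omega>)\<^sup>2 = (\<Sum>a\<in>F. \<Sum>b\<in>F. g a * g b * (e a \<omega> * e b \<omega>))" for \<omega>
    unfolding power2_eq_square sum_product by (simp add: mult_ac)
  have "(\<integral>\<^sup>+\<omega>. (\<Sum>a\<in>F. g a * e a \<omega>)\<^sup>2 \<partial>M) = ennreal (expectation (\<lambda>\<omega>. (\<Sum>a\<in>F. g a * e a \<omega>)\<^sup>2))"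
  proof (rule nn_integral_eq_integral)
    show "integrable M (\<lambda>\<omega>. (\<Sum>a\<in>F. g a * e a \<omega>)\<^sup>2)"
      unfolding sq by (intro Bochner_Integration.integrable_sum integrable_mult_right ee_int)
  qed simp
  also have "expectation (\<lambda>\<omega>. (\<Sum>a\<in>F. g a * e a \<omega>)\<^sup>2) = (\<Sum>a\<in>F. \<Sum>b\<in>F. g a * g b * expectation (\<lambda>\<omega>. e a \<omega> * e b \<omega>))"
    unfolding sq by (simp add: ee_int)
  also have "\<dots> \<le> (\<Sum>a\<in>F. \<kappa> * ((g a)\<^sup>2 + ((g a)\<^sup>2 + (g (prod.swap a))\<^sup>2) / 2))"
    by (intro sum_mono row)
  also have "\<dots> = \<kappa> * ((\<Sum>a\<in>F. (g a)\<^sup>2) + ((\<Sum>a\<in>F. (g a)\<^sup>2) + (\<Sum>a\<in>F. (g (prod.swap a))\<^sup>2)) / 2)"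
    by (simp add: sum_distrib_left[symmetric] sum.distrib sum_divide_distrib[symmetric])
  also have "(\<Sum>a\<in>F. (g (prod.swap a))\<^sup>2) = (\<Sum>a\<in>F. (g a)\<^sup>2)"
    by (rule sum.reindex_bij_witness[of _ prod.swap prod.swap]) (auto simp: F_def)
  also have "\<kappa> * ((\<Sum>a\<in>F. (g a)\<^sup>2) + ((\<Sum>a\<in>F. (g a)\<^sup>2) + (\<Sum>a\<in>F. (g a)\<^sup>2)) / 2) = 2 * \<kappa> * (\<Sum>i<m. \<Sum>j<m. (G i j)\<^sup>2)"
    unfolding F_def by (simp add: sum.cartesian_product g_def case_prod_beta)
  finally show ?thesis unfolding quad by (simp add: ennreal_leI)
qed

section \<open>Expected resolvent trace of a row-normalised array\<close>

lemma det_measurable: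
  assumes A: "\<And>x. A x \<in> carrier_mat m m"
    and meas: "\<And>i j. i < m \<Longrightarrow> j < m \<Longrightarrow> (\<lambda>x. A x $$ (i, j)) \<in> borel_measurable M"
  shows "(\<lambda>x. det (A x) :: real) \<in> borel_measurable M"
  unfolding det_def'[OF A]
proof (intro borel_measurable_sum borel_measurable_times borel_measurable_prod borel_measurable_const)
  fix \<pi> i assume "\<pi> \<in> {\<pi>. \<pi> permutes {0..<m}}" "i \<in> {0..<m}"
  thus "(\<lambda>x. A x $$ (i, \<pi> i)) \<in> borel_measurable M"
    using permutes_in_image[of \<pi> "{0..<m}" i] by (intro meas) auto
qed

lemma resolvent_measurable:
  assumes A: "\<And>x. A x \<in> carrier_mat m m"
    and meas: "\<And>i j. i < m \<Longrightarrow> j < m \<Longrightarrow> (\<lambda>x. A x $$ (i, j)) \<in> borel_measurable M"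
    and ij: "i < m" "j < m"
  shows "(\<lambda>x. resolvent t (A x) $$ (i, j)) \<in> borel_measurable M"
proof -
  have S: "shift_mat t (A x) \<in> carrier_mat m m" for x using A by simp
  have d: "dim_row (A x) = m" "dim_col (A x) = m" for x using A[of x] by auto
  have dS: "dim_row (shift_mat t (A x)) = m" "dim_col (shift_mat t (A x)) = m" for x using S[of x] by auto
  have Sm: "(\<lambda>x. shift_mat t (A x) $$ (k, l)) \<in> borel_measurable M" if "k < m" "l < m" for k l
    using meas[OF that] that by (simp add: shift_mat_def d)
  have del: "mat_delete (shift_mat t (A x)) j i \<in> carrier_mat (m - 1) (m - 1)" for x
    using S[of x] by (auto simp: mat_delete_def)
  have "(\<lambda>x. det (mat_delete (shift_mat t (A x)) j i)) \<in> borel_measurable M"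
  proof (rule det_measurable[OF del])
    fix k l assume "k < m - 1" "l < m - 1"
    thus "(\<lambda>x. mat_delete (shift_mat t (A x)) j i $$ (k, l)) \<in> borel_measurable M"
      using Sm by (simp add: mat_delete_def dS)
  qed
  moreover have "(\<lambda>x. det (shift_mat t (A x))) \<in> borel_measurable M" by (rule det_measurable[OF S Sm])
  moreover have "resolvent t (A x) $$ (i, j)
      = 1 / det (shift_mat t (A x)) * ((-1) ^ (j + i) * det (mat_delete (shift_mat t (A x)) j i))" for x
    using ij dS[of x] by (simp add: resolvent_def adj_mat_def cofactor_def)
  ultimately show ?thesis by simp
qed

lemma mtrace_resolvent_measurable:
  assumes A: "\<And>x. A x \<in> carrier_mat m m"
    and meas: "\<And>i j. i < m \<Longrightarrow> j < m \<Longrightarrow> (\<lambda>x. A x $$ (i, j)) \<in> borel_measurable M"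
  shows "(\<lambda>x. mtrace (resolvent t (A x))) \<in> borel_measurable M"
proof -
  have "dim_row (resolvent t (A x)) = m" for x using resolvent_carrier[OF A] by auto
  thus ?thesis unfolding mtrace_def using resolvent_measurable[OF A meas] by (auto intro!: borel_measurable_sum)
qed

section \<open>The Gram matrix of normalised rows\<close>

definition row_mean :: "nat \<Rightarrow> (nat \<Rightarrow> real) \<Rightarrow> real" where
  "row_mean p r = (\<Sum>j<p. r j) / real p"

text \<open>A row of mean 0 becomes the zero row, since x / 0 = 0. The trace bounds therefore hold
  at every point and not only almost everywhere, as bounded differences on the whole product space
  demand.\<close>

definition scaled_row :: "real \<Rightarrow> real \<Rightarrow> nat \<Rightarrow> (nat \<Rightarrow> real) \<Rightarrow> nat \<Rightarrow> real" where
  "scaled_row \<mu> N p r j = (r j - \<mu>) / (row_mean p r * sqrt N)"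

definition row_gram :: "real \<Rightarrow> real \<Rightarrow> nat \<Rightarrow> (nat \<Rightarrow> nat \<Rightarrow> real) \<Rightarrow> nat set \<Rightarrow> real mat" where
  "row_gram \<mu> N p x I = gram p (\<lambda>i. scaled_row \<mu> N p (x i)) I"

lemma row_gram_carrier [simp]: "row_gram \<mu> N p x I \<in> carrier_mat p p"
  by (simp add: row_gram_def)

lemma psd_row_gram: "finite I \<Longrightarrow> psd p (row_gram \<mu> N p x I)"
  by (simp add: row_gram_def psd_gram)

lemma scaled_row_cong:
  assumes "\<And>j. j < p \<Longrightarrow> r j = r' j" "j < p"
  shows "scaled_row \<mu> N p r j = scaled_row \<mu> N p r' j"
  using assms by (simp add: scaled_row_def row_mean_def)

lemma row_gram_cong:
  assumes "\<And>i j. i \<in> I \<Longrightarrow> j < p \<Longrightarrow> x i j = y i j"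
  shows "row_gram \<mu> N p x I = row_gram \<mu> N p y I"
  unfolding row_gram_def using assms by (intro gram_cong scaled_row_cong) auto

lemma row_gram_measurable:
  assumes "\<And>i j. i \<in> I \<Longrightarrow> j < p \<Longrightarrow> (\<lambda>x. y x i j) \<in> borel_measurable M" "k < p" "l < p"
  shows "(\<lambda>x. row_gram \<mu> N p (y x) I $$ (k, l)) \<in> borel_measurable M"
  using assms unfolding row_gram_def gram_def scaled_row_def row_mean_def
  by (auto intro!: borel_measurable_sum borel_measurable_times borel_measurable_divide borel_measurable_diff)

lemma mtrace_row_gram_remove:
  assumes "finite I" "0 < t"
  shows "mtrace (resolvent t (row_gram \<mu> N p x I)) \<le> mtrace (resolvent t (row_gram \<mu> N p x (I - {k})))" (is "?L1 \<le> ?R1")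
    and "mtrace (resolvent t (row_gram \<mu> N p x (I - {k}))) \<le> mtrace (resolvent t (row_gram \<mu> N p x I)) + 1 / t" (is "?L2 \<le> ?R2")
proof -
  have "?L1 \<le> ?R1 \<and> ?L2 \<le> ?R2"
  proof (cases "k \<in> I")
    case True
    show ?thesis unfolding row_gram_def gram_remove[OF assms(1) True]
      using assms by (intro conjI mtrace_resolvent_add_outer[of p] psd_gram) auto
  qed (use assms in auto)
  thus "?L1 \<le> ?R1" "?L2 \<le> ?R2" by auto
qed

context prob_space
begin

lemma indep_var_nn_integral_le:
  assumes ind: "indep_var S U T V" and F: "F \<in> borel_measurable (S \<Otimes>\<^sub>M T)"
    and le: "\<And>h. h \<in> space T \<Longrightarrow> (\<integral>\<^sup>+\<omega>. F (U \<omega>, h) \<partial>M) \<le> C"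
  shows "(\<integral>\<^sup>+\<omega>. F (U \<omega>, V \<omega>) \<partial>M) \<le> C"
proof -
  have U: "U \<in> measurable M S" and V: "V \<in> measurable M T"
    and eq: "distr M S U \<Otimes>\<^sub>M distr M T V = distr M (S \<Otimes>\<^sub>M T) (\<lambda>x. (U x, V x))"
    using ind by (auto simp: indep_var_distribution_eq)
  interpret DU: prob_space "distr M S U" by (rule prob_space_distr[OF U])
  interpret DV: prob_space "distr M T V" by (rule prob_space_distr[OF V])
  interpret pair_sigma_finite "distr M S U" "distr M T V" ..
  have Fm: "F \<in> borel_measurable (distr M S U \<Otimes>\<^sub>M distr M T V)"
    using F by (simp cong: measurable_cong_sets)
  have "(\<integral>\<^sup>+\<omega>. F (U \<omega>, V \<omega>) \<partial>M) = (\<integral>\<^sup>+z. F z \<partial>(distr M S U \<Otimes>\<^sub>M distr M T V))"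
    unfolding eq using U V F by (subst nn_integral_distr) auto
  also have "\<dots> = (\<integral>\<^sup>+h. \<integral>\<^sup>+r. F (r, h) \<partial>distr M S U \<partial>distr M T V)"
    by (rule nn_integral_snd[OF Fm, symmetric])
  also have "\<dots> \<le> (\<integral>\<^sup>+h. C \<partial>distr M T V)"
  proof (rule nn_integral_mono)
    fix h assume "h \<in> space (distr M T V)"
    hence h: "h \<in> space T" by simp
    have "(\<integral>\<^sup>+r. F (r, h) \<partial>distr M S U) = (\<integral>\<^sup>+\<omega>. F (U \<omega>, h) \<partial>M)"
      by (rule nn_integral_distr[OF U]) (use measurable_compose[OF measurable_Pair2'[OF h] F] in simp)
    thus "(\<integral>\<^sup>+r. F (r, h) \<partial>distr M S U) \<le> C" using le[OF h] by simp
  qed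
  also have "\<dots> = C" using DV.emeasure_space_1 by simp
  finally show ?thesis .
qed

text \<open>The bound on E|Z| is the nonnegativity of the variance of |Z|.\<close>

lemma second_moment_imp_abs:
  fixes Z :: "'a \<Rightarrow> real"
  assumes [measurable]: "Z \<in> borel_measurable M" and C: "0 \<le> C" "(\<integral>\<^sup>+\<omega>. (Z \<omega>)\<^sup>2 \<partial>M) \<le> ennreal C"
  shows "integrable M (\<lambda>\<omega>. (Z \<omega>)\<^sup>2)" "integrable M Z" "expectation (\<lambda>\<omega>. (Z \<omega>)\<^sup>2) \<le> C" "expectation (\<lambda>\<omega>. \<bar>Z \<omega>\<bar>) \<le> sqrt C"
proof -
  show 1: "integrable M (\<lambda>\<omega>. (Z \<omega>)\<^sup>2)"
    by (rule integrableI_bounded) (use C in \<open>auto intro: le_less_trans\<close>)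
  show Z: "integrable M Z" by (rule square_integrable_imp_integrable[OF _ 1]) simp
  show 2: "expectation (\<lambda>\<omega>. (Z \<omega>)\<^sup>2) \<le> C"
    using C nn_integral_eq_integral[OF 1] by simp
  have "0 \<le> expectation (\<lambda>\<omega>. (\<bar>Z \<omega>\<bar> - expectation (\<lambda>\<omega>. \<bar>Z \<omega>\<bar>))\<^sup>2)" by (rule integral_nonneg_AE) auto
  also have "\<dots> = expectation (\<lambda>\<omega>. (Z \<omega>)\<^sup>2) - (expectation (\<lambda>\<omega>. \<bar>Z \<omega>\<bar>))\<^sup>2"
    using Z 1 by (subst variance_eq) auto
  finally show "expectation (\<lambda>\<omega>. \<bar>Z \<omega>\<bar>) \<le> sqrt C" using 2 by (intro real_le_rsqrt) simp
qed

end

text \<open>The difference is a combination of q0 - q and a - a0 with weights a / (a + q) and q / (a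
  + q), both at most 1, over a0 + q0. The variable a, later a squared row mean, never remains alone
  in a denominator.\<close>

lemma ratio_difference_bound:
  fixes a q a\<^sub>0 q\<^sub>0 :: real
  assumes "0 < a" "0 \<le> q" "0 < a\<^sub>0" "0 \<le> q\<^sub>0"
  shows "\<bar>a / (a + q) - a\<^sub>0 / (a\<^sub>0 + q\<^sub>0)\<bar> \<le> (\<bar>q - q\<^sub>0\<bar> + \<bar>a - a\<^sub>0\<bar>) / a\<^sub>0"
proof -
  have p: "0 < a + q" "0 < a\<^sub>0 + q\<^sub>0" using assms by auto
  have "a / (a + q) - a\<^sub>0 / (a\<^sub>0 + q\<^sub>0) = (a / (a + q) * (q\<^sub>0 - q) + q / (a + q) * (a - a\<^sub>0)) / (a\<^sub>0 + q\<^sub>0)"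
    using p by (simp add: divide_simps) (simp add: algebra_simps)
  also have "\<bar>\<dots>\<bar> \<le> (\<bar>q - q\<^sub>0\<bar> + \<bar>a - a\<^sub>0\<bar>) / (a\<^sub>0 + q\<^sub>0)"
  proof -
    have "\<bar>a / (a + q) * (q\<^sub>0 - q)\<bar> \<le> 1 * \<bar>q - q\<^sub>0\<bar>"
      unfolding abs_mult using assms p by (intro mult_mono) (auto simp: field_simps)
    moreover have "\<bar>q / (a + q) * (a - a\<^sub>0)\<bar> \<le> 1 * \<bar>a - a\<^sub>0\<bar>"
      unfolding abs_mult using assms p by (intro mult_mono) (auto simp: field_simps)
    ultimately show ?thesis
      unfolding abs_divide using p by (intro frac_le) (auto intro: order_trans[OF abs_triangle_ineq])
  qed
  also have "\<dots> \<le> (\<bar>q - q\<^sub>0\<bar> + \<bar>a - a\<^sub>0\<bar>) / a\<^sub>0"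
    using assms by (intro divide_left_mono) auto
  finally show ?thesis .
qed

text \<open>The moment data from which the trace estimates are derived, with indices from 0 as in
  the matrices; \<kappa> is the fourth central moment.\<close>

locale iid_array = prob_space M for M :: "'a measure" +
  fixes X :: "nat \<Rightarrow> nat \<Rightarrow> 'a \<Rightarrow> real" and \<mu> \<sigma> \<kappa> :: real
  assumes indep: "indep_vars (\<lambda>_. borel) (\<lambda>(i, j). X i j) UNIV"
    and pos: "\<And>i j. AE \<omega> in M. 0 < X i j \<omega>"
    and int4: "\<And>i j. integrable M (\<lambda>\<omega>. (X i j \<omega> - \<mu>) ^ 4)"
    and mean: "\<And>i j. expectation (\<lambda>\<omega>. X i j \<omega> - \<mu>) = 0"
    and var: "\<And>i j. expectation (\<lambda>\<omega>. (X i j \<omega> - \<mu>)\<^sup>2) = \<sigma>\<^sup>2"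
    and fourth: "\<And>i j. expectation (\<lambda>\<omega>. (X i j \<omega> - \<mu>) ^ 4) = \<kappa>"
    and mu_pos: "0 < \<mu>"
begin

lemma X_measurable [measurable]: "X i j \<in> borel_measurable M"
  using indep by (auto simp: indep_vars_def)

lemma kappa_nonneg: "0 \<le> \<kappa>"
  unfolding fourth[of 0 0, symmetric] by (rule integral_nonneg_AE) auto

text \<open>Rows occupy disjoint blocks of indices. They are made single random elements because the
  bounded differences argument replaces a whole row at a time.\<close>

lemma indep_rows:
  "indep_vars (\<lambda>_. PiM {..<p} (\<lambda>_. borel)) (\<lambda>i \<omega>. \<lambda>j\<in>{..<p}. X i j \<omega>) I"
proof -
  have "indep_vars (\<lambda>i. PiM ({i} \<times> {..<p}) (\<lambda>_. borel))
      (\<lambda>i \<omega>. restrict (\<lambda>a. (case a of (i, j) \<Rightarrow> X i j) \<omega>) ({i} \<times> {..<p})) I"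
    by (rule indep_vars_restrict[OF indep]) (auto simp: disjoint_family_on_def)
  hence "indep_vars (\<lambda>_. PiM {..<p} (\<lambda>_. borel))
      (\<lambda>i \<omega>. (\<lambda>r. \<lambda>j\<in>{..<p}. r (i, j)) (restrict (\<lambda>a. (case a of (i, j) \<Rightarrow> X i j) \<omega>) ({i} \<times> {..<p}))) I"
    by (rule indep_vars_compose2[where Y = "\<lambda>i r. \<lambda>j\<in>{..<p}. r (i, j)"])
      (auto intro!: measurable_restrict measurable_component_singleton)
  also have "(\<lambda>i \<omega>. (\<lambda>r. \<lambda>j\<in>{..<p}. r (i, j)) (restrict (\<lambda>a. (case a of (i, j) \<Rightarrow> X i j) \<omega>) ({i} \<times> {..<p})))
      = (\<lambda>i \<omega>. \<lambda>j\<in>{..<p}. X i j \<omega>)"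
    by (auto simp: fun_eq_iff)
  finally show ?thesis .
qed

lemma indep_row_entries: "indep_vars (\<lambda>_. borel) (\<lambda>j \<omega>. X k j \<omega> - \<mu>) {..<p}"
proof -
  have "indep_vars (\<lambda>j. PiM {(k, j)} (\<lambda>_. borel))
      (\<lambda>j \<omega>. restrict (\<lambda>a. (case a of (i, j) \<Rightarrow> X i j) \<omega>) {(k, j)}) {..<p}"
    by (rule indep_vars_restrict[OF indep]) (auto simp: disjoint_family_on_def)
  hence "indep_vars (\<lambda>_. borel)
      (\<lambda>j \<omega>. (\<lambda>r. r (k, j)) (restrict (\<lambda>a. (case a of (i, j) \<Rightarrow> X i j) \<omega>) {(k, j)})) {..<p}"
    by (rule indep_vars_compose2[where Y = "\<lambda>j r. r (k, j)"]) (auto intro: measurable_component_singleton)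
  hence "indep_vars (\<lambda>_. borel) (\<lambda>j. X k j) {..<p}" by simp
  thus ?thesis by (rule indep_vars_compose2[where Y = "\<lambda>_ x. x - \<mu>"]) auto
qed

lemma xi_square_integrable: "integrable M (\<lambda>\<omega>. (X i j \<omega> - \<mu>)\<^sup>2)"
  by (rule fourth_moment_imp_square_integrable[OF _ int4]) simp

lemma xi_integrable: "integrable M (\<lambda>\<omega>. X i j \<omega> - \<mu>)"
  by (rule square_integrable_imp_integrable[OF _ xi_square_integrable]) simp

lemma xi_products:
  assumes "i < p" "j < p"
  shows "integrable M (\<lambda>\<omega>. (X k i \<omega> - \<mu>) * (X k j \<omega> - \<mu>))"
    and "expectation (\<lambda>\<omega>. (X k i \<omega> - \<mu>) * (X k j \<omega> - \<mu>)) = (if i = j then \<sigma>\<^sup>2 else 0)"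
proof -
  have "integrable M (\<lambda>\<omega>. (X k i \<omega> - \<mu>) * (X k j \<omega> - \<mu>))
    \<and> expectation (\<lambda>\<omega>. (X k i \<omega> - \<mu>) * (X k j \<omega> - \<mu>)) = (if i = j then \<sigma>\<^sup>2 else 0)"
  proof (cases "i = j")
    case True
    thus ?thesis using xi_square_integrable var by (simp add: power2_eq_square)
  next
    case False
    have ind: "indep_vars (\<lambda>_. borel) (\<lambda>j \<omega>. X k j \<omega> - \<mu>) {i, j}"
      by (rule indep_vars_subset[OF indep_row_entries[of k p]]) (use assms in auto)
    show ?thesis
      using indep_vars_lebesgue_integral[OF _ ind] indep_vars_integrable[OF _ ind] False
      by (simp add: xi_integrable mean)
  qed
  thus "integrable M (\<lambda>\<omega>. (X k i \<omega> - \<mu>) * (X k j \<omega> - \<mu>))"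
    and "expectation (\<lambda>\<omega>. (X k i \<omega> - \<mu>) * (X k j \<omega> - \<mu>)) = (if i = j then \<sigma>\<^sup>2 else 0)" by auto
qed

section \<open>Fluctuation of the row means\<close>

definition mean_row :: "nat \<Rightarrow> nat \<Rightarrow> 'a \<Rightarrow> real" where
  "mean_row p k \<omega> = row_mean p (\<lambda>j. X k j \<omega>)"

lemma mean_row_measurable [measurable]: "mean_row p k \<in> borel_measurable M"
  unfolding mean_row_def[abs_def] row_mean_def by measurable

lemma mean_row_second_moment:
  assumes "0 < p"
  shows "(\<integral>\<^sup>+\<omega>. (mean_row p k \<omega> - \<mu>)\<^sup>2 \<partial>M) = ennreal (\<sigma>\<^sup>2 / p)"
proof -
  have "(mean_row p k \<omega> - \<mu>)\<^sup>2 = (\<Sum>i<p. \<Sum>j<p. (X k i \<omega> - \<mu>) * (X k j \<omega> - \<mu>)) / (real p)\<^sup>2" for \<omega>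
  proof -
    have "mean_row p k \<omega> - \<mu> = (\<Sum>j<p. X k j \<omega> - \<mu>) / real p"
      using assms by (simp add: mean_row_def row_mean_def sum_subtractf field_simps)
    thus ?thesis by (simp add: power_divide power2_eq_square sum_product)
  qed
  note eq = this
  have int: "integrable M (\<lambda>\<omega>. (mean_row p k \<omega> - \<mu>)\<^sup>2)"
    unfolding eq by (intro integrable_divide Bochner_Integration.integrable_sum xi_products) auto
  have "expectation (\<lambda>\<omega>. (mean_row p k \<omega> - \<mu>)\<^sup>2) = (\<Sum>i<p. \<Sum>j<p. if i = j then \<sigma>\<^sup>2 else 0) / (real p)\<^sup>2"
  proof -
    have "expectation (\<lambda>\<omega>. \<Sum>i<p. \<Sum>j<p. (X k i \<omega> - \<mu>) * (X k j \<omega> - \<mu>))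
        = (\<Sum>i<p. expectation (\<lambda>\<omega>. \<Sum>j<p. (X k i \<omega> - \<mu>) * (X k j \<omega> - \<mu>)))"
      by (rule Bochner_Integration.integral_sum) (intro Bochner_Integration.integrable_sum xi_products(1)[of _ p], auto)
    also have "\<dots> = (\<Sum>i<p. \<Sum>j<p. expectation (\<lambda>\<omega>. (X k i \<omega> - \<mu>) * (X k j \<omega> - \<mu>)))"
      by (intro sum.cong refl Bochner_Integration.integral_sum xi_products(1)[of _ p]) auto
    also have "\<dots> = (\<Sum>i<p. \<Sum>j<p. if i = j then \<sigma>\<^sup>2 else 0)"
      by (intro sum.cong refl xi_products(2)[of _ p]) auto
    finally show ?thesis unfolding eq by (subst integral_divide_zero) simp
  qed
  also have "\<dots> = \<sigma>\<^sup>2 / p" using assms by (simp add: power2_eq_square)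
  finally show ?thesis using int by (subst nn_integral_eq_integral) auto
qed

text \<open>Expand m^2 - \<mu>^2 = (m - \<mu>)^2 + 2 \<mu> (m - \<mu>): the variance \<sigma>^2 / p
  bounds the first term directly and the second through the mean absolute deviation.\<close>

lemma mean_row_square_close:
  assumes "0 < p"
  shows "integrable M (\<lambda>\<omega>. \<bar>(mean_row p k \<omega>)\<^sup>2 - \<mu>\<^sup>2\<bar>)"
    and "expectation (\<lambda>\<omega>. \<bar>(mean_row p k \<omega>)\<^sup>2 - \<mu>\<^sup>2\<bar>) \<le> \<sigma>\<^sup>2 / p + 2 * \<mu> * sqrt (\<sigma>\<^sup>2 / p)"
proof -
  have "(\<lambda>\<omega>. mean_row p k \<omega> - \<mu>) \<in> borel_measurable M" by measurable
  note m = second_moment_imp_abs[OF this, of "\<sigma>\<^sup>2 / p"] mean_row_second_moment[OF assms, of k]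
  have int: "integrable M (\<lambda>\<omega>. (mean_row p k \<omega> - \<mu>)\<^sup>2 + 2 * \<mu> * \<bar>mean_row p k \<omega> - \<mu>\<bar>)"
    using m by (intro Bochner_Integration.integrable_add integrable_mult_right integrable_abs) auto
  have le: "\<bar>(mean_row p k \<omega>)\<^sup>2 - \<mu>\<^sup>2\<bar> \<le> (mean_row p k \<omega> - \<mu>)\<^sup>2 + 2 * \<mu> * \<bar>mean_row p k \<omega> - \<mu>\<bar>" for \<omega>
  proof -
    have "(mean_row p k \<omega>)\<^sup>2 - \<mu>\<^sup>2 = (mean_row p k \<omega> - \<mu>)\<^sup>2 + 2 * \<mu> * (mean_row p k \<omega> - \<mu>)"
      by (simp add: power2_eq_square algebra_simps)
    also have "\<bar>\<dots>\<bar> \<le> \<bar>(mean_row p k \<omega> - \<mu>)\<^sup>2\<bar> + \<bar>2 * \<mu> * (mean_row p k \<omega> - \<mu>)\<bar>" by (rule abs_triangle_ineq)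
    finally show ?thesis using mu_pos by (simp add: abs_mult)
  qed
  show 1: "integrable M (\<lambda>\<omega>. \<bar>(mean_row p k \<omega>)\<^sup>2 - \<mu>\<^sup>2\<bar>)"
    by (rule Bochner_Integration.integrable_bound[OF int]) (use le in \<open>auto intro!: AE_I2 intro: order_trans[OF _ abs_ge_self]\<close>)
  have "expectation (\<lambda>\<omega>. \<bar>(mean_row p k \<omega>)\<^sup>2 - \<mu>\<^sup>2\<bar>) \<le> expectation (\<lambda>\<omega>. (mean_row p k \<omega> - \<mu>)\<^sup>2 + 2 * \<mu> * \<bar>mean_row p k \<omega> - \<mu>\<bar>)"
    by (rule integral_mono[OF 1 int le])
  also have "\<dots> = expectation (\<lambda>\<omega>. (mean_row p k \<omega> - \<mu>)\<^sup>2) + 2 * \<mu> * expectation (\<lambda>\<omega>. \<bar>mean_row p k \<omega> - \<mu>\<bar>)"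
    using m by (subst Bochner_Integration.integral_add) auto
  also have "\<dots> \<le> \<sigma>\<^sup>2 / p + 2 * \<mu> * sqrt (\<sigma>\<^sup>2 / p)"
    using m mu_pos by (intro add_mono mult_left_mono) auto
  finally show "expectation (\<lambda>\<omega>. \<bar>(mean_row p k \<omega>)\<^sup>2 - \<mu>\<^sup>2\<bar>) \<le> \<sigma>\<^sup>2 / p + 2 * \<mu> * sqrt (\<sigma>\<^sup>2 / p)" .
qed

lemma mean_row_pos:
  assumes "0 < p" shows "AE \<omega> in M. 0 < mean_row p k \<omega>"
proof -
  have "AE \<omega> in M. \<forall>j\<in>{..<p}. 0 < X k j \<omega>" by (rule AE_finite_allI) (auto intro: pos)
  thus ?thesis
  proof eventually_elim
    case (elim \<omega>)
    hence "0 < (\<Sum>j<p. X k j \<omega>)" using assms by (intro sum_pos) auto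
    thus ?case using assms by (simp add: mean_row_def row_mean_def)
  qed
qed

section \<open>Trace estimates for fixed dimensions and fixed t\<close>

context
  fixes n p :: nat and N t :: real
  assumes n: "0 < n" and p: "0 < p" and N: "0 < N" and t: "0 < t"
begin

definition G :: "nat set \<Rightarrow> 'a \<Rightarrow> real mat" where
  "G I \<omega> = resolvent t (row_gram \<mu> N p (\<lambda>i j. X i j \<omega>) I)"

definition T :: "'a \<Rightarrow> real" where
  "T \<omega> = mtrace (G {..<n} \<omega>)"

lemma G_measurable: "i < p \<Longrightarrow> j < p \<Longrightarrow> (\<lambda>\<omega>. G I \<omega> $$ (i, j)) \<in> borel_measurable M"
  unfolding G_def by (rule resolvent_measurable[of _ p]) (auto intro: row_gram_measurable)

lemma mtrace_G_measurable [measurable]: "(\<lambda>\<omega>. mtrace (G I \<omega>)) \<in> borel_measurable M"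
  unfolding G_def by (rule mtrace_resolvent_measurable[of _ p]) (auto intro: row_gram_measurable)

lemma T_measurable [measurable]: "T \<in> borel_measurable M"
  unfolding T_def[abs_def] by measurable

lemma T_bounds: "0 \<le> T \<omega>" "T \<omega> \<le> p / t"
  unfolding T_def G_def using mtrace_resolvent_bounds[OF psd_row_gram t] by auto

lemma T_integrable [simp]: "integrable M T"
  by (rule integrable_const_bound[where B = "p / t"]) (use T_bounds in auto)

lemma T_concentration:
  "0 < e \<Longrightarrow> prob {\<omega> \<in> space M. e \<le> \<bar>T \<omega> - expectation T\<bar>} \<le> 2 * exp (- e\<^sup>2 / (2 * n * (1 / t)\<^sup>2))"
  "expectation (\<lambda>\<omega>. \<bar>T \<omega> - expectation T\<bar>) \<le> 2 * exp (1 / 2) * (1 / t * sqrt n)"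
proof -
  define N' where "N' = (\<lambda>_ :: nat. PiM {..<p} (\<lambda>_. borel :: real measure))"
  define R where "R = (\<lambda>i \<omega>. \<lambda>j\<in>{..<p}. X i j \<omega>)"
  define f where "f = (\<lambda>x. mtrace (resolvent t (row_gram \<mu> N p x {..<n})))"
  have rv: "R i \<in> measurable M (N' i)" for i
    unfolding R_def N'_def by (rule measurable_restrict) simp
  have ind: "indep_vars N' R {..<n}" unfolding N'_def R_def by (rule indep_rows)
  have f: "f \<in> borel_measurable (PiM {..<n} N')"
    unfolding f_def
  proof (rule mtrace_resolvent_measurable[of _ p], simp, rule row_gram_measurable)
    fix i j assume "i \<in> {..<n}" "j < p"
    hence "(\<lambda>x. x i) \<in> measurable (PiM {..<n} N') (N' i)" "(\<lambda>r. r j) \<in> borel_measurable (N' i)"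
      unfolding N'_def by (auto intro: measurable_component_singleton)
    thus "(\<lambda>x. x i j) \<in> borel_measurable (PiM {..<n} N')" by (rule measurable_compose)
  qed
  have bnd: "\<bar>f x\<bar> \<le> p / t" for x
    unfolding f_def using mtrace_resolvent_bounds[OF psd_row_gram t, of "{..<n}"] by (simp add: abs_le_iff)
  have diff: "\<bar>f (x(i := y)) - f x\<bar> \<le> 1 / t" for i x y
  proof -
    \<comment> \<open>Both traces are compared with the one without row i, where the update is
      invisible. Each falls below it by at most 1/t, so they differ by at most 1/t and not merely
      2/t.\<close>
    have eq: "row_gram \<mu> N p (x(i := y)) ({..<n} - {i}) = row_gram \<mu> N p x ({..<n} - {i})"
      by (rule row_gram_cong) auto
    show ?thesis
      using mtrace_row_gram_remove[OF finite_lessThan t, of \<mu> N p x n i]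
        mtrace_row_gram_remove[OF finite_lessThan t, of \<mu> N p "x(i := y)" n i, unfolded eq]
      unfolding f_def by linarith
  qed
  have Tf: "T = (\<lambda>\<omega>. f (\<lambda>i\<in>{..<n}. R i \<omega>))"
    unfolding T_def[abs_def] G_def f_def R_def
    by (rule ext, intro arg_cong[where f = mtrace] arg_cong[where f = "resolvent t"] row_gram_cong) auto
  have ne: "{..<n} \<noteq> {}" "finite {..<n}" "0 < 1 / t" using n t by auto
  show "prob {\<omega> \<in> space M. e \<le> \<bar>T \<omega> - expectation T\<bar>} \<le> 2 * exp (- e\<^sup>2 / (2 * n * (1 / t)\<^sup>2))" if "0 < e"
  proof -
    have "prob {\<omega> \<in> space M. e \<le> \<bar>T \<omega> - expectation T\<bar>} \<le> 2 * exp (- e\<^sup>2 / (2 * card {..<n} * (1 / t)\<^sup>2))"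
      unfolding Tf by (rule bounded_differences_concentration(1)[OF rv ind ne(2,1,3) f]) (use bnd diff that in auto)
    thus ?thesis by simp
  qed
  show "expectation (\<lambda>\<omega>. \<bar>T \<omega> - expectation T\<bar>) \<le> 2 * exp (1 / 2) * (1 / t * sqrt n)"
  proof -
    have "expectation (\<lambda>\<omega>. \<bar>T \<omega> - expectation T\<bar>) \<le> 2 * exp (1 / 2) * (1 / t * sqrt (card {..<n}))"
      unfolding Tf by (rule bounded_differences_concentration(2)[OF rv ind ne(2,1,3) f]) (use bnd diff in auto)
    thus ?thesis by simp
  qed
qed

text \<open>Row k enters through its centred but unnormalised entries, which are independent of each
  other; the factor 1 / (N m_k^2) is restored in \<open>trace_identity\<close>.\<close>

definition Q :: "nat \<Rightarrow> 'a \<Rightarrow> real" where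
  "Q k \<omega> = (\<Sum>i<p. \<Sum>j<p. G ({..<n} - {k}) \<omega> $$ (i, j) * (X k i \<omega> - \<mu>) * (X k j \<omega> - \<mu>))"

lemma Q_measurable [measurable]: "Q k \<in> borel_measurable M"
  unfolding Q_def[abs_def] using G_measurable by (intro borel_measurable_sum borel_measurable_times) auto

text \<open>The resolvent without row k is a function of the other rows only. It can be frozen by
  independence, after which the variance bound for a constant matrix applies with its Frobenius
  norm.\<close>

lemma Q_variance:
  "(\<integral>\<^sup>+\<omega>. (Q k \<omega> - \<sigma>\<^sup>2 * mtrace (G ({..<n} - {k}) \<omega>))\<^sup>2 \<partial>M) \<le> ennreal (2 * \<kappa> * (p / t\<^sup>2))"
proof -
  define A where "A = {k} \<times> {..<p}"
  define B where "B = ({..<n} - {k}) \<times> {..<p}"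
  define Y where "Y = (\<lambda>a \<omega>. (case a of (i, j) \<Rightarrow> X i j) \<omega>)"
  define H where "H = (\<lambda>h. resolvent t (row_gram \<mu> N p (\<lambda>i j. h (i, j)) ({..<n} - {k})))"
  define F where "F = (\<lambda>(r, h). ((\<Sum>i<p. \<Sum>j<p. H h $$ (i, j) * (r (k, i) - \<mu>) * (r (k, j) - \<mu>)) - \<sigma>\<^sup>2 * (\<Sum>i<p. H h $$ (i, i)))\<^sup>2)"
  have ind: "indep_var (PiM A (\<lambda>_. borel)) (\<lambda>\<omega>. restrict (\<lambda>a. Y a \<omega>) A) (PiM B (\<lambda>_. borel)) (\<lambda>\<omega>. restrict (\<lambda>a. Y a \<omega>) B)"
    unfolding Y_def by (rule indep_var_restrict[OF indep]) (auto simp: A_def B_def)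
  have Hm: "(\<lambda>h. H h $$ (i, j)) \<in> borel_measurable (PiM B (\<lambda>_. borel))" if "i < p" "j < p" for i j
    unfolding H_def using that
    by (intro resolvent_measurable[of _ p] row_gram_measurable measurable_component_singleton) (auto simp: B_def)
  have mean_row: "(\<lambda>r. r (k, i)) \<in> borel_measurable (PiM A (\<lambda>_. borel :: real measure))" if "i < p" for i
    using that by (intro measurable_component_singleton) (auto simp: A_def)
  have Fm: "F \<in> borel_measurable (PiM A (\<lambda>_. borel) \<Otimes>\<^sub>M PiM B (\<lambda>_. borel))"
    unfolding F_def case_prod_beta
    by (intro borel_measurable_power borel_measurable_diff borel_measurable_sum borel_measurable_times borel_measurable_const
        measurable_compose[OF measurable_snd Hm] measurable_compose[OF measurable_fst mean_row]) auto
  have Gr: "dim_row (H h) = p" for h unfolding H_def using resolvent_carrier[OF row_gram_carrier] by (metis carrier_matD(1))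
  have HG: "H (restrict (\<lambda>a. Y a \<omega>) B) = G ({..<n} - {k}) \<omega>" for \<omega>
    unfolding H_def G_def by (intro arg_cong[where f = "resolvent t"] row_gram_cong) (auto simp: B_def Y_def)
  have FQ: "F (restrict (\<lambda>a. Y a \<omega>) A, restrict (\<lambda>a. Y a \<omega>) B) = (Q k \<omega> - \<sigma>\<^sup>2 * mtrace (G ({..<n} - {k}) \<omega>))\<^sup>2" for \<omega>
    using Gr unfolding F_def Q_def HG[symmetric] mtrace_def by (simp add: A_def Y_def)
  have "(\<integral>\<^sup>+\<omega>. ennreal (F (restrict (\<lambda>a. Y a \<omega>) A, restrict (\<lambda>a. Y a \<omega>) B)) \<partial>M) \<le> ennreal (2 * \<kappa> * (p / t\<^sup>2))"
  proof (rule indep_var_nn_integral_le[OF ind, of "\<lambda>z. ennreal (F z)"])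
    show "(\<lambda>z. ennreal (F z)) \<in> borel_measurable (PiM A (\<lambda>_. borel) \<Otimes>\<^sub>M PiM B (\<lambda>_. borel))"
      using Fm by measurable
    fix h
    have "(\<integral>\<^sup>+\<omega>. ennreal (F (restrict (\<lambda>a. Y a \<omega>) A, h)) \<partial>M)
       = (\<integral>\<^sup>+\<omega>. ((\<Sum>i<p. \<Sum>j<p. H h $$ (i, j) * (X k i \<omega> - \<mu>) * (X k j \<omega> - \<mu>)) - \<sigma>\<^sup>2 * (\<Sum>i<p. H h $$ (i, i)))\<^sup>2 \<partial>M)"
      by (simp add: F_def A_def Y_def)
    also have "\<dots> \<le> ennreal (2 * \<kappa> * (\<Sum>i<p. \<Sum>j<p. (H h $$ (i, j))\<^sup>2))"
      by (rule quadratic_form_variance[OF indep_row_entries int4 mean var fourth])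
    also have "\<dots> \<le> ennreal (2 * \<kappa> * (p / t\<^sup>2))"
      unfolding H_def using kappa_nonneg t
      by (intro ennreal_leI mult_left_mono resolvent_entries_square_sum psd_row_gram) auto
    finally show "(\<integral>\<^sup>+\<omega>. ennreal (F (restrict (\<lambda>a. Y a \<omega>) A, h)) \<partial>M) \<le> ennreal (2 * \<kappa> * (p / t\<^sup>2))" .
  qed
  thus ?thesis unfolding FQ .
qed

text \<open>Row k is the scalar \<rho> = 1 / (m_k sqrt N) times the centred row, so its form is
  \<rho>^2 Q_k. The identity holds at every point: for m_k = 0 both expressions are 0 by
  convention.\<close>

lemma Q_nonneg: "0 \<le> Q k \<omega>"
  and trace_identity:
    "real p - t * T \<omega> = (\<Sum>k<n. 1 - 1 / (1 + Q k \<omega> / N / (mean_row p k \<omega>)\<^sup>2))"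
proof -
  define v where "v = (\<lambda>k. vec p (\<lambda>j. X k j \<omega> - \<mu>))"
  have v: "v k \<in> carrier_vec p" for k by (simp add: v_def)
  have GM: "G I \<omega> \<in> carrier_mat p p" for I by (simp add: G_def)
  have Qv: "Q k \<omega> = v k \<bullet> (G ({..<n} - {k}) \<omega> *\<^sub>v v k)" for k
    using GM[of "{..<n} - {k}"]
    by (simp add: Q_def v_def scalar_prod_def atLeast0LessThan sum_distrib_left mult_ac)
  show "0 \<le> Q k \<omega>"
    unfolding Qv G_def by (rule quad_resolvent_nonneg[OF psd_row_gram t v]) simp
  have "real p - t * T \<omega> = (\<Sum>k<n. 1 - 1 / (1 + vec p (scaled_row \<mu> N p (\<lambda>j. X k j \<omega>)) \<bullet>
      (G ({..<n} - {k}) \<omega> *\<^sub>v vec p (scaled_row \<mu> N p (\<lambda>j. X k j \<omega>)))))"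
    unfolding T_def G_def row_gram_def by (rule gram_trace_identity) (use t in auto)
  also have "\<dots> = (\<Sum>k<n. 1 - 1 / (1 + Q k \<omega> / N / (mean_row p k \<omega>)\<^sup>2))"
  proof (intro sum.cong refl arg_cong[where f = "\<lambda>x. 1 - 1 / (1 + x)"])
    fix k
    define \<rho> where "\<rho> = 1 / (mean_row p k \<omega> * sqrt N)"
    have "vec p (scaled_row \<mu> N p (\<lambda>j. X k j \<omega>)) = \<rho> \<cdot>\<^sub>v v k"
      by (rule eq_vecI) (auto simp: scaled_row_def v_def \<rho>_def mean_row_def)
    hence "vec p (scaled_row \<mu> N p (\<lambda>j. X k j \<omega>)) \<bullet> (G ({..<n} - {k}) \<omega> *\<^sub>v vec p (scaled_row \<mu> N p (\<lambda>j. X k j \<omega>)))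
        = (\<rho> \<cdot>\<^sub>v v k) \<bullet> (\<rho> \<cdot>\<^sub>v (G ({..<n} - {k}) \<omega> *\<^sub>v v k))"
      using mult_mat_vec[OF GM v] by simp
    also have "\<dots> = \<rho>\<^sup>2 * Q k \<omega>"
    proof -
      have "G ({..<n} - {k}) \<omega> *\<^sub>v v k \<in> carrier_vec p" by (rule mult_mat_vec_carrier[OF GM v])
      thus ?thesis using v[of k]
        by (simp only: Qv power2_eq_square smult_scalar_prod_distrib[of _ p] scalar_prod_smult_distrib[of _ p] smult_carrier_vec mult.assoc)
    qed
    also have "\<dots> = Q k \<omega> / N / (mean_row p k \<omega>)\<^sup>2"
      using N by (simp add: \<rho>_def power_divide power_mult_distrib)
    finally show "vec p (scaled_row \<mu> N p (\<lambda>j. X k j \<omega>)) \<bullet> (G ({..<n} - {k}) \<omega> *\<^sub>v vec p (scaled_row \<mu> N p (\<lambda>j. X k j \<omega>)))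
      = Q k \<omega> / N / (mean_row p k \<omega>)\<^sup>2" .
  qed
  finally show "real p - t * T \<omega> = (\<Sum>k<n. 1 - 1 / (1 + Q k \<omega> / N / (mean_row p k \<omega>)\<^sup>2))" .
qed

text \<open>Three errors add up: the fluctuation of the quadratic form around its conditional mean,
  the removal of one row from the trace, and the fluctuation of the trace itself. Before division by
  N they are of order sqrt p, 1 and sqrt n.\<close>

lemma Q_close:
  defines "Q\<^sub>0 \<equiv> \<sigma>\<^sup>2 * expectation T / N"
  shows "integrable M (\<lambda>\<omega>. \<bar>Q k \<omega> / N - Q\<^sub>0\<bar>)"
    and "expectation (\<lambda>\<omega>. \<bar>Q k \<omega> / N - Q\<^sub>0\<bar>)
      \<le> (sqrt (2 * \<kappa> * (p / t\<^sup>2)) + \<sigma>\<^sup>2 * (1 / t) + \<sigma>\<^sup>2 * (2 * exp (1 / 2) * (1 / t * sqrt n))) / N" (is "_ \<le> ?\<delta>")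
proof -
  define Z where "Z = (\<lambda>\<omega>. Q k \<omega> - \<sigma>\<^sup>2 * mtrace (G ({..<n} - {k}) \<omega>))"
  have Zm: "Z \<in> borel_measurable M" unfolding Z_def by measurable
  have "(\<integral>\<^sup>+\<omega>. (Z \<omega>)\<^sup>2 \<partial>M) \<le> ennreal (2 * \<kappa> * (p / t\<^sup>2))" unfolding Z_def by (rule Q_variance)
  note Z = second_moment_imp_abs[OF Zm _ this]
  have nn: "0 \<le> 2 * \<kappa> * (p / t\<^sup>2)" using kappa_nonneg by simp
  define B where "B = (\<lambda>\<omega>. (\<bar>Z \<omega>\<bar> + \<sigma>\<^sup>2 * (1 / t) + \<sigma>\<^sup>2 * \<bar>T \<omega> - expectation T\<bar>) / N)"
  have Bint: "integrable M B"
    unfolding B_def using Z(2)[OF nn] by (intro integrable_divide Bochner_Integration.integrable_add integrable_mult_right integrable_abs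
        Bochner_Integration.integrable_diff T_integrable integrable_const)
  have le: "\<bar>Q k \<omega> / N - Q\<^sub>0\<bar> \<le> B \<omega>" for \<omega>
  proof -
    have "Q k \<omega> / N - Q\<^sub>0 = (Z \<omega> + \<sigma>\<^sup>2 * (mtrace (G ({..<n} - {k}) \<omega>) - T \<omega>) + \<sigma>\<^sup>2 * (T \<omega> - expectation T)) / N"
      using N by (simp add: Z_def Q\<^sub>0_def field_simps)
    also have "\<bar>\<dots>\<bar> \<le> B \<omega>"
    proof -
      have "\<bar>mtrace (G ({..<n} - {k}) \<omega>) - T \<omega>\<bar> \<le> 1 / t"
        unfolding T_def G_def using mtrace_row_gram_remove[OF finite_lessThan t, of \<mu> N p "\<lambda>i j. X i j \<omega>" n k]
        by linarith
      hence "\<bar>\<sigma>\<^sup>2 * (mtrace (G ({..<n} - {k}) \<omega>) - T \<omega>)\<bar> \<le> \<sigma>\<^sup>2 * (1 / t)"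
        unfolding abs_mult by (intro mult_mono) auto
      moreover have "\<bar>\<sigma>\<^sup>2 * (T \<omega> - expectation T)\<bar> = \<sigma>\<^sup>2 * \<bar>T \<omega> - expectation T\<bar>"
        unfolding abs_mult by simp
      ultimately have "\<bar>Z \<omega> + \<sigma>\<^sup>2 * (mtrace (G ({..<n} - {k}) \<omega>) - T \<omega>) + \<sigma>\<^sup>2 * (T \<omega> - expectation T)\<bar>
          \<le> \<bar>Z \<omega>\<bar> + \<sigma>\<^sup>2 * (1 / t) + \<sigma>\<^sup>2 * \<bar>T \<omega> - expectation T\<bar>" by linarith
      thus ?thesis unfolding B_def abs_divide using N by (simp add: divide_right_mono)
    qed
    finally show ?thesis .
  qed
  show 1: "integrable M (\<lambda>\<omega>. \<bar>Q k \<omega> / N - Q\<^sub>0\<bar>)"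
    by (rule Bochner_Integration.integrable_bound[OF Bint]) (use le in \<open>auto intro!: AE_I2 intro: order_trans[OF _ abs_ge_self]\<close>)
  have "expectation (\<lambda>\<omega>. \<bar>Q k \<omega> / N - Q\<^sub>0\<bar>) \<le> expectation B" by (rule integral_mono[OF 1 Bint le])
  also have "\<dots> = (expectation (\<lambda>\<omega>. \<bar>Z \<omega>\<bar>) + \<sigma>\<^sup>2 * (1 / t) + \<sigma>\<^sup>2 * expectation (\<lambda>\<omega>. \<bar>T \<omega> - expectation T\<bar>)) / N"
    unfolding B_def using Z(2)[OF nn] prob_space by simp
  also have "\<dots> \<le> ?\<delta>"
    using N by (intro divide_right_mono add_mono Z(4)[OF nn] order_refl mult_left_mono[OF T_concentration(2)]) simp_all
  finally show "expectation (\<lambda>\<omega>. \<bar>Q k \<omega> / N - Q\<^sub>0\<bar>)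
      \<le> ?\<delta>" .
qed

text \<open>In each of the n summands of the trace identity the random Q_k / N and m_k^2 are
  replaced by constants; their mean errors are averaged and rescaled by n / p. The explicit bound
  permits n, p and N to vary together afterwards.\<close>

lemma expected_trace_equation:
  defines "s \<equiv> expectation T / p"
  shows "0 \<le> s" "s \<le> 1 / t"
    and "\<bar>1 - t * s - (n / p) * (1 - 1 / (1 + \<sigma>\<^sup>2 / \<mu>\<^sup>2 * (p / N) * s))\<bar>
      \<le> (n / p) * (((sqrt (2 * \<kappa> * (p / t\<^sup>2)) + \<sigma>\<^sup>2 * (1 / t) + \<sigma>\<^sup>2 * (2 * exp (1 / 2) * (1 / t * sqrt n))) / N
          + (\<sigma>\<^sup>2 / p + 2 * \<mu> * sqrt (\<sigma>\<^sup>2 / p))) / \<mu>\<^sup>2)" (is "?lhs \<le> ?rhs")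
proof -
  have ET: "0 \<le> expectation T" "expectation T \<le> p / t"
    using T_bounds T_integrable by (auto intro: integral_le_const)
  show "0 \<le> s" using ET by (simp add: s_def)
  show "s \<le> 1 / t" using ET p by (simp add: s_def field_simps)
  define Q\<^sub>0 where "Q\<^sub>0 = \<sigma>\<^sup>2 * expectation T / N"
  have Q0: "0 \<le> Q\<^sub>0" using ET N by (simp add: Q\<^sub>0_def)
  \<comment> \<open>The common value of the summands 1 / (1 + q_k) once Q_k / N is replaced by
    \<open>Q\<^sub>0\<close> and m_k by \<mu>.\<close>
  define A where "A = \<mu>\<^sup>2 / (\<mu>\<^sup>2 + Q\<^sub>0)"
  define \<delta>\<^sub>1 where "\<delta>\<^sub>1 = (sqrt (2 * \<kappa> * (p / t\<^sup>2)) + \<sigma>\<^sup>2 * (1 / t) + \<sigma>\<^sup>2 * (2 * exp (1 / 2) * (1 / t * sqrt n))) / N"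
  define \<delta>\<^sub>2 where "\<delta>\<^sub>2 = \<sigma>\<^sup>2 / p + 2 * \<mu> * sqrt (\<sigma>\<^sup>2 / p)"
  define E where "E = (\<lambda>k \<omega>. (\<bar>Q k \<omega> / N - Q\<^sub>0\<bar> + \<bar>(mean_row p k \<omega>)\<^sup>2 - \<mu>\<^sup>2\<bar>) / \<mu>\<^sup>2)"
  have Eint: "integrable M (E k)" for k
    unfolding E_def Q\<^sub>0_def by (intro integrable_divide Bochner_Integration.integrable_add Q_close mean_row_square_close p)
  have Ele: "expectation (E k) \<le> (\<delta>\<^sub>1 + \<delta>\<^sub>2) / \<mu>\<^sup>2" for k
  proof -
    have "expectation (E k) = (expectation (\<lambda>\<omega>. \<bar>Q k \<omega> / N - Q\<^sub>0\<bar>) + expectation (\<lambda>\<omega>. \<bar>(mean_row p k \<omega>)\<^sup>2 - \<mu>\<^sup>2\<bar>)) / \<mu>\<^sup>2"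
      unfolding E_def Q\<^sub>0_def by (subst integral_divide_zero, subst Bochner_Integration.integral_add) (simp_all add: Q_close(1) mean_row_square_close(1) p)
    also have "\<dots> \<le> (\<delta>\<^sub>1 + \<delta>\<^sub>2) / \<mu>\<^sup>2"
      unfolding \<delta>\<^sub>1_def \<delta>\<^sub>2_def Q\<^sub>0_def by (intro divide_right_mono add_mono Q_close mean_row_square_close p) simp
    finally show ?thesis .
  qed
  have AE: "AE \<omega> in M. \<bar>real p - t * T \<omega> - n * (1 - A)\<bar> \<le> (\<Sum>k<n. E k \<omega>)"
  proof -
    have "AE \<omega> in M. \<forall>k\<in>{..<n}. 0 < mean_row p k \<omega>" by (rule AE_finite_allI) (auto intro: mean_row_pos p)
    thus ?thesis
    proof eventually_elim
      case (elim \<omega>)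
      have "real p - t * T \<omega> - n * (1 - A) = (\<Sum>k<n. A - 1 / (1 + Q k \<omega> / N / (mean_row p k \<omega>)\<^sup>2))"
        unfolding trace_identity by (simp add: sum_subtractf algebra_simps)
      hence "\<bar>real p - t * T \<omega> - n * (1 - A)\<bar> = \<bar>\<Sum>k<n. A - 1 / (1 + Q k \<omega> / N / (mean_row p k \<omega>)\<^sup>2)\<bar>"
        by (rule arg_cong)
      also have "\<dots> \<le> (\<Sum>k<n. \<bar>A - 1 / (1 + Q k \<omega> / N / (mean_row p k \<omega>)\<^sup>2)\<bar>)" by (rule sum_abs)
      also have "\<dots> \<le> (\<Sum>k<n. E k \<omega>)"
      proof (rule sum_mono)
        fix k assume "k \<in> {..<n}"
        hence "0 < mean_row p k \<omega>" using elim by blast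
        hence r: "0 < (mean_row p k \<omega>)\<^sup>2" by simp
        have "1 / (1 + Q k \<omega> / N / (mean_row p k \<omega>)\<^sup>2) = (mean_row p k \<omega>)\<^sup>2 / ((mean_row p k \<omega>)\<^sup>2 + Q k \<omega> / N)"
        proof -
          have "1 + Q k \<omega> / N / (mean_row p k \<omega>)\<^sup>2 = ((mean_row p k \<omega>)\<^sup>2 + Q k \<omega> / N) / (mean_row p k \<omega>)\<^sup>2"
            using r by (simp add: add_divide_distrib)
          thus ?thesis by simp
        qed
        hence "\<bar>A - 1 / (1 + Q k \<omega> / N / (mean_row p k \<omega>)\<^sup>2)\<bar> = \<bar>(mean_row p k \<omega>)\<^sup>2 / ((mean_row p k \<omega>)\<^sup>2 + Q k \<omega> / N) - \<mu>\<^sup>2 / (\<mu>\<^sup>2 + Q\<^sub>0)\<bar>"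
          by (simp add: A_def abs_minus_commute)
        also have "\<dots> \<le> E k \<omega>"
          unfolding E_def using r Q_nonneg N Q0 mu_pos by (intro ratio_difference_bound) auto
        finally show "\<bar>A - 1 / (1 + Q k \<omega> / N / (mean_row p k \<omega>)\<^sup>2)\<bar> \<le> E k \<omega>" .
      qed
      finally show ?case .
    qed
  qed
  have intL: "integrable M (\<lambda>\<omega>. real p - t * T \<omega> - n * (1 - A))" by simp
  have "real p - t * expectation T - n * (1 - A) = expectation (\<lambda>\<omega>. real p - t * T \<omega> - n * (1 - A))"
    using prob_space by simp
  also have "\<bar>\<dots>\<bar> \<le> expectation (\<lambda>\<omega>. \<bar>real p - t * T \<omega> - n * (1 - A)\<bar>)" by (rule integral_abs_bound)
  also have "\<dots> \<le> expectation (\<lambda>\<omega>. \<Sum>k<n. E k \<omega>)"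
    by (rule integral_mono_AE) (use intL Eint AE in \<open>auto intro!: Bochner_Integration.integrable_sum\<close>)
  also have "\<dots> = (\<Sum>k<n. expectation (E k))" using Eint by (simp add: Bochner_Integration.integral_sum)
  also have "\<dots> \<le> (\<Sum>k<n. (\<delta>\<^sub>1 + \<delta>\<^sub>2) / \<mu>\<^sup>2)" by (rule sum_mono) (rule Ele)
  finally have main: "\<bar>real p - t * expectation T - n * (1 - A)\<bar> \<le> n * ((\<delta>\<^sub>1 + \<delta>\<^sub>2) / \<mu>\<^sup>2)" by simp
  have Aeq: "A = 1 / (1 + \<sigma>\<^sup>2 / \<mu>\<^sup>2 * (p / N) * s)"
  proof -
    have "1 + \<sigma>\<^sup>2 / \<mu>\<^sup>2 * (p / N) * s = (\<mu>\<^sup>2 + Q\<^sub>0) / \<mu>\<^sup>2"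
      using p mu_pos by (simp add: s_def Q\<^sub>0_def add_divide_distrib)
    thus ?thesis by (simp add: A_def)
  qed
  have "1 - t * s - (n / p) * (1 - A) = (real p - t * expectation T - n * (1 - A)) / p"
    using p by (simp add: s_def diff_divide_distrib)
  also have "\<bar>\<dots>\<bar> \<le> n * ((\<delta>\<^sub>1 + \<delta>\<^sub>2) / \<mu>\<^sup>2) / p"
    unfolding abs_divide abs_of_nat by (rule divide_right_mono[OF main]) simp
  finally show "?lhs \<le> ?rhs"
    unfolding Aeq[symmetric] \<delta>\<^sub>1_def[symmetric] \<delta>\<^sub>2_def[symmetric] by (simp add: mult_ac)
qed

end

end

section \<open>The centred matrix and its spectral measure\<close>

lemma centering_mat_entry:
  "i < n \<Longrightarrow> j < n \<Longrightarrow> centering_mat n $$ (i, j) = (if i = j then 1 else 0) - 1 / real n"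
  by (simp add: centering_mat_def ones_col_def times_mat_def scalar_prod_def)

lemma centering_mat_carrier: "centering_mat n \<in> carrier_mat n n"
  by (auto simp: centering_mat_def ones_col_def)

text \<open>Multiplication by the centring matrix on one side already subtracts the column
  means.\<close>

lemma centered_product_entry:
  assumes A: "A \<in> carrier_mat n p" and jk: "j < p" "k < p"
  shows "(transpose_mat A * centering_mat n * A) $$ (j, k)
    = (\<Sum>i<n. A $$ (i, j) * A $$ (i, k)) - (\<Sum>i<n. A $$ (i, j)) * (\<Sum>i<n. A $$ (i, k)) / real n"
proof -
  note C = centering_mat_carrier[of n]
  have "(transpose_mat A * centering_mat n) $$ (j, i) = A $$ (i, j) - (\<Sum>l<n. A $$ (l, j)) / real n" if i: "i < n" for i
  proof -
    have "(transpose_mat A * centering_mat n) $$ (j, i) = (\<Sum>l<n. A $$ (l, j) * ((if l = i then 1 else 0) - 1 / real n))"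
      using A C i jk centering_mat_entry[of _ n i] by (simp add: scalar_prod_def atLeast0LessThan)
    also have "\<dots> = (\<Sum>l<n. (if l = i then A $$ (i, j) else 0) - A $$ (l, j) / real n)"
      by (intro sum.cong) (auto simp: algebra_simps)
    finally show ?thesis using i by (simp add: sum_subtractf sum_divide_distrib)
  qed
  moreover have "(transpose_mat A * centering_mat n * A) $$ (j, k)
      = (\<Sum>i<n. (transpose_mat A * centering_mat n) $$ (j, i) * A $$ (i, k))"
  proof -
    have "transpose_mat A * centering_mat n \<in> carrier_mat p n" using A C by auto
    thus ?thesis using A jk by (auto simp: index_mult_mat(1) scalar_prod_def atLeast0LessThan simp del: assoc_mult_mat)
  qed
  ultimately have "(transpose_mat A * centering_mat n * A) $$ (j, k)
      = (\<Sum>i<n. (A $$ (i, j) - (\<Sum>l<n. A $$ (l, j)) / real n) * A $$ (i, k))"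
    by simp
  also have "\<dots> = (\<Sum>i<n. A $$ (i, j) * A $$ (i, k)) - (\<Sum>i<n. (\<Sum>l<n. A $$ (l, j)) / real n * A $$ (i, k))"
    unfolding left_diff_distrib sum_subtractf ..
  also have "(\<Sum>i<n. (\<Sum>l<n. A $$ (l, j)) / real n * A $$ (i, k)) = (\<Sum>i<n. A $$ (i, j)) * (\<Sum>i<n. A $$ (i, k)) / real n"
    unfolding sum_distrib_left[symmetric] by simp
  finally show ?thesis .
qed

lemma B_mat_carrier: "B_mat w n p \<in> carrier_mat p p"
  using centering_mat_carrier[of n] by (auto simp: B_mat_def compositional_mat_def)

text \<open>The factor p^2 / N is shared equally between the two copies of the data matrix. As p
  times a compositional entry is the entry over its row mean, \<open>D\<close> is the array scaled
  by 1 / (m_i sqrt N).\<close>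

lemma B_mat_entry:
  fixes w :: "nat \<Rightarrow> nat \<Rightarrow> real"
  assumes "2 \<le> n" "j < p" "k < p"
  defines "D \<equiv> \<lambda>i j. real p * (w (Suc i) (Suc j) / (\<Sum>l = 1..p. w (Suc i) l)) / sqrt (real (n - 1))"
  shows "B_mat w n p $$ (j, k) = (\<Sum>i<n. D i j * D i k) - (\<Sum>i<n. D i j) * (\<Sum>i<n. D i k) / real n"
proof -
  define A where "A = compositional_mat w n p"
  define s where "s = real p / sqrt (real (n - 1))"
  have A: "A \<in> carrier_mat n p" by (simp add: A_def compositional_mat_def)
  have D: "D i j = s * A $$ (i, j)" if "i < n" "j < p" for i j
    using that by (simp add: D_def s_def A_def compositional_mat_def)
  have s2: "s * s = (real p)\<^sup>2 / real (n - 1)" using assms(1) by (simp add: s_def power2_eq_square)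
  have "B_mat w n p $$ (j, k) = s * s * ((\<Sum>i<n. A $$ (i, j) * A $$ (i, k)) - (\<Sum>i<n. A $$ (i, j)) * (\<Sum>i<n. A $$ (i, k)) / real n)"
  proof -
    have "transpose_mat A * centering_mat n * A \<in> carrier_mat p p" using A centering_mat_carrier[of n] by auto
    thus ?thesis unfolding B_mat_def A_def[symmetric] s2 using assms(2,3)
      by (subst index_smult_mat(1)) (auto simp only: carrier_matD centered_product_entry[OF A])
  qed
  also have "\<dots> = s * s * (\<Sum>i<n. A $$ (i, j) * A $$ (i, k)) - (s * (\<Sum>i<n. A $$ (i, j))) * (s * (\<Sum>i<n. A $$ (i, k))) / real n"
    unfolding right_diff_distrib by (simp only: mult_ac times_divide_eq_right)
  also have "s * (\<Sum>i<n. A $$ (i, j)) = (\<Sum>i<n. D i j)"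
    unfolding sum_distrib_left using assms(2) by (intro sum.cong) (auto simp: D)
  also have "s * (\<Sum>i<n. A $$ (i, k)) = (\<Sum>i<n. D i k)"
    unfolding sum_distrib_left using assms(3) by (intro sum.cong) (auto simp: D)
  also have "s * s * (\<Sum>i<n. A $$ (i, j) * A $$ (i, k)) = (\<Sum>i<n. D i j * D i k)"
    unfolding sum_distrib_left using assms(2,3) by (intro sum.cong) (auto simp: D)
  finally show ?thesis .
qed

text \<open>Since the centring matrix is a symmetric idempotent, the matrix is the Gram matrix of
  the column-centred data; the computation checks this entrywise.\<close>

lemma psd_B_mat:
  assumes "2 \<le> n" shows "psd p (B_mat w n p)"
proof -
  define D where "D = (\<lambda>i j. real p * (w (Suc i) (Suc j) / (\<Sum>l = 1..p. w (Suc i) l)) / sqrt (real (n - 1)))"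
  define S where "S = (\<lambda>j. \<Sum>i<n. D i j)"
  have "B_mat w n p = gram p (\<lambda>i j. D i j - S j / real n) {..<n}"
  proof (rule eq_matI)
    fix j k assume "j < dim_row (gram p (\<lambda>i j. D i j - S j / real n) {..<n})" "k < dim_col (gram p (\<lambda>i j. D i j - S j / real n) {..<n})"
    hence jk: "j < p" "k < p" by (auto simp: gram_def)
    have n: "real n \<noteq> 0" using assms by simp
    have "(\<Sum>i<n. (D i j - S j / real n) * (D i k - S k / real n))
        = (\<Sum>i<n. D i j * D i k - D i j * (S k / n) - S j / n * D i k + S j / n * (S k / n))"
      by (intro sum.cong refl) (simp add: algebra_simps)
    also have "\<dots> = (\<Sum>i<n. D i j * D i k) - S j * (S k / n) - S j / n * S k + n * (S j / n * (S k / n))"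
      by (simp only: sum.distrib sum_subtractf sum_distrib_left[symmetric] sum_distrib_right[symmetric]
          sum_constant card_lessThan of_nat_mult) (simp add: S_def)
    also have "\<dots> = (\<Sum>i<n. D i j * D i k) - S j * S k / n" using n by (simp add: field_simps)
    finally show "B_mat w n p $$ (j, k) = gram p (\<lambda>i j. D i j - S j / real n) {..<n} $$ (j, k)"
      using B_mat_entry[OF assms jk, of w] jk by (simp add: gram_def S_def D_def)
  qed (use B_mat_carrier[of w n p] in \<open>auto simp: gram_def\<close>)
  thus ?thesis by (simp add: psd_gram)
qed

text \<open>Every added rank-one term lowers the trace by at most 1/t, so the traces for B and S
  exceed the common one by at most 2/t and 1/t. Stating the relation with additions on both sides
  keeps every matrix positive semidefinite.\<close>

lemma mtrace_resolvent_low_rank: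
  assumes "psd p B" "psd p S" "0 < t"
    and v: "h \<in> carrier_vec p" "e \<in> carrier_vec p" "u \<in> carrier_vec p"
    and eq: "B + outer h h + outer e e = S + outer u u"
  shows "\<bar>mtrace (resolvent t B) - mtrace (resolvent t S)\<bar> \<le> 2 / t"
proof -
  note 1 = mtrace_resolvent_add_outer[OF assms(1,3) v(1)]
  note 2 = mtrace_resolvent_add_outer[OF psd_add_outer[OF assms(1) v(1)] assms(3) v(2)]
  note 3 = mtrace_resolvent_add_outer[OF assms(2,3) v(3)]
  have "2 / t = 1 / t + 1 / t" "0 < 1 / t" using assms(3) by auto
  thus ?thesis using 1 2 3 unfolding eq by linarith
qed

section \<open>The empirical measure of a multiset\<close>

definition empirical :: "real multiset \<Rightarrow> real measure" where
  "empirical E = distr (measure_pmf (pmf_of_multiset E)) borel (\<lambda>x. x)"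

lemma real_distribution_empirical: "real_distribution (empirical E)"
proof -
  interpret prob_space "empirical E"
    unfolding empirical_def by (rule measure_pmf.prob_space_distr) simp
  show ?thesis by unfold_locales (auto simp: empirical_def)
qed

lemma integral_empirical:
  fixes g :: "real \<Rightarrow> real"
  assumes "E \<noteq> {#}" and g: "g \<in> borel_measurable borel"
  shows "(\<integral>x. g x \<partial>empirical E) = (\<Sum>l\<in>#E. g l) / size E"
proof -
  have "(\<integral>x. g x \<partial>empirical E) = measure_pmf.expectation (pmf_of_multiset E) g"
    unfolding empirical_def by (rule integral_distr) (use g in auto)
  also have "\<dots> = (\<Sum>a\<in>set_mset E. pmf (pmf_of_multiset E) a *\<^sub>R g a)"
    by (rule integral_measure_pmf) (use assms in \<open>auto simp: set_pmf_of_multiset\<close>)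
  also have "\<dots> = (\<Sum>a\<in>set_mset E. real (count E a) * g a) / size E"
    using assms by (simp add: pmf_of_multiset sum_divide_distrib)
  also have "(\<Sum>a\<in>set_mset E. real (count E a) * g a) = (\<Sum>l\<in>#E. g l)"
  proof -
    have fin: "finite (set_mset E)" by simp
    have "(\<Sum>a\<in>A. real (count F a) * g a) = (\<Sum>l\<in>#F. g l)" if "finite A" "set_mset F \<subseteq> A" for F A
      using that
    proof (induction F)
      case (add x F)
      have "(\<Sum>a\<in>A. real (count (add_mset x F) a) * g a) = (\<Sum>a\<in>A. real (count F a) * g a + (if a = x then g a else 0))"
        by (intro sum.cong) (auto simp: algebra_simps)
      thus ?case using add by (simp add: sum.distrib)
    qed simp
    from this[OF fin order_refl] show ?thesis .
  qed
  finally show ?thesis .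
qed

lemma AE_empirical:
  assumes "E \<noteq> {#}" "\<And>l. l \<in># E \<Longrightarrow> 0 \<le> l"
  shows "AE x in empirical E. 0 \<le> x"
  unfolding empirical_def by (subst AE_distr_iff) (use assms in \<open>auto simp: AE_measure_pmf_iff set_pmf_of_multiset\<close>)

lemma cdf_empirical:
  assumes "E \<noteq> {#}"
  shows "cdf (empirical E) x = size {#l \<in># E. l \<le> x#} / size E"
proof -
  interpret real_distribution "empirical E" by (rule real_distribution_empirical)
  have "cdf (empirical E) x = (\<integral>y. indicator {..x} y \<partial>empirical E)"
    by (simp add: cdf_def)
  also have "\<dots> = (\<Sum>l\<in>#E. indicator {..x} l) / size E"
    by (rule integral_empirical[OF assms]) simp
  also have "(\<Sum>l\<in>#E. indicator {..x} l) = real (size {#l \<in># E. l \<le> x#})"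
    by (induction E) auto
  finally show ?thesis .
qed

section \<open>Almost sure limit of the resolvent trace\<close>

text \<open>Borel-Cantelli is applied at the thresholds 1 / (k + 1), and the countably many null
  sets are united.\<close>

lemma (in prob_space) AE_tendsto_0_of_summable_prob:
  fixes Z :: "nat \<Rightarrow> 'a \<Rightarrow> real"
  assumes [measurable]: "\<And>n. Z n \<in> borel_measurable M"
    and sum: "\<And>e. 0 < e \<Longrightarrow> summable (\<lambda>n. prob {\<omega> \<in> space M. e \<le> \<bar>Z n \<omega>\<bar>})"
  shows "AE \<omega> in M. (\<lambda>n. Z n \<omega>) \<longlonglongrightarrow> 0"
proof -
  have "AE \<omega> in M. \<forall>k. eventually (\<lambda>n. \<bar>Z n \<omega>\<bar> < 1 / real (Suc k)) sequentially"
  proof (rule AE_all_countable[THEN iffD2, rule_format])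
    fix k
    have "AE \<omega> in M. eventually (\<lambda>n. \<omega> \<in> space M - {\<omega> \<in> space M. 1 / real (Suc k) \<le> \<bar>Z n \<omega>\<bar>}) sequentially"
      by (rule borel_cantelli_AE1) (use sum in \<open>auto simp: less_top[symmetric]\<close>)
    thus "AE \<omega> in M. eventually (\<lambda>n. \<bar>Z n \<omega>\<bar> < 1 / real (Suc k)) sequentially"
      by eventually_elim (auto elim: eventually_mono)
  qed
  thus ?thesis
  proof eventually_elim
    case (elim \<omega>)
    show ?case
    proof (rule tendstoI)
      fix e :: real assume "0 < e"
      then obtain k where k: "1 / real (Suc k) < e" using nat_approx_posE by blast
      have "eventually (\<lambda>n. \<bar>Z n \<omega>\<bar> < 1 / real (Suc k)) sequentially" using elim by blast
      thus "eventually (\<lambda>n. dist (Z n \<omega>) 0 < e) sequentially"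
        by eventually_elim (use k in \<open>simp add: dist_real_def\<close>)
    qed
  qed
qed

context iid_array
begin

section \<open>Passage to the limit along a sequence of dimensions\<close>

context
  fixes p :: "nat \<Rightarrow> nat" and c t m :: real
  assumes p: "filterlim p at_top sequentially"
    and ratio: "(\<lambda>n. real (p n) / real (n - 1)) \<longlonglongrightarrow> c" and c: "0 < c"
    and t: "0 < t" and m: "0 \<le> m" and \<sigma>: "0 < \<sigma>\<^sup>2"
    and m_eq: "1 - t * m = (1 / c) * (1 - 1 / (1 + \<sigma>\<^sup>2 / \<mu>\<^sup>2 * c * m))"
begin

abbreviation \<tau> :: "nat \<Rightarrow> 'a \<Rightarrow> real" where
  "\<tau> n \<equiv> T n (p n) (real (n - 1)) t"

lemma ev_dims: "eventually (\<lambda>n. 2 \<le> n \<and> 0 < p n) sequentially"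
proof -
  have "eventually (\<lambda>n. 1 \<le> p n) sequentially" using p by (simp add: filterlim_at_top)
  with eventually_ge_at_top[of 2] show ?thesis by eventually_elim auto
qed

text \<open>The finite equation has coefficients n / p and p / (n - 1) instead of 1/c and c.
  Exchanging them adds to the residual a term that tends to 0, and stability of the limit equation
  converts the residual into the distance from m.\<close>

lemma expected_trace_limit:
  "(\<lambda>n. expectation (\<tau> n) / p n) \<longlonglongrightarrow> m"
proof -
  define \<gamma> where "\<gamma> = \<sigma>\<^sup>2 / \<mu>\<^sup>2"
  have \<gamma>: "0 < \<gamma>" using \<sigma> mu_pos by (simp add: \<gamma>_def)
  define s where "s = (\<lambda>n. expectation (\<tau> n) / p n)"
  define err where "err = (\<lambda>n. (n / p n) * (((sqrt (2 * \<kappa> * (p n / t\<^sup>2)) + \<sigma>\<^sup>2 * (1 / t) + \<sigma>\<^sup>2 * (2 * exp (1 / 2) * (1 / t * sqrt n))) / real (n - 1)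
          + (\<sigma>\<^sup>2 / p n + 2 * \<mu> * sqrt (\<sigma>\<^sup>2 / p n))) / \<mu>\<^sup>2))"
  define C where "C = (\<lambda>n. real (p n) / real (n - 1))"
  have np: "(\<lambda>n. real n / p n) \<longlonglongrightarrow> 1 / c"
  proof -
    \<comment> \<open>The Gram matrix has n rows whereas the ratio is assumed for n - 1; the
      quotient of the two tends to 1.\<close>
    have "(\<lambda>n. (real n / real (n - 1)) / C n) \<longlonglongrightarrow> 1 / c"
    proof (rule tendsto_divide)
      show "(\<lambda>n. real n / real (n - 1)) \<longlonglongrightarrow> 1" by real_asymp
      show "C \<longlonglongrightarrow> c" using ratio by (simp add: C_def[abs_def])
    qed (use c in simp)
    moreover have "eventually (\<lambda>n. (real n / real (n - 1)) / C n = real n / p n) sequentially"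
      using ev_dims by eventually_elim (simp add: C_def)
    ultimately show ?thesis by (rule Lim_transform_eventually)
  qed
  have pr: "filterlim (\<lambda>n. real (p n)) at_top sequentially"
    by (rule filterlim_compose[OF filterlim_real_sequentially p])
  have err0: "err \<longlonglongrightarrow> 0"
  proof -
    have 1: "(\<lambda>n. sqrt (2 * \<kappa> * (p n / t\<^sup>2)) / real (n - 1)) \<longlonglongrightarrow> 0"
    proof -
      have "(\<lambda>n. sqrt (2 * \<kappa> / t\<^sup>2 * C n * (1 / real (n - 1)))) \<longlonglongrightarrow> sqrt (2 * \<kappa> / t\<^sup>2 * c * 0)"
      proof (intro tendsto_real_sqrt tendsto_mult tendsto_const)
        show "C \<longlonglongrightarrow> c" using ratio by (simp add: C_def[abs_def])
        show "(\<lambda>n. 1 / real (n - 1)) \<longlonglongrightarrow> 0" by real_asymp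
      qed
      moreover have "sqrt (2 * \<kappa> / t\<^sup>2 * C n * (1 / real (n - 1))) = sqrt (2 * \<kappa> * (p n / t\<^sup>2)) / real (n - 1)" for n
      proof -
        have "2 * \<kappa> / t\<^sup>2 * C n * (1 / real (n - 1)) = 2 * \<kappa> * (p n / t\<^sup>2) / (real (n - 1))\<^sup>2"
          by (simp add: C_def power2_eq_square)
        thus ?thesis by (simp only: real_sqrt_divide real_sqrt_abs abs_of_nat)
      qed
      ultimately show ?thesis by simp
    qed
    have 2: "(\<lambda>n. \<sigma>\<^sup>2 * (1 / t) / real (n - 1)) \<longlonglongrightarrow> 0" by real_asymp
    have 3: "(\<lambda>n. \<sigma>\<^sup>2 * (2 * exp (1 / 2) * (1 / t * sqrt n)) / real (n - 1)) \<longlonglongrightarrow> 0"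
    proof -
      have "(\<lambda>n. sqrt (real n) / real (n - 1)) \<longlonglongrightarrow> 0" by real_asymp
      from tendsto_mult_left[OF this, of "\<sigma>\<^sup>2 * (2 * exp (1 / 2) * (1 / t))"] show ?thesis by (simp add: mult_ac)
    qed
    have 4: "(\<lambda>n. \<sigma>\<^sup>2 / p n) \<longlonglongrightarrow> 0" by (rule real_tendsto_divide_at_top[OF tendsto_const pr])
    have "err \<longlonglongrightarrow> (1 / c) * ((((0 + 0) + 0) + (0 + 2 * \<mu> * sqrt 0)) / \<mu>\<^sup>2)"
      unfolding err_def add_divide_distrib[of _ _ "real (_ - 1)"]
      using mu_pos by (intro tendsto_mult np tendsto_divide tendsto_add 1 2 3 4 tendsto_const tendsto_real_sqrt) auto
    thus ?thesis by simp
  qed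
  \<comment> \<open>The sum of the finite-size error and of both coefficient changes, divided by the
    stability constant t. The bound s <= 1/t makes it free of s.\<close>
  define bnd where "bnd = (\<lambda>n. (err n + (\<bar>real n / p n - 1 / c\<bar> + (1 / c) * (\<gamma> * (1 / t) * \<bar>C n - c\<bar>))) / t)"
  have "bnd \<longlonglongrightarrow> (0 + (\<bar>1 / c - 1 / c\<bar> + (1 / c) * (\<gamma> * (1 / t) * \<bar>c - c\<bar>))) / t"
    unfolding bnd_def C_def using t by (intro tendsto_intros err0 np ratio) auto
  hence bnd0: "bnd \<longlonglongrightarrow> 0" by simp
  have "eventually (\<lambda>n. norm (s n - m) \<le> bnd n) sequentially"
    using ev_dims
  proof eventually_elim
    case (elim n)
    hence dims: "0 < n" "0 < p n" "0 < real (n - 1)" by auto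
    note e = expected_trace_equation[OF dims t]
    have s: "0 \<le> s n" "s n \<le> 1 / t" unfolding s_def by (fact e)+
    define A where "A = 1 / (1 + \<gamma> * c * s n)"
    define A' where "A' = 1 / (1 + \<gamma> * C n * s n)"
    have C0: "0 \<le> C n" by (simp add: C_def)
    have d1: "1 \<le> 1 + \<gamma> * c * s n" "1 \<le> 1 + \<gamma> * C n * s n" using \<gamma> c s C0 by auto
    have A01: "0 \<le> 1 - A'" "1 - A' \<le> 1" using d1 by (auto simp: A'_def)
    have AA: "\<bar>A - A'\<bar> \<le> \<gamma> * (1 / t) * \<bar>C n - c\<bar>"
    proof -
      have "A - A' = (\<gamma> * s n * (C n - c)) / ((1 + \<gamma> * c * s n) * (1 + \<gamma> * C n * s n))"
      proof -
        have "1 + \<gamma> * c * s n \<noteq> 0" "1 + \<gamma> * C n * s n \<noteq> 0" using d1 by linarith+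
        thus ?thesis unfolding A_def A'_def by (simp add: diff_frac_eq algebra_simps)
      qed
      also have "\<bar>\<dots>\<bar> \<le> \<bar>\<gamma> * s n * (C n - c)\<bar> / 1"
        unfolding abs_divide
      proof (rule divide_left_mono)
        show "1 \<le> \<bar>(1 + \<gamma> * c * s n) * (1 + \<gamma> * C n * s n)\<bar>"
          using mult_mono[OF d1] d1 by simp
      qed (use d1 in auto)
      also have "\<dots> = \<gamma> * s n * \<bar>C n - c\<bar>" using \<gamma> s by (simp add: abs_mult)
      also have "\<dots> \<le> \<gamma> * (1 / t) * \<bar>C n - c\<bar>" using \<gamma> s by (intro mult_right_mono mult_left_mono) auto
      finally show ?thesis .
    qed
    have "\<bar>1 - t * s n - (n / p n) * (1 - A')\<bar> \<le> err n"
      using e(3) unfolding A'_def \<gamma>_def C_def s_def err_def by simp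
    moreover have "\<bar>(n / p n) * (1 - A') - (1 / c) * (1 - A)\<bar> \<le> \<bar>real n / p n - 1 / c\<bar> + (1 / c) * (\<gamma> * (1 / t) * \<bar>C n - c\<bar>)"
    proof -
      have "(n / p n) * (1 - A') - (1 / c) * (1 - A) = (n / p n - 1 / c) * (1 - A') + (1 / c) * (A - A')"
        by (simp add: algebra_simps diff_divide_distrib)
      hence "\<bar>(n / p n) * (1 - A') - (1 / c) * (1 - A)\<bar> \<le> \<bar>n / p n - 1 / c\<bar> * \<bar>1 - A'\<bar> + \<bar>1 / c\<bar> * \<bar>A - A'\<bar>"
        by (metis abs_mult abs_triangle_ineq)
      also have "\<dots> \<le> \<bar>n / p n - 1 / c\<bar> * 1 + (1 / c) * (\<gamma> * (1 / t) * \<bar>C n - c\<bar>)"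
        using A01 AA c by (intro add_mono mult_mono) auto
      finally show ?thesis by simp
    qed
    moreover have "\<bar>x - z\<bar> \<le> u + v" if "\<bar>x - y\<bar> \<le> u" "\<bar>y - z\<bar> \<le> v" for x y z u v :: real
      using that by linarith
    ultimately have "\<bar>1 - t * s n - (1 / c) * (1 - A)\<bar> \<le> err n + (\<bar>real n / p n - 1 / c\<bar> + (1 / c) * (\<gamma> * (1 / t) * \<bar>C n - c\<bar>))"
      by blast
    moreover have "t * \<bar>s n - m\<bar> \<le> \<bar>1 - t * s n - (1 / c) * (1 - A)\<bar>"
      unfolding A_def by (rule mp_equation_contraction[OF c \<gamma> t s(1) m]) (use m_eq in \<open>simp add: \<gamma>_def\<close>)
    ultimately show "norm (s n - m) \<le> bnd n"
      using t by (simp add: bnd_def field_simps)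
  qed
  hence "(\<lambda>n. s n - m) \<longlonglongrightarrow> 0" by (rule Lim_null_comparison[OF _ bnd0])
  thus ?thesis unfolding s_def by (rule LIM_zero_cancel)
qed

text \<open>The trace deviates on the scale sqrt n while p grows like n, so a deviation of e p has
  probability exponentially small in n.\<close>

lemma AE_trace_limit:
  "AE \<omega> in M. (\<lambda>n. \<tau> n \<omega> / p n) \<longlonglongrightarrow> m"
proof -
  define s where "s = (\<lambda>n. expectation (\<tau> n) / p n)"
  \<comment> \<open>Small dimensions are set to 0, so that \<open>Z n\<close> is measurable for
    every n.\<close>
  define Z where "Z = (\<lambda>n \<omega>. if 2 \<le> n \<and> 0 < p n then \<tau> n \<omega> / p n - s n else 0)"
  have Zm: "Z n \<in> borel_measurable M" for n
  proof (cases "2 \<le> n \<and> 0 < p n")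
    case True
    hence dims: "0 < n" "0 < p n" "0 < real (n - 1)" by auto
    show ?thesis using True T_measurable[OF dims t] by (simp add: Z_def)
  next
    case False
    hence "Z n = (\<lambda>_. 0)" by (auto simp: Z_def fun_eq_iff)
    thus ?thesis by simp
  qed
  have "AE \<omega> in M. (\<lambda>n. Z n \<omega>) \<longlonglongrightarrow> 0"
  proof (rule AE_tendsto_0_of_summable_prob[OF Zm])
    fix e :: real assume e: "0 < e"
    \<comment> \<open>From p >= c n / 4 the exponent (e p)^2 t^2 / (2 n) is at least n times this
      constant.\<close>
    define \<delta> where "\<delta> = e\<^sup>2 * c\<^sup>2 * t\<^sup>2 / 32"
    have \<delta>: "0 < \<delta>" using e c t by (simp add: \<delta>_def)
    have "eventually (\<lambda>n. c / 2 < real (p n) / real (n - 1)) sequentially"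
      using ratio c by (intro order_tendstoD) auto
    hence "eventually (\<lambda>n. norm (prob {\<omega> \<in> space M. e \<le> \<bar>Z n \<omega>\<bar>}) \<le> 2 * exp (- \<delta>) ^ n) sequentially"
      using ev_dims
    proof eventually_elim
      case (elim n)
      hence dims: "0 < n" "0 < p n" "0 < real (n - 1)" by auto
      define P where "P = real (p n)"
      have P: "0 < P" using elim by (simp add: P_def)
      have "{\<omega> \<in> space M. e \<le> \<bar>Z n \<omega>\<bar>} = {\<omega> \<in> space M. e * P \<le> \<bar>\<tau> n \<omega> - expectation (\<tau> n)\<bar>}"
      proof -
        have "Z n \<omega> = (\<tau> n \<omega> - expectation (\<tau> n)) / P" for \<omega>
          using elim by (simp add: Z_def s_def P_def diff_divide_distrib)
        thus ?thesis using P by (simp add: abs_divide pos_le_divide_eq)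
      qed
      moreover have "0 < e * P" using e P by simp
      ultimately have "prob {\<omega> \<in> space M. e \<le> \<bar>Z n \<omega>\<bar>} \<le> 2 * exp (- (e * P)\<^sup>2 / (2 * n * (1 / t)\<^sup>2))"
        using T_concentration(1)[OF dims t] by simp
      also have "- (e * P)\<^sup>2 / (2 * n * (1 / t)\<^sup>2) \<le> real n * (- \<delta>)"
      proof -
        have "c / 2 * real (n - 1) < P" using elim(1) dims by (simp add: P_def pos_less_divide_eq)
        \<comment> \<open>Uses n <= 2 (n - 1), valid from n = 2 on.\<close>
        moreover have "c / 4 * real n \<le> c / 2 * real (n - 1)" using elim(2) c by (simp add: field_simps)
        ultimately have "c / 4 * real n \<le> P" by linarith
        hence "(c / 4 * real n)\<^sup>2 \<le> P\<^sup>2" using c by (intro power_mono) auto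
        hence "e\<^sup>2 * t\<^sup>2 / (2 * n) * (c / 4 * real n)\<^sup>2 \<le> e\<^sup>2 * t\<^sup>2 / (2 * n) * P\<^sup>2" by (rule mult_left_mono) simp
        also have "e\<^sup>2 * t\<^sup>2 / (2 * n) * (c / 4 * real n)\<^sup>2 = real n * \<delta>"
          using dims by (simp add: \<delta>_def power2_eq_square)
        also have "e\<^sup>2 * t\<^sup>2 / (2 * n) * P\<^sup>2 = (e * P)\<^sup>2 / (2 * n * (1 / t)\<^sup>2)"
          using t by (simp add: power_mult_distrib power_divide)
        finally show ?thesis by simp
      qed
      hence "2 * exp (- (e * P)\<^sup>2 / (2 * n * (1 / t)\<^sup>2)) \<le> 2 * exp (- \<delta>) ^ n"
        by (simp add: exp_of_nat_mult[symmetric])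
      finally show "norm (prob {\<omega> \<in> space M. e \<le> \<bar>Z n \<omega>\<bar>}) \<le> 2 * exp (- \<delta>) ^ n" by simp
    qed
    moreover have "summable (\<lambda>n. 2 * exp (- \<delta>) ^ n)" using \<delta> by (intro summable_mult summable_geometric) simp
    ultimately show "summable (\<lambda>n. prob {\<omega> \<in> space M. e \<le> \<bar>Z n \<omega>\<bar>})" by (rule summable_comparison_test_ev)
  qed
  thus ?thesis
  proof eventually_elim
    case (elim \<omega>)
    have "(\<lambda>n. Z n \<omega> + s n) \<longlonglongrightarrow> 0 + m"
      using elim expected_trace_limit unfolding s_def by (rule tendsto_add)
    moreover have "eventually (\<lambda>n. Z n \<omega> + s n = \<tau> n \<omega> / p n) sequentially"
      using ev_dims by eventually_elim (simp add: Z_def)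
    ultimately show ?case by (simp add: Lim_transform_eventually)
  qed
qed

end

end

section \<open>The limiting spectral distribution\<close>

text \<open>The closed form of the transform, with the atom included, is the root singled out in
  \<open>mp_equation_root\<close>, which links the measure to the trace equation.\<close>

lemma mp_measure_exists:
  fixes \<mu> \<sigma> c :: real
  assumes \<mu>: "0 < \<mu>" and \<sigma>: "0 < \<sigma>\<^sup>2" and c: "0 < c"
  defines "\<gamma> \<equiv> \<sigma>\<^sup>2 / \<mu>\<^sup>2"
  defines "a \<equiv> \<gamma> * (1 - sqrt c)\<^sup>2" and "b \<equiv> \<gamma> * (1 + sqrt c)\<^sup>2"
  obtains \<nu> :: "real measure" where "real_distribution \<nu>"
    and "\<And>A. A \<in> sets borel \<Longrightarrow> emeasure \<nu> A =
            (\<integral>\<^sup>+x \<in> A. ennreal (mp_density \<mu> \<sigma> c x) \<partial>lborel)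
            + (if c > 1 then ennreal (1 - 1 / c) * indicator A 0 else 0)"
    and "AE x in \<nu>. 0 \<le> x"
    and "\<And>t. 0 < t \<Longrightarrow> (\<integral>x. 1 / (x + t) \<partial>\<nu>) = (sqrt ((a + t) * (b + t)) - t + \<gamma> * (c - 1)) / (2 * c * \<gamma> * t)"
proof -
  have \<gamma>: "0 < \<gamma>" using \<mu> \<sigma> by (simp add: \<gamma>_def)
  note ab = mp_edges[OF c \<gamma>, folded a_def b_def]
  define g where "g = (\<lambda>x. sqrt ((b - x) * (x - a)) / (2 * pi * c * \<gamma> * x))"
  define r where "r = (if c > 1 then ennreal (1 - 1 / c) else 0)"
  have f_eq: "mp_density \<mu> \<sigma> c x = (if x \<in> {a..b} then g x else 0)" for x
  proof -
    have "\<mu>\<^sup>2 / (2 * pi * c * \<sigma>\<^sup>2 * x) = 1 / (2 * pi * c * \<gamma> * x)"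
      using \<mu> by (simp add: \<gamma>_def)
    thus ?thesis by (simp add: mp_density_def Let_def a_def b_def g_def \<gamma>_def)
  qed
  have g0: "0 \<le> g x" if "x \<in> {a..b}" for x
    using that ab(1) c \<gamma> by (auto simp: g_def)
  have f_ind: "ennreal (mp_density \<mu> \<sigma> c x) = ennreal (g x) * indicator {a..b} x" for x
    by (simp add: f_eq indicator_def)
  have fm: "(\<lambda>x. ennreal (mp_density \<mu> \<sigma> c x)) \<in> borel_measurable borel"
    unfolding f_ind g_def by measurable
  obtain \<nu> where \<nu>: "sets \<nu> = sets borel" "space \<nu> = UNIV"
    "\<And>A. A \<in> sets borel \<Longrightarrow> emeasure \<nu> A = (\<integral>\<^sup>+x \<in> A. ennreal (mp_density \<mu> \<sigma> c x) \<partial>lborel) + r * indicator A 0"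
    using density_plus_atom_exists[OF fm, of r] by blast
  have mass: "(\<integral>\<^sup>+x. ennreal (g x) * indicator {a..b} x \<partial>lborel) = ennreal ((1 + c - \<bar>1 - c\<bar>) / (2 * c))"
    by (rule nn_integral_has_integral_lebesgue'[OF g0]) (use has_integral_mp_mass[OF c \<gamma>, folded a_def b_def] in \<open>simp_all add: g_def\<close>)
  have "emeasure \<nu> UNIV = ennreal ((1 + c - \<bar>1 - c\<bar>) / (2 * c)) + r"
    using \<nu>(3)[of UNIV] mass by (simp add: f_ind)
  also have "\<dots> = 1"
  proof (cases "c > 1")
    case True
    hence "(1 + c - \<bar>1 - c\<bar>) / (2 * c) = 1 / c" by simp
    thus ?thesis using True by (simp add: r_def ennreal_plus[symmetric] del: ennreal_plus)
  qed (use c in \<open>simp add: r_def\<close>)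
  finally have "prob_space \<nu>" by (intro prob_spaceI) (simp add: \<nu>)
  hence rd: "real_distribution \<nu>" using \<nu> by (simp add: real_distribution_def real_distribution_axioms_def)
  have AE: "AE x in \<nu>. 0 \<le> x"
  proof (rule AE_I)
    have "emeasure \<nu> {..<0} = (\<integral>\<^sup>+x. ennreal (mp_density \<mu> \<sigma> c x) * indicator {..<0} x \<partial>lborel)"
      by (subst \<nu>(3)) auto
    also have "\<dots> = (\<integral>\<^sup>+x. 0 \<partial>(lborel :: real measure))"
      using ab(1) by (intro nn_integral_cong) (auto simp: f_eq indicator_def)
    finally show "emeasure \<nu> {..<0} = 0" by simp
  qed (use \<nu> in auto)
  have st: "(\<integral>x. 1 / (x + t) \<partial>\<nu>) = (sqrt ((a + t) * (b + t)) - t + \<gamma> * (c - 1)) / (2 * c * \<gamma> * t)" if t: "0 < t" for t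
  proof -
    define m\<^sub>0 where "m\<^sub>0 = (sqrt ((a + t) * (b + t)) - t - \<gamma> * \<bar>1 - c\<bar>) / (2 * c * \<gamma> * t)"
    define H where "H = (\<lambda>x. ennreal (indicator {0..} x * (1 / (x + t))))"
    have Hm: "H \<in> borel_measurable borel" unfolding H_def by measurable
    have hi: "((\<lambda>x. g x * (1 / (x + t))) has_integral m\<^sub>0) {a..b}"
      using has_integral_mp_stieltjes[OF c \<gamma> t, folded a_def b_def] by (simp add: g_def m\<^sub>0_def)
    have gt0: "0 \<le> g x * (1 / (x + t))" if "x \<in> {a..b}" for x
      using g0[OF that] that ab(1) t by (intro mult_nonneg_nonneg) auto
    have m0: "0 \<le> m\<^sub>0" by (rule has_integral_nonneg[OF hi gt0])
    have "(\<integral>\<^sup>+x. ennreal (mp_density \<mu> \<sigma> c x) * H x \<partial>lborel) = (\<integral>\<^sup>+x. ennreal (g x * (1 / (x + t))) * indicator {a..b} x \<partial>lborel)"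
      using ab(1) t by (intro nn_integral_cong) (auto simp: f_ind H_def ennreal_mult[symmetric] g0 indicator_def)
    also have "\<dots> = ennreal m\<^sub>0" by (rule nn_integral_has_integral_lebesgue'[OF gt0 hi])
    finally have 1: "(\<integral>\<^sup>+x. ennreal (mp_density \<mu> \<sigma> c x) * H x \<partial>lborel) = ennreal m\<^sub>0" .
    have "(\<integral>\<^sup>+x. ennreal (1 / (x + t)) \<partial>\<nu>) = (\<integral>\<^sup>+x. H x \<partial>\<nu>)"
      by (rule nn_integral_cong_AE) (use AE in \<open>eventually_elim, simp add: H_def\<close>)
    also have "\<dots> = ennreal m\<^sub>0 + r * H 0"
      unfolding 1[symmetric] by (rule nn_integral_density_plus_atom[OF \<nu>(1) fm \<nu>(3) Hm])
    also have "r * H 0 = ennreal ((if c > 1 then 1 - 1 / c else 0) * (1 / t))"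
      using t c by (auto simp: r_def H_def ennreal_mult[symmetric])
    also have "ennreal m\<^sub>0 + \<dots> = ennreal (m\<^sub>0 + (if c > 1 then 1 - 1 / c else 0) * (1 / t))"
      using m0 t c by (subst ennreal_plus) auto
    \<comment> \<open>The atom adds (1 - 1/c) / t exactly when c > 1, which replaces -|1 - c| by c -
      1 in the numerator and removes the case distinction.\<close>
    also have "m\<^sub>0 + (if c > 1 then 1 - 1 / c else 0) * (1 / t) = (sqrt ((a + t) * (b + t)) - t + \<gamma> * (c - 1)) / (2 * c * \<gamma> * t)"
    proof (cases "c > 1")
      case True
      thus ?thesis using \<gamma> t unfolding m\<^sub>0_def by (simp add: divide_simps)
    qed (simp add: m\<^sub>0_def algebra_simps)
    finally have nn: "(\<integral>\<^sup>+x. ennreal (1 / (x + t)) \<partial>\<nu>) = ennreal ((sqrt ((a + t) * (b + t)) - t + \<gamma> * (c - 1)) / (2 * c * \<gamma> * t))" .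
    have "(\<integral>x. 1 / (x + t) \<partial>\<nu>) = enn2real (\<integral>\<^sup>+x. ennreal (1 / (x + t)) \<partial>\<nu>)"
    proof (rule integral_eq_nn_integral)
      show "(\<lambda>x. 1 / (x + t)) \<in> borel_measurable \<nu>" using \<nu>(1) by (simp cong: measurable_cong_sets)
      show "AE x in \<nu>. 0 \<le> 1 / (x + t)" using AE by eventually_elim (use t in simp)
    qed
    thus ?thesis
      using mp_equation_root(1)[OF c \<gamma> t, folded a_def b_def] by (simp add: nn)
  qed
  show thesis
  proof (rule that[OF rd _ AE st])
    fix A :: "real set" assume "A \<in> sets borel"
    thus "emeasure \<nu> A = (\<integral>\<^sup>+x \<in> A. ennreal (mp_density \<mu> \<sigma> c x) \<partial>lborel)
            + (if c > 1 then ennreal (1 - 1 / c) * indicator A 0 else 0)"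
      using \<nu>(3)[of A] by (simp add: r_def)
  qed
qed

text \<open>The scaled data are z_ij + v_i, with v_i constant along row i. Their Gram matrix is S +
  \<alpha> 1' + 1 \<alpha>' + L^2 1 1', and completing the square writes this as S + u u' - e e'.
  Centring subtracts a third rank-one term h h'.\<close>

lemma mtrace_resolvent_B_mat_close:
  fixes w :: "nat \<Rightarrow> nat \<Rightarrow> real"
  assumes n: "2 \<le> n" and p: "0 < p" and t: "0 < t" and \<mu>: "0 < \<mu>"
    and pos: "\<And>i j. 0 < w (Suc i) (Suc j)"
  shows "\<bar>mtrace (resolvent t (B_mat w n p))
      - mtrace (resolvent t (row_gram \<mu> (real (n - 1)) p (\<lambda>i j. w (Suc i) (Suc j)) {..<n}))\<bar> \<le> 2 / t"
proof -
  define N where "N = real (n - 1)"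
  have N: "0 < N" using n by (simp add: N_def)
  define \<rho> where "\<rho> = (\<lambda>i. row_mean p (\<lambda>j. w (Suc i) (Suc j)))"
  have \<rho>: "0 < \<rho> i" for i
    unfolding \<rho>_def row_mean_def using p pos by (intro divide_pos_pos sum_pos) auto
  define z where "z = (\<lambda>i. scaled_row \<mu> N p (\<lambda>j. w (Suc i) (Suc j)))"
  define v where "v = (\<lambda>i. \<mu> / (\<rho> i * sqrt N))"
  define D where "D = (\<lambda>i j. real p * (w (Suc i) (Suc j) / (\<Sum>l = 1..p. w (Suc i) l)) / sqrt (real (n - 1)))"
  have D: "D i j = z i j + v i" for i j
  proof -
    have "(\<Sum>l = 1..p. w (Suc i) l) = real p * \<rho> i"
      using p by (simp add: \<rho>_def row_mean_def sum.atLeast1_atMost_eq)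
    hence "D i j = w (Suc i) (Suc j) / (\<rho> i * sqrt N)" using p by (simp add: D_def N_def)
    also have "\<dots> = z i j + v i"
      by (simp add: z_def v_def scaled_row_def \<rho>_def diff_divide_distrib)
    finally show ?thesis .
  qed
  \<comment> \<open>The norm of v; its positivity permits the division by L when the square is
    completed.\<close>
  define L where "L = sqrt (\<Sum>i<n. (v i)\<^sup>2)"
  have L2: "L\<^sup>2 = (\<Sum>i<n. (v i)\<^sup>2)" unfolding L_def by (simp add: sum_nonneg)
  have "0 < (\<Sum>i<n. (v i)\<^sup>2)"
  proof (rule sum_pos)
    fix i have "0 < v i" unfolding v_def using \<mu> \<rho> N by simp
    thus "0 < (v i)\<^sup>2" by simp
  qed (use n in \<open>auto simp: lessThan_empty_iff\<close>)
  hence L: "0 < L" by (simp add: L_def)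
  define \<alpha> where "\<alpha> = (\<lambda>j. \<Sum>i<n. z i j * v i)"
  \<comment> \<open>\<open>h\<close> is the column-sum term removed by the centring matrix;
    \<open>e\<close> and \<open>u\<close> come from (L + \<alpha> j / L) (L + \<alpha> k / L), whose
    excess term is \<alpha> j \<alpha> k / L^2.\<close>
  define h where "h = vec p (\<lambda>j. (\<Sum>i<n. D i j) / sqrt (real n))"
  define e where "e = vec p (\<lambda>j. \<alpha> j / L)"
  define u where "u = vec p (\<lambda>j. L + \<alpha> j / L)"
  have S: "row_gram \<mu> (real (n - 1)) p (\<lambda>i j. w (Suc i) (Suc j)) {..<n} = gram p z {..<n}"
    by (simp add: row_gram_def z_def N_def)
  have eq: "B_mat w n p + outer h h + outer e e = gram p z {..<n} + outer u u"
  proof (rule eq_matI)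
    fix j k assume "j < dim_row (gram p z {..<n} + outer u u)" "k < dim_col (gram p z {..<n} + outer u u)"
    hence jk: "j < p" "k < p" by (auto simp: u_def outer_def)
    have "(B_mat w n p + outer h h + outer e e) $$ (j, k)
        = B_mat w n p $$ (j, k) + (\<Sum>i<n. D i j) * (\<Sum>i<n. D i k) / real n + \<alpha> j * \<alpha> k / L\<^sup>2"
      using jk B_mat_carrier[of w n p] by (simp add: outer_def h_def e_def power2_eq_square)
    also have "\<dots> = (\<Sum>i<n. D i j * D i k) + \<alpha> j * \<alpha> k / L\<^sup>2"
      unfolding B_mat_entry[OF n jk] D_def by simp
    also have "(\<Sum>i<n. D i j * D i k) = (\<Sum>i<n. z i j * z i k + z i j * v i + z i k * v i + (v i)\<^sup>2)"
      unfolding D by (intro sum.cong refl) (simp add: algebra_simps power2_eq_square)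
    also have "\<dots> = (\<Sum>i<n. z i j * z i k) + \<alpha> j + \<alpha> k + L\<^sup>2"
      unfolding L2 \<alpha>_def by (simp add: sum.distrib)
    also have "\<dots> + \<alpha> j * \<alpha> k / L\<^sup>2 = (\<Sum>i<n. z i j * z i k) + (L + \<alpha> j / L) * (L + \<alpha> k / L)"
      using L by (simp add: field_simps power2_eq_square)
    also have "\<dots> = (gram p z {..<n} + outer u u) $$ (j, k)"
      using jk by (simp add: gram_def outer_def u_def)
    finally show "(B_mat w n p + outer h h + outer e e) $$ (j, k) = (gram p z {..<n} + outer u u) $$ (j, k)" .
  qed (auto simp: outer_def e_def u_def)
  show ?thesis
    unfolding S by (rule mtrace_resolvent_low_rank[OF psd_B_mat[OF n] psd_gram t _ _ _ eq]) (auto simp: h_def e_def u_def)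
qed

text \<open>Equality of laws carries integrability and expectation of any Borel function from entry
  (1, 1) to every entry; reindexing by \<open>Suc\<close> preserves independence because it is
  injective.\<close>

lemma (in prob_space) iid_arrayI:
  fixes w :: "nat \<Rightarrow> nat \<Rightarrow> 'a \<Rightarrow> real" and \<mu> \<sigma> :: real
  assumes indep: "indep_vars (\<lambda>_. borel) (\<lambda>(i, j). w i j) ({1..} \<times> {1..})"
    and ident: "\<And>i j. i \<ge> 1 \<Longrightarrow> j \<ge> 1 \<Longrightarrow> distr M borel (w i j) = distr M borel (w 1 1)"
    and pos: "\<And>i j. i \<ge> 1 \<Longrightarrow> j \<ge> 1 \<Longrightarrow> AE \<omega> in M. w i j \<omega> > 0"
    and integrable: "integrable M (w 1 1)"
    and mean: "expectation (w 1 1) = \<mu>" "\<mu> > 0"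
    and var: "variance (w 1 1) = \<sigma>\<^sup>2"
    and fourth_moment: "integrable M (\<lambda>\<omega>. \<bar>w 1 1 \<omega> - \<mu>\<bar> ^ 4)"
  shows "iid_array M (\<lambda>i j. w (Suc i) (Suc j)) \<mu> \<sigma> (expectation (\<lambda>\<omega>. (w 1 1 \<omega> - \<mu>) ^ 4))"
proof -
  have wm: "w i j \<in> borel_measurable M" if "i \<ge> 1" "j \<ge> 1" for i j
  proof -
    have "\<forall>a\<in>{1..} \<times> {1..}. (case a of (i, j) \<Rightarrow> w i j) \<in> borel_measurable M"
      using indep unfolding indep_vars_def by blast
    from bspec[OF this, of "(i, j)"] that show ?thesis by simp
  qed
  have transfer: "integrable M (\<lambda>\<omega>. g (w (Suc i) (Suc j) \<omega>)) \<longleftrightarrow> integrable M (\<lambda>\<omega>. g (w 1 1 \<omega>))"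
    "expectation (\<lambda>\<omega>. g (w (Suc i) (Suc j) \<omega>)) = expectation (\<lambda>\<omega>. g (w 1 1 \<omega>))"
    if g: "g \<in> borel_measurable borel" for g :: "real \<Rightarrow> real" and i j
  proof -
    have w: "w (Suc i) (Suc j) \<in> borel_measurable M" "w 1 1 \<in> borel_measurable M" by (intro wm; simp)+
    show "integrable M (\<lambda>\<omega>. g (w (Suc i) (Suc j) \<omega>)) \<longleftrightarrow> integrable M (\<lambda>\<omega>. g (w 1 1 \<omega>))"
      using integrable_distr_eq[OF w(1) g] integrable_distr_eq[OF w(2) g] ident[of "Suc i" "Suc j"] by simp
    show "expectation (\<lambda>\<omega>. g (w (Suc i) (Suc j) \<omega>)) = expectation (\<lambda>\<omega>. g (w 1 1 \<omega>))"
      using integral_distr[OF w(1) g] integral_distr[OF w(2) g] ident[of "Suc i" "Suc j"] by simp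
  qed
  have "indep_vars (\<lambda>a. PiM {(Suc (fst a), Suc (snd a))} (\<lambda>_. borel))
      (\<lambda>a \<omega>. restrict (\<lambda>b. (case b of (i, j) \<Rightarrow> w i j) \<omega>) {(Suc (fst a), Suc (snd a))}) UNIV"
    by (rule indep_vars_restrict[OF indep]) (auto simp: disjoint_family_on_def)
  hence "indep_vars (\<lambda>_. borel)
      (\<lambda>a \<omega>. (\<lambda>r. r (Suc (fst a), Suc (snd a))) (restrict (\<lambda>b. (case b of (i, j) \<Rightarrow> w i j) \<omega>) {(Suc (fst a), Suc (snd a))})) UNIV"
    by (rule indep_vars_compose2[where Y = "\<lambda>a r. r (Suc (fst a), Suc (snd a))"]) (auto intro: measurable_component_singleton)
  hence ind: "indep_vars (\<lambda>_. borel) (\<lambda>(i, j). w (Suc i) (Suc j)) UNIV"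
    by (simp add: case_prod_beta')
  show ?thesis
  proof unfold_locales
    show "indep_vars (\<lambda>_. borel) (\<lambda>(i, j). w (Suc i) (Suc j)) UNIV" by (rule ind)
    fix i j
    show "AE \<omega> in M. 0 < w (Suc i) (Suc j) \<omega>" by (rule pos) simp_all
    have "integrable M (\<lambda>\<omega>. (w 1 1 \<omega> - \<mu>) ^ 4)" using fourth_moment by (simp only: power_even_abs_numeral even_numeral)
    thus "integrable M (\<lambda>\<omega>. (w (Suc i) (Suc j) \<omega> - \<mu>) ^ 4)"
      by (subst transfer(1)) simp_all
    show "expectation (\<lambda>\<omega>. (w (Suc i) (Suc j) \<omega> - \<mu>) ^ 4) = expectation (\<lambda>\<omega>. (w 1 1 \<omega> - \<mu>) ^ 4)"
      by (rule transfer(2)) simp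
    have "expectation (\<lambda>\<omega>. w (Suc i) (Suc j) \<omega> - \<mu>) = expectation (\<lambda>\<omega>. w 1 1 \<omega> - \<mu>)"
      by (rule transfer(2)) simp
    also have "\<dots> = expectation (w 1 1) - \<mu>"
      by (subst Bochner_Integration.integral_diff[OF integrable]) (simp_all add: prob_space)
    finally show "expectation (\<lambda>\<omega>. w (Suc i) (Suc j) \<omega> - \<mu>) = 0" unfolding mean by simp
    have "expectation (\<lambda>\<omega>. (w (Suc i) (Suc j) \<omega> - \<mu>)\<^sup>2) = expectation (\<lambda>\<omega>. (w 1 1 \<omega> - \<mu>)\<^sup>2)"
      by (rule transfer(2)) simp
    also have "\<dots> = \<sigma>\<^sup>2" using var unfolding mean .
    finally show "expectation (\<lambda>\<omega>. (w (Suc i) (Suc j) \<omega> - \<mu>)\<^sup>2) = \<sigma>\<^sup>2" .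
  qed (rule mean)
qed

theorem theorem2p3:
  fixes M :: "'a measure"
    and w :: "nat \<Rightarrow> nat \<Rightarrow> 'a \<Rightarrow> real"
    and p :: "nat \<Rightarrow> nat"
    and \<mu> \<sigma> c :: real
  assumes "prob_space M"
    and indep: "prob_space.indep_vars M (\<lambda>_. borel) (\<lambda>(i, j). w i j) ({1..} \<times> {1..})"
    and ident: "\<And>i j. i \<ge> 1 \<Longrightarrow> j \<ge> 1 \<Longrightarrow> distr M borel (w i j) = distr M borel (w 1 1)"
    and pos: "\<And>i j. i \<ge> 1 \<Longrightarrow> j \<ge> 1 \<Longrightarrow> AE \<omega> in M. w i j \<omega> > 0"
    and integrable: "integrable M (w 1 1)"
    and mean: "prob_space.expectation M (w 1 1) = \<mu>" "\<mu> > 0"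
    and var: "prob_space.variance M (w 1 1) = \<sigma>\<^sup>2" "\<sigma>\<^sup>2 > 0"
    and fourth_moment: "integrable M (\<lambda>\<omega>. \<bar>w 1 1 \<omega> - \<mu>\<bar> ^ 4)"
    and p_infty: "filterlim p at_top sequentially"
    and ratio: "(\<lambda>n. real (p n) / real (n - 1)) \<longlonglongrightarrow> c" "c > 0"
  shows "\<exists>\<nu> :: real measure. real_distribution \<nu> \<and>
           (\<forall>A \<in> sets borel. emeasure \<nu> A =
              (\<integral>\<^sup>+x \<in> A. ennreal (mp_density \<mu> \<sigma> c x) \<partial>lborel)
              + (if c > 1 then ennreal (1 - 1 / c) * indicator A 0 else 0)) \<and>
           (AE \<omega> in M. weak_conv (\<lambda>n. esd (B_mat (\<lambda>i j. w i j \<omega>) n (p n))) (cdf \<nu>))"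
proof -
  interpret prob_space M by fact
  interpret iid: iid_array M "\<lambda>i j. w (Suc i) (Suc j)" \<mu> \<sigma> "expectation (\<lambda>\<omega>. (w 1 1 \<omega> - \<mu>) ^ 4)"
    by (rule iid_arrayI[OF indep ident pos integrable mean var(1) fourth_moment])
  define \<gamma> where "\<gamma> = \<sigma>\<^sup>2 / \<mu>\<^sup>2"
  have \<gamma>: "0 < \<gamma>" using mean var by (simp add: \<gamma>_def)
  define a where "a = \<gamma> * (1 - sqrt c)\<^sup>2"
  define b where "b = \<gamma> * (1 + sqrt c)\<^sup>2"
  define m where "m = (\<lambda>t. (sqrt ((a + t) * (b + t)) - t + \<gamma> * (c - 1)) / (2 * c * \<gamma> * t))"
  obtain \<nu> where \<nu>: "real_distribution \<nu>"
    "\<And>A. A \<in> sets borel \<Longrightarrow> emeasure \<nu> A =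
            (\<integral>\<^sup>+x \<in> A. ennreal (mp_density \<mu> \<sigma> c x) \<partial>lborel)
            + (if c > 1 then ennreal (1 - 1 / c) * indicator A 0 else 0)"
    "AE x in \<nu>. 0 \<le> x" "\<And>t. 0 < t \<Longrightarrow> (\<integral>x. 1 / (x + t) \<partial>\<nu>) = m t"
  proof (rule mp_measure_exists[OF mean(2) var(2) ratio(2)], goal_cases)
    case (1 \<nu>)
    show ?case
    proof (rule that[of \<nu>])
      show "real_distribution \<nu>" by (rule 1)
      show "AE x in \<nu>. 0 \<le> x" by (rule 1)
      show "(\<integral>x. 1 / (x + t) \<partial>\<nu>) = m t" if "0 < t" for t
        using 1(5)[OF that] by (simp only: m_def a_def b_def \<gamma>_def)
    qed (rule 1)
  qed
  \<comment> \<open>The evaluation points t = 1 - h j lie in [1/2, 1) and accumulate at 1, as the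
    expansion in powers of h requires.\<close>
  define h where "h = (\<lambda>j :: nat. 1 / (real j + 2))"
  have h: "0 < h j" "h j \<le> 1 / 2" "0 < 1 - h j" for j by (auto simp: h_def field_simps)
  have h0: "h \<longlonglongrightarrow> 0" unfolding h_def by real_asymp
  \<comment> \<open>Countably many points share one null set, after which \<omega> is fixed and the
    remaining argument is deterministic.\<close>
  have "AE \<omega> in M. \<forall>j. (\<lambda>n. iid.T n (p n) (real (n - 1)) (1 - h j) \<omega> / p n) \<longlonglongrightarrow> m (1 - h j)"
  proof (rule AE_all_countable[THEN iffD2, rule_format])
    fix j
    have root: "0 \<le> m (1 - h j)" "1 - (1 - h j) * m (1 - h j) = (1 / c) * (1 - 1 / (1 + \<gamma> * c * m (1 - h j)))"
      unfolding m_def a_def b_def by (rule mp_equation_root[OF ratio(2) \<gamma> h(3)])+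
    show "AE \<omega> in M. (\<lambda>n. iid.T n (p n) (real (n - 1)) (1 - h j) \<omega> / p n) \<longlonglongrightarrow> m (1 - h j)"
      by (rule iid.AE_trace_limit[OF p_infty ratio h(3) root(1) var(2) root(2)[unfolded \<gamma>_def]])
  qed
  moreover have "AE \<omega> in M. \<forall>i j. 0 < w (Suc i) (Suc j) \<omega>"
    unfolding AE_all_countable by (intro allI iid.pos)
  ultimately have "AE \<omega> in M. weak_conv (\<lambda>n. esd (B_mat (\<lambda>i j. w i j \<omega>) n (p n))) (cdf \<nu>)"
  proof eventually_elim
    case (elim \<omega>)
    define W where "W = (\<lambda>i j. w i j \<omega>)"
    have Wpos: "0 < W (Suc i) (Suc j)" for i j using elim(2) by (simp add: W_def)
    define ok where "ok = (\<lambda>n. 2 \<le> n \<and> 0 < p n)"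
    have ok: "eventually ok sequentially"
    proof -
      have "eventually (\<lambda>n. 1 \<le> p n) sequentially" using p_infty by (simp add: filterlim_at_top)
      with eventually_ge_at_top[of 2] show ?thesis by eventually_elim (simp add: ok_def)
    qed
    (* Finitely many n with an empty spectrum or a junk value of 1 / (n - 1) are skipped. *)
    define E where "E = (\<lambda>n. if ok n then eigenvalues (B_mat W n (p n)) else {#0#})"
    have psd: "psd (p n) (B_mat W n (p n))" if "ok n" for n
      using that psd_B_mat by (simp add: ok_def)
    have E: "E n \<noteq> {#}" "\<And>l. l \<in># E n \<Longrightarrow> 0 \<le> l" for n
    proof -
      show "E n \<noteq> {#}"
      proof (cases "ok n")
        case True
        hence "size (E n) = p n" using eigenvalues_psd(1)[OF psd] by (simp add: E_def)
        thus ?thesis using True by (auto simp: ok_def)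
      qed (simp add: E_def)
      show "0 \<le> l" if "l \<in># E n" for l
        using that eigenvalues_psd(2)[OF psd] by (cases "ok n") (auto simp: E_def)
    qed
    have lim: "(\<lambda>n. \<integral>x. 1 / (x + (1 - h j)) \<partial>empirical (E n)) \<longlonglongrightarrow> (\<integral>x. 1 / (x + (1 - h j)) \<partial>\<nu>)" for j
    proof -
      define t where "t = 1 - h j"
      have t: "0 < t" using h by (simp add: t_def)
      define I where "I = (\<lambda>n. \<integral>x. 1 / (x + t) \<partial>empirical (E n))"
      have pr: "filterlim (\<lambda>n. real (p n)) at_top sequentially"
        by (rule filterlim_compose[OF filterlim_real_sequentially p_infty])
      \<comment> \<open>The rank-three comparison costs 2/t in the trace, which disappears after
        division by p.\<close>
      have "eventually (\<lambda>n. norm (I n - iid.T n (p n) (real (n - 1)) t \<omega> / p n) \<le> 2 / t / p n) sequentially"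
        using ok
      proof eventually_elim
        case (elim n)
        hence dims: "0 < n" "0 < p n" "0 < real (n - 1)" and n2: "2 \<le> n" by (auto simp: ok_def)
        have "I n = mtrace (resolvent t (B_mat W n (p n))) / p n"
          unfolding I_def using elim E(1)[of n] eigenvalues_psd[OF psd[OF elim]] t
          by (subst integral_empirical) (auto simp: E_def)
        moreover have "iid.T n (p n) (real (n - 1)) t \<omega>
            = mtrace (resolvent t (row_gram \<mu> (real (n - 1)) (p n) (\<lambda>i j. W (Suc i) (Suc j)) {..<n}))"
          unfolding iid.T_def[OF dims t] iid.G_def[OF dims t] W_def ..
        moreover note mtrace_resolvent_B_mat_close[OF n2 dims(2) t mean(2), of W, OF Wpos]
        ultimately show ?case
          unfolding real_norm_def by (simp only: diff_divide_distrib[symmetric] abs_divide abs_of_nat) (rule divide_right_mono, auto)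
      qed
      moreover have "(\<lambda>n. 2 / t / p n) \<longlonglongrightarrow> 0" by (rule real_tendsto_divide_at_top[OF tendsto_const pr])
      ultimately have "(\<lambda>n. I n - iid.T n (p n) (real (n - 1)) t \<omega> / p n) \<longlonglongrightarrow> 0" by (rule Lim_null_comparison)
      from tendsto_add[OF this, of "\<lambda>n. iid.T n (p n) (real (n - 1)) t \<omega> / p n" "m t"] elim(1)
      have "I \<longlonglongrightarrow> m t" by (simp add: t_def)
      thus ?thesis using \<nu>(4)[OF t] by (simp add: I_def t_def)
    qed
    have "weak_conv_m (\<lambda>n. empirical (E n)) \<nu>"
      by (rule stieltjes_imp_weak_conv[OF real_distribution_empirical AE_empirical[OF E] \<nu>(1,3) h(1,2) h0 lim])
    hence wc: "isCont (cdf \<nu>) x \<Longrightarrow> (\<lambda>n. cdf (empirical (E n)) x) \<longlonglongrightarrow> cdf \<nu> x" for x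
      by (simp add: weak_conv_m_def weak_conv_def)
    have esd: "eventually (\<lambda>n. cdf (empirical (E n)) x = esd (B_mat W n (p n)) x) sequentially" for x
      using ok
    proof eventually_elim
      case (elim n)
      have "dim_row (B_mat W n (p n)) = p n" using B_mat_carrier[of W n "p n"] by auto
      thus ?case using elim cdf_empirical[OF E(1), of n x] eigenvalues_psd(1)[OF psd[OF elim]]
        by (simp add: esd_def E_def)
    qed
    show ?case
      unfolding weak_conv_def W_def[symmetric] by (intro allI impI Lim_transform_eventually[OF wc esd])
  qed
  with \<nu>(1,2) show ?thesis by (intro exI[of _ \<nu>] conjI ballI)
qed

end
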